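(* There is a universal constant $c>0$ such that the following holds. Let $X\subseteq\mathbb{R}^d$ have reach $\tau_X>0$ and let $\varepsilon\in(0,1)$. Then there exist an integer $m\le c\,\varepsilon^{-2}\,\omega(S_X)^2$ and a terminal embedding $f\colon\mathbb{R}^d\to\mathbb{R}^{m+1}$ of $X$ with distortion $\varepsilon$ such that $f$ is locally $\tfrac14$-Hölder on $X+B(0,\tau_X/2)$: for every $u\in\mathbb{R}^d$ with $d(u,X)<\tau_X/2$ there exist a neighborhood $U$ of $u$ and a constant $C_u>0$, depending only on $d(u,X)$ and $\varepsilon$, such that \[\|f(v)-f(w)\|\le C_u\|v-w\|^{1/4}\quad\forall\,v,w\in U.\]
   Context: All norms are Euclidean; $B(x,r)$ is the open ball of center $x$ and radius $r$, $d(x,X)=\inf_{y\in X}\|x-y\|$, and $\overline{X}$ is the closure. The reach of $X$ is $\tau_X=\sup\{t\ge0:\ \text{every }x\in\mathbb{R}^d\text{ with }d(x,X)<t\text{ has a unique closest point in }\overline{X}\}$. The unit secants of $X$ are $S_X=\overline{\{(x-y)/\|x-y\|: x\ne y\in X\}}\subseteq S^{d-1}$. The Gaussian width of $T\subseteq\mathbb{R}^d$ is $\omega(T)=\mathbb{E}\sup_{x\in T}\langle g,x\rangle$, with $g$ a standard Gaussian vector in $\mathbb{R}^d$. For $X\subseteq\mathbb{R}^d$ and $\varepsilon\in(0,1)$, a map $f\colon\mathbb{R}^d\to\mathbb{R}^{k}$ is a terminal embedding of $X$ with distortion $\varepsilon$ if $(1-\varepsilon)\|x-y\|\le\|f(x)-f(y)\|\le(1+\varepsilon)\|x-y\|$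 for all $x\in X$ and all $y\in\mathbb{R}^d$. $X+B(0,r)$ denotes the Minkowski sum. *)

theory Defs
  imports "HOL-Probability.Probability"
begin

text \<open>Since the universal constant must not depend on the ambient dimension d, and the
target dimension m+1 is existentially quantified, points of R^d are represented
explicitly as functions nat => real vanishing at all indices >= d.\<close>

definition rvec :: "nat \<Rightarrow> (nat \<Rightarrow> real) set" where
  "rvec d = {x. \<forall>i\<ge>d. x i = 0}"

definition einner :: "nat \<Rightarrow> (nat \<Rightarrow> real) \<Rightarrow> (nat \<Rightarrow> real) \<Rightarrow> real" where
  "einner d x y = (\<Sum>i<d. x i * y i)"

definition enorm :: "nat \<Rightarrow> (nat \<Rightarrow> real) \<Rightarrow> real" where
  "enorm d x = sqrt (\<Sum>i<d. (x i)\<^sup>2)"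

definition edist :: "nat \<Rightarrow> (nat \<Rightarrow> real) \<Rightarrow> (nat \<Rightarrow> real) \<Rightarrow> real" where
  "edist d x y = enorm d (\<lambda>i. x i - y i)"

text \<open>Distance from a point to a set (infimum, +infinity for the empty set).\<close>
definition pt_set_dist :: "nat \<Rightarrow> (nat \<Rightarrow> real) \<Rightarrow> (nat \<Rightarrow> real) set \<Rightarrow> ereal" where
  "pt_set_dist d x X = (INF y\<in>X. ereal (edist d x y))"

definition eclosure :: "nat \<Rightarrow> (nat \<Rightarrow> real) set \<Rightarrow> (nat \<Rightarrow> real) set" where
  "eclosure d X = {y \<in> rvec d. \<forall>e>0. \<exists>z\<in>X. edist d y z < e}"

definition reach :: "nat \<Rightarrow> (nat \<Rightarrow> real) set \<Rightarrow> ereal" where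
  "reach d X = Sup {ereal t | t. t \<ge> 0 \<and>
     (\<forall>x\<in>rvec d. pt_set_dist d x X < ereal t \<longrightarrow>
        (\<exists>!y. y \<in> eclosure d X \<and> ereal (edist d x y) = pt_set_dist d x (eclosure d X)))}"

definition secants :: "nat \<Rightarrow> (nat \<Rightarrow> real) set \<Rightarrow> (nat \<Rightarrow> real) set" where
  "secants d X = eclosure d
     {(\<lambda>i. (x i - y i) / edist d x y) | x y. x \<in> X \<and> y \<in> X \<and> x \<noteq> y}"

definition gauss :: "nat \<Rightarrow> (nat \<Rightarrow> real) measure" where
  "gauss d = PiM {..<d} (\<lambda>_. density lborel std_normal_density)"

definition gaussian_width :: "nat \<Rightarrow> (nat \<Rightarrow> real) set \<Rightarrow> real" where
  "gaussian_width d T = (\<integral>g. (SUP x\<in>T. einner d g x) \<partial>gauss d)"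

definition terminal_embedding ::
  "nat \<Rightarrow> nat \<Rightarrow> (nat \<Rightarrow> real) set \<Rightarrow> real \<Rightarrow> ((nat \<Rightarrow> real) \<Rightarrow> (nat \<Rightarrow> real)) \<Rightarrow> bool" where
  "terminal_embedding d k X \<epsilon> f \<longleftrightarrow>
     f ` rvec d \<subseteq> rvec k \<and>
     (\<forall>x\<in>X. \<forall>y\<in>rvec d.
        (1 - \<epsilon>) * edist d x y \<le> edist k (f x) (f y) \<and>
        edist k (f x) (f y) \<le> (1 + \<epsilon>) * edist d x y)"

end

theory Submission
  imports Defs "HOL-Real_Asymp.Real_Asymp"
begin

text \<open>Let \<open>p\<close> be the metric projection onto the closure of \<open>X\<close> and \<open>z = u - p u\<close>. For a near-isometry \<open>P\<close>
  on the convex hull \<open>T\<close> of the secants, a point \<open>u\<close> is sent to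
  \<open>(P (p u) + v, sqrt (|z|^2 - |v|^2))\<close>, where \<open>v = v z\<close> is the vector of least norm with
  \<open>|\<langle>v, P s\<rangle> - \<langle>z, s\<rangle>| \<le> 4 e |z|\<close> for all secants \<open>s\<close>. These constraints give the distortion bound, and duality
  with \<open>|P t| \<ge> |t| - e\<close> on \<open>T\<close> gives \<open>|v| \<le> |z|\<close>. Slater points with half the slack make \<open>|v|\<close> Lipschitz
  and \<open>v\<close> 1/2-Hoelder in \<open>z\<close>, while positive reach makes \<open>p\<close> Lipschitz near \<open>X\<close>; so the map is even locally
  1/2-Hoelder, hence 1/4-Hoelder.

  The map \<open>P\<close> is a normalised Gaussian matrix. For the weighted deviation
  \<open>| |A t|^2 - m |t|^2 | / (|t| + e)\<close>, symmetrisation and rotation invariance replace the difference of squares by the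
  bilinear form \<open>\<langle>A t, B t\<rangle>\<close> of two independent matrices; conditionally on \<open>A\<close> this is a Gaussian process, and
  Sudakov-Fernique compares it with linear processes whose suprema are bounded by the Gaussian width.\<close>

section \<open>Gaussian measures on finite products\<close>

text \<open>Two demands are made on \<open>P\<close>: a relative error on unit secants, for the
  distortion, and an additive lower bound on their whole hull, for the duality argument, where a
  multiple of an arbitrary hull point appears. The weight \<open>1 / (|t| + e)\<close> serves both,
  and a linear form has the same supremum over the hull as over the secants, so the hull costs no
  width. The obstacle is that conditioning on \<open>A\<close> leaves a process whose size depends
  on \<open>|A t|\<close>, which has no a priori bound. The deviation itself bounds it, linearly, so
  the expected deviation \<open>D\<close> obeys an inequality with \<open>D\<close> on both sides;
  once \<open>300 W \<le> e sqrt m\<close>, the right-hand occurrence is absorbed. Neither chaining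
  nor concentration enters: Markov gives probability 1/2 for each finite net, and nested nets give
  nested events, hence one matrix for all of them. Duality provides feasible vectors with slack
  \<open>2 e\<close>, while the least-norm vector is selected at slack \<open>4 e\<close>. The gap
  is what makes the selection stable in \<open>z\<close>. The resulting squared distortion is
  \<open>18 e\<close>, which explains \<open>e = \<epsilon> / 20\<close>. A secant forces the width
  to be at least 1/2, so rounding the target dimension up is harmless; sets with fewer than two
  points are treated apart.\<close>

abbreviation std_normal :: "real measure" where
  "std_normal \<equiv> density lborel std_normal_density"

definition gaussian :: "'i set \<Rightarrow> ('i \<Rightarrow> real) measure" where
  "gaussian I = PiM I (\<lambda>_. std_normal)"

interpretation std_normal: prob_space std_normal
  by (rule prob_space_normal_density) simp

interpretation gprod: product_sigma_finite "\<lambda>_. std_normal"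
  by (simp add: product_sigma_finite_def std_normal.sigma_finite_measure_axioms)

lemma prob_space_gaussian: "prob_space (gaussian I)"
  unfolding gaussian_def by (rule prob_space_PiM) (rule std_normal.prob_space_axioms)

interpretation gaussian: prob_space "gaussian I" for I
  by (rule prob_space_gaussian)

lemma sets_gaussian [measurable_cong]: "sets (gaussian I) = sets (PiM I (\<lambda>_. borel))"
  unfolding gaussian_def by (intro sets_PiM_cong) auto

lemma space_gaussian: "space (gaussian I) = extensional I"
  unfolding gaussian_def by (simp add: space_PiM PiE_UNIV_domain) (auto simp: PiE_def)

lemma borel_measurable_std_normal [simp]: "borel_measurable std_normal = borel_measurable borel"
  by (intro measurable_cong_sets) auto

lemma distr_gaussian_component:
  "i \<in> I \<Longrightarrow> distr (gaussian I) std_normal (\<lambda>x. x i) = std_normal"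
  unfolding gaussian_def
proof -
  assume i: "i \<in> I"
  interpret product_prob_space "\<lambda>_. std_normal" I
    by unfold_locales
  show "distr (PiM I (\<lambda>_. std_normal)) std_normal (\<lambda>x. x i) = std_normal"
    using PiM_component[OF i] .
qed

lemma measurable_gaussian_component:
  "i \<in> I \<Longrightarrow> (\<lambda>x. x i) \<in> measurable (gaussian I) std_normal"
  unfolding gaussian_def by (rule measurable_component_singleton)

lemma integral_gaussian_component:
  fixes f :: "real \<Rightarrow> real"
  assumes "i \<in> I" "f \<in> borel_measurable borel"
  shows "(\<integral>x. f (x i) \<partial>gaussian I) = (\<integral>x. f x \<partial>std_normal)"
  using integral_distr[OF measurable_gaussian_component[OF assms(1)], of f] assms(2)
    distr_gaussian_component[OF assms(1)] by simp

lemma integrable_gaussian_component: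
  fixes f :: "real \<Rightarrow> real"
  assumes "i \<in> I" "integrable std_normal f"
  shows "integrable (gaussian I) (\<lambda>x. f (x i))"
  using integrable_distr[OF measurable_gaussian_component[OF assms(1)], of f] assms(2)
    distr_gaussian_component[OF assms(1)] by simp

lemma integrable_std_normal_power: "integrable std_normal (\<lambda>x. x ^ k)"
  using integrable_std_normal_moment[of k] by (simp add: integrable_density)

lemma integral_std_normal_square: "(\<integral>x. x\<^sup>2 \<partial>std_normal) = 1"
  using integral_std_normal_moment_even[of 1]
  by (simp add: integral_density)

lemma integral_std_normal_id: "(\<integral>x. x \<partial>std_normal) = 0"
  using integral_std_normal_moment_odd[of 0]
  by (simp add: integral_density)

lemma integral_std_normal_abs: "(\<integral>x. \<bar>x\<bar> \<partial>std_normal) = sqrt (2 / pi)"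
  using integral_std_normal_moment_abs_odd[of 0]
  by (simp add: integral_density)

section \<open>Gaussian integration by parts (Stein's identity)\<close>

lemma std_normal_integration_by_parts:
  fixes h h' :: "real \<Rightarrow> real"
  assumes deriv: "\<And>x. (h has_real_derivative h' x) (at x)"
    and cont: "continuous_on UNIV h'"
    and bnd: "\<And>x. \<bar>h x\<bar> \<le> B" "\<And>x. \<bar>h' x\<bar> \<le> B'"
  shows "(\<integral>x. x * h x \<partial>std_normal) = (\<integral>x. h' x \<partial>std_normal)"
proof -
  have conth: "continuous_on UNIV h"
    using DERIV_isCont[OF deriv] by (simp add: continuous_at_imp_continuous_on)
  have [measurable]: "h \<in> borel_measurable borel" "h' \<in> borel_measurable borel"
    using conth cont by (auto intro: borel_measurable_continuous_onI)
  define f where "f x = std_normal_density x * h' x - std_normal_density x * (x * h x)" for x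
  define F where "F x = std_normal_density x * h x" for x
  have bnd': "\<bar>h x\<bar> \<le> \<bar>B\<bar>" "\<bar>h' x\<bar> \<le> \<bar>B'\<bar>" for x
    using bnd[of x] by auto
  have i1: "integrable lborel (\<lambda>x. std_normal_density x * h' x)"
    by (rule Bochner_Integration.integrable_bound[OF integrable_mult_right[OF integrable_normal_density[of 1 0], of B']])
       (auto intro!: AE_I2 mult_right_mono bnd' simp: abs_mult mult.commute[of "std_normal_density _"])
  have i2: "integrable lborel (\<lambda>x. std_normal_density x * (x * h x))"
  proof (rule Bochner_Integration.integrable_bound[OF integrable_mult_right[OF integrable_std_normal_moment[of 1], of B]])
    show "AE x in lborel. norm (std_normal_density x * (x * h x)) \<le> norm (B * (std_normal_density x * x ^ 1))"
    proof (intro AE_I2)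
      fix x
      have "\<bar>h x\<bar> * (std_normal_density x * \<bar>x\<bar>) \<le> \<bar>B\<bar> * (std_normal_density x * \<bar>x\<bar>)"
        by (intro mult_right_mono bnd') auto
      then show "norm (std_normal_density x * (x * h x)) \<le> norm (B * (std_normal_density x * x ^ 1))"
        by (simp add: abs_mult ac_simps)
    qed
  qed simp
  have "(LBINT x=-\<infinity>..\<infinity>. f x) = 0 - 0"
  proof (rule interval_integral_FTC_integrable[where F = F])
    show "(F has_vector_derivative f x) (at x)" for x
    proof -
      \<comment> \<open>Hiding the normalising factor leaves
        \<open>c * exp (- x\<^sup>2 / 2)\<close>, whose derivative is \<open>- x\<close> times
        itself; so \<open>f\<close> is the derivative of \<open>F\<close>.\<close>
      obtain c where c: "std_normal_density = (\<lambda>x. c * exp (- x\<^sup>2 / 2))"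
        using std_normal_density_def by blast
      show ?thesis
        unfolding has_real_derivative_iff_has_vector_derivative[symmetric] F_def f_def c
        by (auto intro!: derivative_eq_intros deriv simp: algebra_simps)
    qed
    show "isCont f x" for x
    proof -
      have "continuous_on UNIV f"
        unfolding f_def std_normal_density_def by (intro continuous_intros conth cont) auto
      thus ?thesis by (simp add: continuous_on_eq_continuous_at)
    qed
    show "set_integrable lborel (einterval (-\<infinity>) \<infinity>) f"
      unfolding set_integrable_def f_def using i1 i2 by (simp add: einterval_def)
    have lim: "(F \<longlongrightarrow> 0) G" if G: "(std_normal_density \<longlongrightarrow> 0) G" for G
    proof (rule Lim_null_comparison)
      show "\<forall>\<^sub>F x in G. norm (F x) \<le> B * std_normal_density x"
        unfolding F_def using bnd(1) by (auto intro!: always_eventually mult_right_mono simp: abs_mult mult.commute)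
      show "((\<lambda>x. B * std_normal_density x) \<longlongrightarrow> 0) G"
        by (rule tendsto_mult_right_zero[OF G])
    qed
    have "(std_normal_density \<longlongrightarrow> 0) at_top" "(std_normal_density \<longlongrightarrow> 0) at_bot"
      unfolding std_normal_density_def[abs_def] by real_asymp+
    then show "((F \<circ> real_of_ereal) \<longlongrightarrow> 0) (at_right (-\<infinity>))" "((F \<circ> real_of_ereal) \<longlongrightarrow> 0) (at_left \<infinity>)"
      unfolding ereal_tendsto_simps using lim by auto
  qed simp
  then have "(\<integral>x. f x \<partial>lborel) = 0"
    by (simp add: interval_lebesgue_integral_def set_lebesgue_integral_def einterval_def)
  then show ?thesis
    using i1 i2 by (simp add: f_def integral_density)
qed

lemma gaussian_insert_integral:
  fixes f :: "('i \<Rightarrow> real) \<Rightarrow> real"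
  assumes "finite I" "i \<notin> I" "integrable (gaussian (insert i I)) f"
  shows "(\<integral>x. f x \<partial>gaussian (insert i I)) = (\<integral>x. (\<integral>y. f (x(i := y)) \<partial>std_normal) \<partial>gaussian I)"
  using assms unfolding gaussian_def by (intro gprod.product_integral_insert) auto

lemma integrable_gaussian_bounded:
  fixes p :: "('i \<Rightarrow> real) \<Rightarrow> real"
  assumes [measurable]: "p \<in> borel_measurable (gaussian I)" and "\<And>x. \<bar>p x\<bar> \<le> B"
  shows "integrable (gaussian I) p"
  by (rule gaussian.integrable_const_bound[where B = B]) (use assms in auto)

lemma integrable_gaussian_mult_bounded:
  fixes p f :: "('i \<Rightarrow> real) \<Rightarrow> real"
  assumes [measurable]: "p \<in> borel_measurable (gaussian I)" and B: "\<And>x. \<bar>p x\<bar> \<le> B"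
    and f: "integrable (gaussian I) f"
  shows "integrable (gaussian I) (\<lambda>x. f x * p x)"
proof (rule Bochner_Integration.integrable_bound[OF integrable_mult_left[OF f, of B]])
  show "AE x in gaussian I. norm (f x * p x) \<le> norm (f x * B)"
    by (intro AE_I2) (auto simp: abs_mult intro!: mult_left_mono order.trans[OF B])
qed (use f in measurable)

text \<open>Fubini isolates coordinate \<open>k\<close>, and the one-dimensional identity applies
  with the other coordinates frozen.\<close>

lemma gaussian_integration_by_parts:
  fixes p q :: "('i \<Rightarrow> real) \<Rightarrow> real"
  assumes K: "finite K" "k \<in> K"
    and meas: "p \<in> borel_measurable (gaussian K)" "q \<in> borel_measurable (gaussian K)"
    and deriv: "\<And>x y. ((\<lambda>y. p (x(k := y))) has_real_derivative q (x(k := y))) (at y)"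
    and cont: "\<And>x. continuous_on UNIV (\<lambda>y. q (x(k := y)))"
    and bnd: "\<And>x. \<bar>p x\<bar> \<le> B" "\<And>x. \<bar>q x\<bar> \<le> B'"
  shows "(\<integral>x. x k * p x \<partial>gaussian K) = (\<integral>x. q x \<partial>gaussian K)"
proof -
  define I where "I = K - {k}"
  have KI: "K = insert k I" "k \<notin> I" "finite I" using K by (auto simp: I_def)
  have int1: "integrable (gaussian K) (\<lambda>x. x k * p x)"
    using integrable_std_normal_power[of 1] K
    by (intro integrable_gaussian_mult_bounded[OF meas(1) bnd(1)] integrable_gaussian_component) auto
  have int2: "integrable (gaussian K) q"
    by (rule integrable_gaussian_bounded[OF meas(2) bnd(2)])
  have "(\<integral>x. x k * p x \<partial>gaussian K) =
      (\<integral>x. (\<integral>y. y * p (x(k := y)) \<partial>std_normal) \<partial>gaussian I)"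
    using gaussian_insert_integral[OF KI(3,2), of "\<lambda>x. x k * p x"] int1 by (simp add: KI(1))
  also have "\<dots> = (\<integral>x. (\<integral>y. q (x(k := y)) \<partial>std_normal) \<partial>gaussian I)"
    by (intro Bochner_Integration.integral_cong refl std_normal_integration_by_parts[where B = B and B' = B'])
       (use deriv cont bnd in auto)
  also have "\<dots> = (\<integral>x. q x \<partial>gaussian K)"
    using gaussian_insert_integral[OF KI(3,2), of q] int2 by (simp add: KI(1))
  finally show ?thesis .
qed

section \<open>Comparison of expected maxima of Gaussian processes\<close>

text \<open>By the mean value inequality the bound \<open>w\<close> on the derivative also bounds
  all difference quotients, so dominated convergence applies along every sequence of
  increments.\<close>

lemma has_real_derivative_integral:
  fixes f f' :: "real \<Rightarrow> 'x \<Rightarrow> real"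
  assumes int: "\<And>t. integrable M (f t)"
    and deriv: "\<And>t x. ((\<lambda>t. f t x) has_real_derivative f' t x) (at t)"
    and dom: "\<And>t x. \<bar>f' t x\<bar> \<le> w x" "integrable M w"
  shows "((\<lambda>t. \<integral>x. f t x \<partial>M) has_real_derivative (\<integral>x. f' t x \<partial>M)) (at t)"
proof -
  have "((\<lambda>h. ((\<integral>x. f (t + h) x \<partial>M) - (\<integral>x. f t x \<partial>M)) / h) \<longlongrightarrow> (\<integral>x. f' t x \<partial>M)) (at 0)"
  proof (subst tendsto_at_iff_sequentially, intro allI impI)
    fix h :: "nat \<Rightarrow> real" assume h: "\<forall>i. h i \<in> UNIV - {0}" "h \<longlonglongrightarrow> 0"
    have conv: "(\<lambda>n. (f (t + h n) x - f t x) / h n) \<longlonglongrightarrow> f' t x" for x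
      using deriv[of x t, unfolded DERIV_def, unfolded tendsto_at_iff_sequentially] h
      by (auto simp: o_def)
    have m: "(\<lambda>x. (f (t + h n) x - f t x) / h n) \<in> borel_measurable M" for n
      using int by measurable
    have bound: "norm ((f (t + h n) x - f t x) / h n) \<le> w x" for n x
    proof -
      have hn: "h n \<noteq> 0" using h by auto
      have "\<bar>f (t + h n) x - f t x\<bar> \<le> w x * \<bar>t + h n - t\<bar>"
        using field_differentiable_bound[of UNIV "\<lambda>t. f t x" "\<lambda>t. f' t x" "w x" "t + h n" t] deriv dom(1)
        by (auto simp: )
      then show ?thesis using hn by (simp add: field_simps)
    qed
    have "(\<lambda>n. \<integral>x. (f (t + h n) x - f t x) / h n \<partial>M) \<longlonglongrightarrow> (\<integral>x. f' t x \<partial>M)"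
    proof (rule integral_dominated_convergence[where w = w])
      show "f' t \<in> borel_measurable M"
        by (rule borel_measurable_LIMSEQ_real[OF conv m])
    qed (use m conv bound dom in auto)
    then show "((\<lambda>h. ((\<integral>x. f (t + h) x \<partial>M) - (\<integral>x. f t x \<partial>M)) / h) \<circ> h) \<longlonglongrightarrow> (\<integral>x. f' t x \<partial>M)"
      by (simp add: o_def int)
  qed
  then show ?thesis by (simp add: DERIV_def)
qed

section \<open>Log-sum-exp as a smooth substitute for the maximum\<close>

definition softmax :: "real \<Rightarrow> 'a set \<Rightarrow> ('a \<Rightarrow> real) \<Rightarrow> real" where
  "softmax \<beta> T z = ln (\<Sum>t\<in>T. exp (\<beta> * z t)) / \<beta>"

text \<open>The gradient of \<open>softmax\<close>: a Gibbs probability vector on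
  \<open>T\<close>.\<close>

definition softmax_weight :: "real \<Rightarrow> 'a set \<Rightarrow> ('a \<Rightarrow> real) \<Rightarrow> 'a \<Rightarrow> real" where
  "softmax_weight \<beta> T z t = exp (\<beta> * z t) / (\<Sum>s\<in>T. exp (\<beta> * z s))"

lemma sum_exp_pos:
  fixes z :: "'a \<Rightarrow> real"
  assumes "finite T" "T \<noteq> {}"
  shows "0 < (\<Sum>t\<in>T. exp (z t))"
  using assms by (intro sum_pos) auto

lemma softmax_weight_nonneg: "0 \<le> softmax_weight \<beta> T z t"
  unfolding softmax_weight_def by (intro divide_nonneg_nonneg sum_nonneg) auto

lemma softmax_weight_sum:
  assumes "finite T" "T \<noteq> {}"
  shows "(\<Sum>t\<in>T. softmax_weight \<beta> T z t) = 1"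
  unfolding softmax_weight_def sum_divide_distrib[symmetric]
  using sum_exp_pos[OF assms, of "\<lambda>t. \<beta> * z t"] by simp

lemma softmax_weight_le_1:
  assumes "finite T" "t \<in> T"
  shows "softmax_weight \<beta> T z t \<le> 1"
proof -
  have "softmax_weight \<beta> T z t \<le> (\<Sum>t\<in>T. softmax_weight \<beta> T z t)"
    using assms by (intro member_le_sum) (auto simp: softmax_weight_nonneg)
  also have "\<dots> = 1" using assms by (intro softmax_weight_sum) auto
  finally show ?thesis .
qed

lemma softmax_ge:
  assumes "finite T" "t \<in> T" "0 < \<beta>"
  shows "z t \<le> softmax \<beta> T z"
proof -
  have "exp (\<beta> * z t) \<le> (\<Sum>t\<in>T. exp (\<beta> * z t))"
    using assms by (intro member_le_sum) auto
  then have "\<beta> * z t \<le> ln (\<Sum>t\<in>T. exp (\<beta> * z t))"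
    using assms by (metis exp_gt_zero ln_exp ln_le_cancel_iff order_less_le_trans)
  then show ?thesis using assms by (simp add: softmax_def field_simps)
qed

text \<open>There are \<open>card T\<close> summands, each at most \<open>exp (\<beta> * B)\<close>;
  the excess over the true maximum vanishes as \<beta> grows.\<close>

lemma softmax_le:
  assumes "finite T" "T \<noteq> {}" "0 < \<beta>" "\<And>t. t \<in> T \<Longrightarrow> z t \<le> B"
  shows "softmax \<beta> T z \<le> B + ln (card T) / \<beta>"
proof -
  have "(\<Sum>t\<in>T. exp (\<beta> * z t)) \<le> (\<Sum>t\<in>T. exp (\<beta> * B))"
    using assms by (intro sum_mono) auto
  also have "\<dots> = card T * exp (\<beta> * B)" by simp
  finally have "ln (\<Sum>t\<in>T. exp (\<beta> * z t)) \<le> ln (card T * exp (\<beta> * B))"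
    using sum_exp_pos[OF assms(1,2), of "\<lambda>t. \<beta> * z t"] by (metis ln_mono order_less_le_trans)
  also have "\<dots> = ln (card T) + \<beta> * B"
    using assms by (subst ln_mult) (auto simp: card_gt_0_iff)
  finally show ?thesis using assms by (simp add: softmax_def field_simps)
qed

lemma softmax_has_derivative:
  assumes "finite T" "T \<noteq> {}" "0 < \<beta>"
    and "\<And>t. t \<in> T \<Longrightarrow> ((\<lambda>u. z u t) has_real_derivative z' t) (at u)"
  shows "((\<lambda>u. softmax \<beta> T (z u)) has_real_derivative (\<Sum>t\<in>T. softmax_weight \<beta> T (z u) t * z' t)) (at u)"
proof -
  note pos = sum_exp_pos[OF assms(1,2), of "\<lambda>t. \<beta> * z u t"]
  have "((\<lambda>u. \<Sum>t\<in>T. exp (\<beta> * z u t)) has_real_derivative (\<Sum>t\<in>T. exp (\<beta> * z u t) * (\<beta> * z' t))) (at u)"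
    by (auto intro!: derivative_eq_intros assms(4) simp: ac_simps)
  then have "((\<lambda>u. ln (\<Sum>t\<in>T. exp (\<beta> * z u t)) / \<beta>) has_real_derivative
      (\<Sum>t\<in>T. exp (\<beta> * z u t) * (\<beta> * z' t)) / (\<Sum>t\<in>T. exp (\<beta> * z u t)) / \<beta>) (at u)"
  proof -
    have "((\<lambda>u. ln (S u) / \<beta>) has_real_derivative S' / S u / \<beta>) (at u)"
      if "(S has_real_derivative S') (at u)" "0 < S u" for S S'
      using that assms(3) by (auto intro!: derivative_eq_intros)
    from this[OF \<open>((\<lambda>u. \<Sum>t\<in>T. exp (\<beta> * z u t)) has_real_derivative _) (at u)\<close> pos] show ?thesis .
  qed
  also have "(\<Sum>t\<in>T. exp (\<beta> * z u t) * (\<beta> * z' t)) / (\<Sum>t\<in>T. exp (\<beta> * z u t)) / \<beta>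
      = (\<Sum>t\<in>T. softmax_weight \<beta> T (z u) t * z' t)"
    using assms(3) by (simp add: softmax_weight_def sum_divide_distrib)
  finally show ?thesis unfolding softmax_def .
qed

text \<open>A weight grows at the rate by which its own slope exceeds the weighted mean slope. This
  centring produces the variance structure in the interpolation below.\<close>

lemma softmax_weight_has_derivative:
  assumes "finite T" "T \<noteq> {}"
    and d: "\<And>t. t \<in> T \<Longrightarrow> ((\<lambda>u. z u t) has_real_derivative z' t) (at u)"
    and t: "t \<in> T"
  shows "((\<lambda>u. softmax_weight \<beta> T (z u) t) has_real_derivative
    \<beta> * softmax_weight \<beta> T (z u) t * (z' t - (\<Sum>s\<in>T. softmax_weight \<beta> T (z u) s * z' s))) (at u)"
proof -
  define S where "S = (\<Sum>s\<in>T. exp (\<beta> * z u s))"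
  note pos = sum_exp_pos[OF assms(1,2), of "\<lambda>t. \<beta> * z u t", folded S_def]
  have S': "((\<lambda>u. \<Sum>t\<in>T. exp (\<beta> * z u t)) has_real_derivative (\<Sum>t\<in>T. exp (\<beta> * z u t) * (\<beta> * z' t))) (at u)"
    by (auto intro!: derivative_eq_intros d simp: ac_simps)
  have "((\<lambda>u. exp (\<beta> * z u t) / (\<Sum>t\<in>T. exp (\<beta> * z u t))) has_real_derivative
     (exp (\<beta> * z u t) * (\<beta> * z' t) * S - exp (\<beta> * z u t) * (\<Sum>t\<in>T. exp (\<beta> * z u t) * (\<beta> * z' t))) / (S * S)) (at u)"
    by (rule DERIV_divide[OF _ S', folded S_def]) (use pos t in \<open>auto intro!: derivative_eq_intros d\<close>)
  also have "(\<Sum>t\<in>T. exp (\<beta> * z u t) * (\<beta> * z' t)) = \<beta> * S * (\<Sum>s\<in>T. softmax_weight \<beta> T (z u) s * z' s)"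
    using pos by (simp add: softmax_weight_def S_def[symmetric] sum_distrib_left ac_simps)
  also have "(exp (\<beta> * z u t) * (\<beta> * z' t) * S - exp (\<beta> * z u t) * (\<beta> * S * (\<Sum>s\<in>T. softmax_weight \<beta> T (z u) s * z' s))) / (S * S)
     = \<beta> * (exp (\<beta> * z u t) / S) * (z' t - (\<Sum>s\<in>T. softmax_weight \<beta> T (z u) s * z' s))"
    using pos by (simp add: field_simps)
  finally show ?thesis unfolding softmax_weight_def S_def .
qed

text \<open>A polarised form of "the variance is half the mean squared difference of two independent
  samples". For a Gram matrix \<open>D\<close> the combination on the right is a squared increment,
  so a difference of Gram matrices enters only through differences of squared increments.\<close>

lemma weighted_variance_identity:
  fixes w :: "'a \<Rightarrow> real" and D :: "'a \<Rightarrow> 'a \<Rightarrow> real"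
  assumes w: "(\<Sum>t\<in>T. w t) = 1"
  shows "(\<Sum>t\<in>T. w t * D t t) - (\<Sum>t\<in>T. \<Sum>s\<in>T. w t * w s * D t s)
       = (\<Sum>t\<in>T. \<Sum>s\<in>T. w t * w s * (D t t + D s s - 2 * D t s)) / 2"
proof -
  have 1: "(\<Sum>t\<in>T. \<Sum>s\<in>T. w t * w s * D t t) = (\<Sum>t\<in>T. w t * D t t)"
  proof (rule sum.cong[OF refl])
    fix t
    have "(\<Sum>s\<in>T. w t * w s * D t t) = (\<Sum>s\<in>T. w s) * (w t * D t t)"
      by (simp add: sum_distrib_right sum_distrib_left ac_simps)
    then show "(\<Sum>s\<in>T. w t * w s * D t t) = w t * D t t" using w by simp
  qed
  have 2: "(\<Sum>t\<in>T. \<Sum>s\<in>T. w t * w s * D s s) = (\<Sum>t\<in>T. w t * D t t)"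
    by (subst sum.swap) (use 1 in \<open>simp add: ac_simps\<close>)
  have "(\<Sum>t\<in>T. \<Sum>s\<in>T. w t * w s * (D t t + D s s - 2 * D t s)) =
    (\<Sum>t\<in>T. \<Sum>s\<in>T. w t * w s * D t t) + (\<Sum>t\<in>T. \<Sum>s\<in>T. w t * w s * D s s) - 2 * (\<Sum>t\<in>T. \<Sum>s\<in>T. w t * w s * D t s)"
    by (simp add: algebra_simps sum.distrib sum_subtractf sum_distrib_left)
  then show ?thesis using 1 2 by simp
qed

abbreviation (input) linform :: "'i set \<Rightarrow> ('i \<Rightarrow> real) \<Rightarrow> ('i \<Rightarrow> real) \<Rightarrow> real" where
  "linform K c g \<equiv> (\<Sum>k\<in>K. c k * g k)"

lemma integrable_gaussian_id:
  assumes "k \<in> K" shows "integrable (gaussian K) (\<lambda>g. g k)"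
  using integrable_std_normal_power[of 1] assms by (intro integrable_gaussian_component) auto

lemma integrable_linform: "integrable (gaussian K) (linform K c)"
  by (intro Bochner_Integration.integrable_sum integrable_mult_right integrable_gaussian_id)

lemma linform_upd:
  assumes "finite K" "k \<in> K"
  shows "linform K c (g(k := y)) = c k * y + linform (K - {k}) c g"
  using assms by (subst sum.remove[of K k]) (auto intro!: sum.cong)

lemma measurable_softmax_linform:
  "finite T \<Longrightarrow> (\<lambda>g. softmax \<beta> T (\<lambda>t. linform K (c t) g)) \<in> borel_measurable (gaussian K)"
  unfolding softmax_def by measurable

lemma measurable_softmax_weight_linform:
  "finite T \<Longrightarrow> (\<lambda>g. softmax_weight \<beta> T (\<lambda>t. linform K (c t) g) s) \<in> borel_measurable (gaussian K)"
  unfolding softmax_weight_def by measurable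

lemma integrable_softmax_linform:
  assumes T: "finite T" "T \<noteq> {}" and \<beta>: "0 < \<beta>"
  shows "integrable (gaussian K) (\<lambda>g. softmax \<beta> T (\<lambda>t. linform K (c t) g))"
proof (rule Bochner_Integration.integrable_bound)
  show "integrable (gaussian K) (\<lambda>g. (\<Sum>t\<in>T. \<bar>linform K (c t) g\<bar>) + ln (card T) / \<beta>)"
    by (intro Bochner_Integration.integrable_add Bochner_Integration.integrable_sum integrable_abs integrable_linform) auto
  show "AE g in gaussian K. norm (softmax \<beta> T (\<lambda>t. linform K (c t) g))
      \<le> norm ((\<Sum>t\<in>T. \<bar>linform K (c t) g\<bar>) + ln (card T) / \<beta>)"
  proof (intro AE_I2)
    fix g
    have le: "\<bar>linform K (c t) g\<bar> \<le> (\<Sum>t\<in>T. \<bar>linform K (c t) g\<bar>)" if "t \<in> T" for t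
      using T that by (intro member_le_sum) auto
    have c: "0 \<le> ln (card T) / \<beta>" using T \<beta> by (auto simp: Suc_le_eq card_gt_0_iff)
    have "softmax \<beta> T (\<lambda>t. linform K (c t) g) \<le> (\<Sum>t\<in>T. \<bar>linform K (c t) g\<bar>) + ln (card T) / \<beta>"
      using le by (intro softmax_le T \<beta>) (meson abs_ge_self order_trans)
    moreover obtain t where t: "t \<in> T" using T by auto
    have "- (\<Sum>t\<in>T. \<bar>linform K (c t) g\<bar>) \<le> softmax \<beta> T (\<lambda>t. linform K (c t) g)"
      using softmax_ge[OF T(1) t \<beta>, of "\<lambda>t. linform K (c t) g"] le[OF t] by linarith
    ultimately show "norm (softmax \<beta> T (\<lambda>t. linform K (c t) g))
      \<le> norm ((\<Sum>t\<in>T. \<bar>linform K (c t) g\<bar>) + ln (card T) / \<beta>)"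
      using c unfolding real_norm_def by linarith
  qed
qed (rule measurable_softmax_linform[OF T(1)])

text \<open>Stein's identity for a Gibbs weight, whose values lie in \<open>[0, 1]\<close> and whose
  partial derivatives are bounded by the coefficients.\<close>

lemma gaussian_softmax_weight_by_parts:
  fixes c :: "'a \<Rightarrow> 'i \<Rightarrow> real"
  assumes K: "finite K" "k \<in> K" and T: "finite T" "T \<noteq> {}" "t \<in> T" and \<beta>: "0 < \<beta>"
  defines "w \<equiv> \<lambda>g. softmax_weight \<beta> T (\<lambda>t. linform K (c t) g)"
  shows "(\<integral>g. g k * w g t \<partial>gaussian K)
       = (\<integral>g. \<beta> * w g t * (c t k - (\<Sum>s\<in>T. w g s * c s k)) \<partial>gaussian K)"
proof (rule gaussian_integration_by_parts[OF K, where B = 1 and B' = "\<beta> * (\<bar>c t k\<bar> + (\<Sum>s\<in>T. \<bar>c s k\<bar>))"])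
  have w_meas [measurable]: "(\<lambda>g. w g s) \<in> borel_measurable (gaussian K)" for s
    unfolding w_def by (rule measurable_softmax_weight_linform[OF T(1)])
  show "(\<lambda>g. w g t) \<in> borel_measurable (gaussian K)" by measurable
  show "(\<lambda>g. \<beta> * w g t * (c t k - (\<Sum>s\<in>T. w g s * c s k))) \<in> borel_measurable (gaussian K)" by measurable
  have lf: "((\<lambda>y. linform K (c s) (g(k := y))) has_real_derivative c s k) (at y)" for s g y
    unfolding linform_upd[OF K] by (auto intro!: derivative_eq_intros)
  have wd: "((\<lambda>y. w (g(k := y)) s) has_real_derivative
      \<beta> * w (g(k := y)) s * (c s k - (\<Sum>r\<in>T. w (g(k := y)) r * c r k))) (at y)" if "s \<in> T" for g y s
    unfolding w_def
    by (rule softmax_weight_has_derivative[where z = "\<lambda>y t. linform K (c t) (g(k := y))", OF T(1,2) lf that])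
  then show "((\<lambda>y. w (g(k := y)) t) has_real_derivative
      \<beta> * w (g(k := y)) t * (c t k - (\<Sum>s\<in>T. w (g(k := y)) s * c s k))) (at y)" for g y
    using T(3) by blast
  have wc: "continuous_on UNIV (\<lambda>y. w (g(k := y)) s)" if "s \<in> T" for g s
    using DERIV_isCont[OF wd[OF that]] by (simp add: continuous_at_imp_continuous_on)
  show "continuous_on UNIV (\<lambda>y. \<beta> * w (g(k := y)) t * (c t k - (\<Sum>s\<in>T. w (g(k := y)) s * c s k)))" for g
    by (intro continuous_intros wc T)
  have w01: "0 \<le> w g s" "s \<in> T \<Longrightarrow> w g s \<le> 1" for g s
    unfolding w_def by (rule softmax_weight_nonneg, rule softmax_weight_le_1[OF T(1)])
  show "\<bar>w g t\<bar> \<le> 1" for g using w01(1)[of g t] w01(2)[of t g] T by auto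
  show "\<bar>\<beta> * w g t * (c t k - (\<Sum>s\<in>T. w g s * c s k))\<bar> \<le> \<beta> * (\<bar>c t k\<bar> + (\<Sum>s\<in>T. \<bar>c s k\<bar>))" for g
  proof -
    have "\<bar>\<Sum>s\<in>T. w g s * c s k\<bar> \<le> (\<Sum>s\<in>T. \<bar>w g s * c s k\<bar>)" by (rule sum_abs)
    also have "\<dots> \<le> (\<Sum>s\<in>T. \<bar>c s k\<bar>)"
      using w01 by (intro sum_mono) (auto simp: abs_mult intro!: mult_left_le_one_le)
    finally have 1: "\<bar>c t k - (\<Sum>s\<in>T. w g s * c s k)\<bar> \<le> \<bar>c t k\<bar> + (\<Sum>s\<in>T. \<bar>c s k\<bar>)" by linarith
    have "w g t * \<bar>c t k - (\<Sum>s\<in>T. w g s * c s k)\<bar> \<le> 1 * (\<bar>c t k\<bar> + (\<Sum>s\<in>T. \<bar>c s k\<bar>))"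
      using w01(1)[of g t] w01(2)[of t g] T 1 by (intro mult_mono) auto
    then have "\<beta> * (w g t * \<bar>c t k - (\<Sum>s\<in>T. w g s * c s k)\<bar>) \<le> \<beta> * (\<bar>c t k\<bar> + (\<Sum>s\<in>T. \<bar>c s k\<bar>))"
      using \<beta> by (intro mult_left_mono) auto
    then show ?thesis using \<beta> w01(1)[of g t] by (simp add: abs_mult mult.assoc)
  qed
qed

text \<open>Gaussian interpolation: along \<open>sin \<theta> a + cos \<theta> b\<close> the derivative of the expected soft maximum is
  a weighted average of the differences of the squared increments.\<close>

lemma gaussian_softmax_mono:
  fixes a b :: "'a \<Rightarrow> 'i \<Rightarrow> real"
  assumes K: "finite K" and T: "finite T" "T \<noteq> {}" and \<beta>: "0 < \<beta>"
    and orth: "\<And>s t. (\<Sum>k\<in>K. a s k * b t k) = 0"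
    and incr: "\<And>s t. s \<in> T \<Longrightarrow> t \<in> T \<Longrightarrow> (\<Sum>k\<in>K. (a s k - a t k)\<^sup>2) \<le> (\<Sum>k\<in>K. (b s k - b t k)\<^sup>2)"
  shows "(\<integral>g. softmax \<beta> T (\<lambda>t. linform K (a t) g) \<partial>gaussian K)
       \<le> (\<integral>g. softmax \<beta> T (\<lambda>t. linform K (b t) g) \<partial>gaussian K)"
proof -
  \<comment> \<open>The path starts at \<open>b\<close> for \<open>\<theta> = 0\<close> and reaches
    \<open>a\<close> at \<open>pi / 2\<close>, so the claim is that the expectation decreases along
    it; \<open>c'\<close> is its velocity.\<close>
  define c where "c \<theta> t k = sin \<theta> * a t k + cos \<theta> * b t k" for \<theta> t k
  define c' where "c' \<theta> t k = cos \<theta> * a t k - sin \<theta> * b t k" for \<theta> t k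
  define w where "w \<theta> g = softmax_weight \<beta> T (\<lambda>t. linform K (c \<theta> t) g)" for \<theta> g
  define f where "f \<theta> g = softmax \<beta> T (\<lambda>t. linform K (c \<theta> t) g)" for \<theta> g
  define f' where "f' \<theta> g = (\<Sum>t\<in>T. w \<theta> g t * linform K (c' \<theta> t) g)" for \<theta> g
  define D where "D t s = (\<Sum>k\<in>K. a t k * a s k) - (\<Sum>k\<in>K. b t k * b s k)" for t s
  have w01: "0 \<le> w \<theta> g s" "s \<in> T \<Longrightarrow> w \<theta> g s \<le> 1" "(\<Sum>t\<in>T. w \<theta> g t) = 1" for \<theta> g s
    unfolding w_def by (rule softmax_weight_nonneg, rule softmax_weight_le_1[OF T(1)], assumption, rule softmax_weight_sum[OF T])
  have w_meas [measurable]: "(\<lambda>g. w \<theta> g s) \<in> borel_measurable (gaussian K)" for s \<theta>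
    unfolding w_def by (rule measurable_softmax_weight_linform[OF T(1)])
  have d: "((\<lambda>\<theta>. \<integral>g. f \<theta> g \<partial>gaussian K) has_real_derivative (\<integral>g. f' \<theta> g \<partial>gaussian K)) (at \<theta>)" for \<theta>
  proof (rule has_real_derivative_integral[where w = "\<lambda>g. \<Sum>t\<in>T. \<Sum>k\<in>K. (\<bar>a t k\<bar> + \<bar>b t k\<bar>) * \<bar>g k\<bar>"])
    show "integrable (gaussian K) (f \<theta>)" for \<theta>
      unfolding f_def by (rule integrable_softmax_linform[OF T \<beta>])
    show "((\<lambda>\<theta>. f \<theta> g) has_real_derivative f' \<theta> g) (at \<theta>)" for \<theta> g
      unfolding f_def f'_def w_def
      by (rule softmax_has_derivative[OF T \<beta>]) (auto simp: c_def c'_def intro!: derivative_eq_intros sum.cong)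
    show "\<bar>f' \<theta> g\<bar> \<le> (\<Sum>t\<in>T. \<Sum>k\<in>K. (\<bar>a t k\<bar> + \<bar>b t k\<bar>) * \<bar>g k\<bar>)" for \<theta> g
    proof -
      have cb: "\<bar>c' \<theta> t k\<bar> \<le> \<bar>a t k\<bar> + \<bar>b t k\<bar>" for t k
      proof -
        have "\<bar>c' \<theta> t k\<bar> \<le> \<bar>cos \<theta> * a t k\<bar> + \<bar>sin \<theta> * b t k\<bar>" unfolding c'_def by (rule abs_triangle_ineq4)
        also have "\<dots> \<le> \<bar>a t k\<bar> + \<bar>b t k\<bar>"
          by (auto simp: abs_mult intro!: add_mono mult_left_le_one_le)
        finally show ?thesis .
      qed
      have "\<bar>f' \<theta> g\<bar> \<le> (\<Sum>t\<in>T. \<bar>w \<theta> g t * linform K (c' \<theta> t) g\<bar>)" unfolding f'_def by (rule sum_abs)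
      also have "\<dots> \<le> (\<Sum>t\<in>T. \<bar>linform K (c' \<theta> t) g\<bar>)"
        using w01 by (intro sum_mono) (auto simp: abs_mult intro!: mult_left_le_one_le)
      also have "\<dots> \<le> (\<Sum>t\<in>T. \<Sum>k\<in>K. \<bar>c' \<theta> t k * g k\<bar>)" by (intro sum_mono sum_abs)
      also have "\<dots> \<le> (\<Sum>t\<in>T. \<Sum>k\<in>K. (\<bar>a t k\<bar> + \<bar>b t k\<bar>) * \<bar>g k\<bar>)"
        using cb by (auto simp: abs_mult intro!: sum_mono mult_right_mono)
      finally show ?thesis .
    qed
    show "integrable (gaussian K) (\<lambda>g. \<Sum>t\<in>T. \<Sum>k\<in>K. (\<bar>a t k\<bar> + \<bar>b t k\<bar>) * \<bar>g k\<bar>)"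
      by (intro Bochner_Integration.integrable_sum integrable_mult_right integrable_abs integrable_gaussian_id)
  qed
  have neg: "(\<integral>g. f' \<theta> g \<partial>gaussian K) \<le> 0" if \<theta>: "0 \<le> \<theta>" "\<theta> \<le> pi / 2" for \<theta>
  proof -
    define q where "q t k g = \<beta> * w \<theta> g t * (c \<theta> t k - (\<Sum>s\<in>T. w \<theta> g s * c \<theta> s k))" for t k g
    have int1: "integrable (gaussian K) (\<lambda>g. g k * w \<theta> g t)" if "k \<in> K" "t \<in> T" for k t
      using w01[where \<theta> = \<theta>] that
      by (intro integrable_gaussian_mult_bounded[where B = 1] integrable_gaussian_id) (auto simp: abs_le_iff intro: order.trans[OF _ w01(1)])
    have int2: "integrable (gaussian K) (q t k)" if t: "t \<in> T" for t k
    proof -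
      have "integrable (gaussian K) (\<lambda>g. \<beta> * (w \<theta> g t * c \<theta> t k - (\<Sum>s\<in>T. (w \<theta> g t * w \<theta> g s) * c \<theta> s k)))"
      proof (intro integrable_mult_right Bochner_Integration.integrable_diff Bochner_Integration.integrable_sum integrable_mult_left)
        show "integrable (gaussian K) (\<lambda>g. w \<theta> g t)"
          using w01 t by (intro integrable_gaussian_bounded[where B = 1]) auto
        show "integrable (gaussian K) (\<lambda>g. w \<theta> g t * w \<theta> g s)" if "s \<in> T" for s
          using w01 t that by (intro integrable_gaussian_bounded[where B = 1]) (auto simp: abs_mult intro!: mult_le_one)
      qed
      then show ?thesis by (simp add: q_def[abs_def] algebra_simps sum_distrib_left)
    qed
    have "(\<integral>g. f' \<theta> g \<partial>gaussian K) = (\<integral>g. (\<Sum>t\<in>T. \<Sum>k\<in>K. c' \<theta> t k * (g k * w \<theta> g t)) \<partial>gaussian K)"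
      unfolding f'_def by (simp add: sum_distrib_left ac_simps)
    also have "\<dots> = (\<Sum>t\<in>T. \<Sum>k\<in>K. c' \<theta> t k * (\<integral>g. g k * w \<theta> g t \<partial>gaussian K))"
      using int1 by (subst Bochner_Integration.integral_sum; force intro!: Bochner_Integration.integrable_sum sum.cong simp: Bochner_Integration.integral_sum)
    also have "\<dots> = (\<Sum>t\<in>T. \<Sum>k\<in>K. c' \<theta> t k * (\<integral>g. q t k g \<partial>gaussian K))"
      unfolding q_def w_def using gaussian_softmax_weight_by_parts[OF K _ T _ \<beta>]
      by (intro sum.cong refl arg_cong2[where f = times]) auto
    also have "\<dots> = (\<integral>g. (\<Sum>t\<in>T. \<Sum>k\<in>K. c' \<theta> t k * q t k g) \<partial>gaussian K)"
      using int2 by (subst Bochner_Integration.integral_sum; force intro!: Bochner_Integration.integrable_sum sum.cong simp: Bochner_Integration.integral_sum)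
    also have "\<dots> \<le> (\<integral>g. 0 \<partial>gaussian K)"
    proof (rule integral_mono)
      show "integrable (gaussian K) (\<lambda>g. \<Sum>t\<in>T. \<Sum>k\<in>K. c' \<theta> t k * q t k g)"
        using int2 by (auto intro!: Bochner_Integration.integrable_sum)
      fix g
      \<comment> \<open>Orthogonality of \<open>a\<close> and \<open>b\<close> removes the mixed
        terms; what remains is a multiple of the difference \<open>D\<close> of the two Gram
        matrices.\<close>
      have cc: "(\<Sum>k\<in>K. c' \<theta> t k * c \<theta> s k) = sin \<theta> * cos \<theta> * D t s" for t s
      proof -
        have "(\<Sum>k\<in>K. c' \<theta> t k * c \<theta> s k) = (\<Sum>k\<in>K. sin \<theta> * cos \<theta> * (a t k * a s k) - sin \<theta> * cos \<theta> * (b t k * b s k)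
            + (cos \<theta>)\<^sup>2 * (a t k * b s k) - (sin \<theta>)\<^sup>2 * (a s k * b t k))"
          unfolding c_def c'_def by (intro sum.cong refl) (simp add: algebra_simps power2_eq_square)
        also have "\<dots> = sin \<theta> * cos \<theta> * D t s"
          by (simp add: sum.distrib sum_subtractf sum_distrib_left[symmetric] orth D_def right_diff_distrib)
        finally show ?thesis .
      qed
      have "(\<Sum>t\<in>T. \<Sum>k\<in>K. c' \<theta> t k * q t k g)
          = (\<Sum>t\<in>T. \<beta> * (w \<theta> g t * (\<Sum>k\<in>K. c' \<theta> t k * c \<theta> t k) - (\<Sum>s\<in>T. w \<theta> g t * w \<theta> g s * (\<Sum>k\<in>K. c' \<theta> t k * c \<theta> s k))))"
      proof (rule sum.cong[OF refl])
        fix t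
        have "(\<Sum>k\<in>K. c' \<theta> t k * q t k g) = \<beta> * w \<theta> g t * ((\<Sum>k\<in>K. c' \<theta> t k * c \<theta> t k) - (\<Sum>k\<in>K. \<Sum>s\<in>T. w \<theta> g s * (c' \<theta> t k * c \<theta> s k)))"
          unfolding q_def by (simp add: sum_distrib_left sum_subtractf algebra_simps)
        also have "(\<Sum>k\<in>K. \<Sum>s\<in>T. w \<theta> g s * (c' \<theta> t k * c \<theta> s k)) = (\<Sum>s\<in>T. w \<theta> g s * (\<Sum>k\<in>K. c' \<theta> t k * c \<theta> s k))"
          by (subst sum.swap) (simp add: sum_distrib_left)
        finally show "(\<Sum>k\<in>K. c' \<theta> t k * q t k g) = \<beta> * (w \<theta> g t * (\<Sum>k\<in>K. c' \<theta> t k * c \<theta> t k) - (\<Sum>s\<in>T. w \<theta> g t * w \<theta> g s * (\<Sum>k\<in>K. c' \<theta> t k * c \<theta> s k)))"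
          by (simp add: sum_distrib_left algebra_simps)
      qed
      also have "\<dots> = \<beta> * (sin \<theta> * cos \<theta>) * ((\<Sum>t\<in>T. w \<theta> g t * D t t) - (\<Sum>t\<in>T. \<Sum>s\<in>T. w \<theta> g t * w \<theta> g s * D t s))"
        unfolding cc by (simp add: sum_distrib_left sum_subtractf algebra_simps)
      \<comment> \<open>The variance identity rewrites the bracket in terms of squared increments,
        where the hypothesis fixes the sign; \<open>sin \<theta> * cos \<theta>\<close> is
        nonnegative on the first quadrant.\<close>
      also have "\<dots> = \<beta> * (sin \<theta> * cos \<theta>) * ((\<Sum>t\<in>T. \<Sum>s\<in>T. w \<theta> g t * w \<theta> g s * (D t t + D s s - 2 * D t s)) / 2)"
        by (subst weighted_variance_identity[OF w01(3)]) simp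
      also have "\<dots> \<le> 0"
      proof (rule mult_nonneg_nonpos)
        show "0 \<le> \<beta> * (sin \<theta> * cos \<theta>)"
          using \<beta> \<theta> by (intro mult_nonneg_nonneg sin_ge_zero cos_ge_zero) auto
        have "D t t + D s s - 2 * D t s = (\<Sum>k\<in>K. (a t k - a s k)\<^sup>2) - (\<Sum>k\<in>K. (b t k - b s k)\<^sup>2)" for t s
          by (simp add: D_def power2_eq_square sum.distrib[symmetric] sum_subtractf[symmetric] sum_distrib_left algebra_simps)
        then have "D t t + D s s - 2 * D t s \<le> 0" if "t \<in> T" "s \<in> T" for t s
          using incr[OF that] by simp
        then have "(\<Sum>t\<in>T. \<Sum>s\<in>T. w \<theta> g t * w \<theta> g s * (D t t + D s s - 2 * D t s)) \<le> 0"
          using w01 by (intro sum_nonpos mult_nonneg_nonpos) auto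
        then show "(\<Sum>t\<in>T. \<Sum>s\<in>T. w \<theta> g t * w \<theta> g s * (D t t + D s s - 2 * D t s)) / 2 \<le> 0" by simp
      qed
      finally show "(\<Sum>t\<in>T. \<Sum>k\<in>K. c' \<theta> t k * q t k g) \<le> 0" .
    qed simp
    finally show ?thesis by simp
  qed
  have "(\<integral>g. f (pi / 2) g \<partial>gaussian K) \<le> (\<integral>g. f 0 g \<partial>gaussian K)"
    by (rule DERIV_nonpos_imp_nonincreasing[of 0 "pi / 2"]) (use d neg in auto)
  then show ?thesis by (simp add: f_def c_def)
qed

lemma integrable_Max_linform:
  assumes T: "finite T" "T \<noteq> {}"
  shows "integrable (gaussian K) (\<lambda>g. Max ((\<lambda>t. linform K (c t) g) ` T))"
proof (rule Bochner_Integration.integrable_bound)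
  show "integrable (gaussian K) (\<lambda>g. \<Sum>t\<in>T. \<bar>linform K (c t) g\<bar>)"
    by (intro Bochner_Integration.integrable_sum integrable_abs integrable_linform)
  show "AE g in gaussian K. norm (Max ((\<lambda>t. linform K (c t) g) ` T)) \<le> norm (\<Sum>t\<in>T. \<bar>linform K (c t) g\<bar>)"
  proof (intro AE_I2)
    fix g
    have "Max ((\<lambda>t. linform K (c t) g) ` T) \<in> (\<lambda>t. linform K (c t) g) ` T"
      using T by (intro Max_in) auto
    then obtain t where t: "t \<in> T" "Max ((\<lambda>t. linform K (c t) g) ` T) = linform K (c t) g" by auto
    then have "\<bar>linform K (c t) g\<bar> \<le> (\<Sum>t\<in>T. \<bar>linform K (c t) g\<bar>)"
      using T by (intro member_le_sum[where f = "\<lambda>t. \<bar>linform K (c t) g\<bar>"]) auto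
    then show "norm (Max ((\<lambda>t. linform K (c t) g) ` T)) \<le> norm (\<Sum>t\<in>T. \<bar>linform K (c t) g\<bar>)"
      using t by simp
  qed
qed (use T in measurable)

section \<open>The Sudakov-Fernique inequality\<close>

lemma gaussian_Max_mono_orthogonal:
  fixes a b :: "'a \<Rightarrow> 'i \<Rightarrow> real"
  assumes K: "finite K" and T: "finite T" "T \<noteq> {}"
    and orth: "\<And>s t. (\<Sum>k\<in>K. a s k * b t k) = 0"
    and incr: "\<And>s t. s \<in> T \<Longrightarrow> t \<in> T \<Longrightarrow> (\<Sum>k\<in>K. (a s k - a t k)\<^sup>2) \<le> (\<Sum>k\<in>K. (b s k - b t k)\<^sup>2)"
  shows "(\<integral>g. Max ((\<lambda>t. linform K (a t) g) ` T) \<partial>gaussian K)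
       \<le> (\<integral>g. Max ((\<lambda>t. linform K (b t) g) ` T) \<partial>gaussian K)"
proof (rule field_le_epsilon)
  fix e :: real assume e: "0 < e"
  \<comment> \<open>Makes the smoothing error at most \<open>e\<close>; the summand 1 keeps \<beta>
    positive when \<open>T\<close> is a singleton.\<close>
  define \<beta> where "\<beta> = (ln (card T) + 1) / e"
  have c: "0 \<le> ln (card T)" using T by (auto simp: Suc_le_eq card_gt_0_iff)
  then have \<beta>: "0 < \<beta>" using e by (simp add: \<beta>_def)
  have be: "ln (card T) / \<beta> \<le> e"
    using c e by (simp add: \<beta>_def field_simps)
  have "(\<integral>g. Max ((\<lambda>t. linform K (a t) g) ` T) \<partial>gaussian K)
      \<le> (\<integral>g. softmax \<beta> T (\<lambda>t. linform K (a t) g) \<partial>gaussian K)"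
    using T \<beta> by (intro integral_mono integrable_Max_linform integrable_softmax_linform) (auto intro!: softmax_ge)
  also have "\<dots> \<le> (\<integral>g. softmax \<beta> T (\<lambda>t. linform K (b t) g) \<partial>gaussian K)"
    by (rule gaussian_softmax_mono[OF K T \<beta> orth incr])
  also have "\<dots> \<le> (\<integral>g. Max ((\<lambda>t. linform K (b t) g) ` T) + ln (card T) / \<beta> \<partial>gaussian K)"
    using T \<beta> by (intro integral_mono Bochner_Integration.integrable_add integrable_Max_linform integrable_softmax_linform)
      (auto intro!: softmax_le)
  also have "\<dots> = (\<integral>g. Max ((\<lambda>t. linform K (b t) g) ` T) \<partial>gaussian K) + ln (card T) / \<beta>"
    using T by (subst Bochner_Integration.integral_add) (auto intro!: integrable_Max_linform simp: gaussian.prob_space)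
  finally show "(\<integral>g. Max ((\<lambda>t. linform K (a t) g) ` T) \<partial>gaussian K)
      \<le> (\<integral>g. Max ((\<lambda>t. linform K (b t) g) ` T) \<partial>gaussian K) + e"
    using be by linarith
qed

text \<open>Selecting and renaming coordinates pushes the product measure on \<open>K\<close>
  forward to the one on \<open>I\<close>; the other coordinates integrate out.\<close>

lemma integral_gaussian_reindex:
  fixes F :: "('i \<Rightarrow> real) \<Rightarrow> real"
  assumes f: "inj_on f I" "f ` I \<subseteq> K" and F: "F \<in> borel_measurable (gaussian I)"
  shows "(\<integral>g. F (\<lambda>i\<in>I. g (f i)) \<partial>gaussian K) = (\<integral>g. F g \<partial>gaussian I)"
proof -
  have d: "distr (gaussian K) (gaussian I) (\<lambda>g. \<lambda>i\<in>I. g (f i)) = gaussian I"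
    unfolding gaussian_def using f
    by (intro distr_PiM_reindex std_normal.prob_space_axioms) auto
  have m: "(\<lambda>g. \<lambda>i\<in>I. g (f i)) \<in> measurable (gaussian K) (gaussian I)"
    unfolding gaussian_def using f by (intro measurable_restrict) (auto intro!: measurable_component_singleton)
  show ?thesis using integral_distr[OF m F] d by simp
qed

text \<open>A finite centred Gaussian process is encoded by its coefficient vectors, so processes
  over different index sets can be compared. With \<open>c t = t\<close> this is the Gaussian width
  of \<open>T\<close>.\<close>

definition expected_max :: "'i set \<Rightarrow> 'a set \<Rightarrow> ('a \<Rightarrow> 'i \<Rightarrow> real) \<Rightarrow> real" where
  "expected_max K T c = (\<integral>g. Max ((\<lambda>t. linform K (c t) g) ` T) \<partial>gaussian K)"

lemma expected_max_reindex:
  assumes f: "inj_on f I" "f ` I \<subseteq> K" and K: "finite K" and T: "finite T" "T \<noteq> {}"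
    and c: "\<And>t i. i \<in> I \<Longrightarrow> c' t (f i) = c t i" "\<And>t k. k \<in> K - f ` I \<Longrightarrow> c' t k = 0"
  shows "expected_max K T c' = expected_max I T c"
proof -
  have "linform K (c' t) g = linform I (c t) (\<lambda>i\<in>I. g (f i))" for t g
  proof -
    have "linform K (c' t) g = linform (f ` I) (c' t) g"
      using f K c by (intro sum.mono_neutral_right) auto
    also have "\<dots> = linform I (c t) (\<lambda>i\<in>I. g (f i))"
      using f c by (subst sum.reindex) auto
    finally show ?thesis .
  qed
  then have "expected_max K T c' = (\<integral>g. Max ((\<lambda>t. linform I (c t) (\<lambda>i\<in>I. g (f i))) ` T) \<partial>gaussian K)"
    by (simp only: expected_max_def)
  also have "\<dots> = expected_max I T c"
    unfolding expected_max_def using f integrable_Max_linform[OF T, of I c]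
    by (intro integral_gaussian_reindex) auto
  finally show ?thesis .
qed

text \<open>On the disjoint sum of the index sets the two processes have disjoint supports, which
  supplies the orthogonality that the interpolation needs.\<close>

theorem sudakov_fernique:
  fixes a :: "'a \<Rightarrow> 'i \<Rightarrow> real" and b :: "'a \<Rightarrow> 'j \<Rightarrow> real"
  assumes fin: "finite I" "finite J" and T: "finite T" "T \<noteq> {}"
    and incr: "\<And>s t. s \<in> T \<Longrightarrow> t \<in> T \<Longrightarrow> (\<Sum>i\<in>I. (a s i - a t i)\<^sup>2) \<le> (\<Sum>j\<in>J. (b s j - b t j)\<^sup>2)"
  shows "expected_max I T a \<le> expected_max J T b"
proof -
  define K where "K = I <+> J"
  define a' where "a' t k = (case k of Inl i \<Rightarrow> a t i | Inr j \<Rightarrow> 0)" for t and k :: "'i + 'j"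
  define b' where "b' t k = (case k of Inl i \<Rightarrow> 0 | Inr j \<Rightarrow> b t j)" for t and k :: "'i + 'j"
  have K: "finite K" unfolding K_def using fin by auto
  have a: "expected_max K T a' = expected_max I T a"
    by (rule expected_max_reindex[where f = Inl, OF _ _ K T]) (auto simp: K_def a'_def)
  have b: "expected_max K T b' = expected_max J T b"
    by (rule expected_max_reindex[where f = Inr, OF _ _ K T]) (auto simp: K_def b'_def)
  have "expected_max K T a' \<le> expected_max K T b'"
    unfolding expected_max_def
  proof (rule gaussian_Max_mono_orthogonal[OF K T])
    show "(\<Sum>k\<in>K. a' s k * b' t k) = 0" for s t
      by (intro sum.neutral) (auto simp: a'_def b'_def split: sum.splits)
    show "(\<Sum>k\<in>K. (a' s k - a' t k)\<^sup>2) \<le> (\<Sum>k\<in>K. (b' s k - b' t k)\<^sup>2)" if "s \<in> T" "t \<in> T" for s t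
      using incr[OF that] unfolding K_def by (simp add: sum.Plus fin a'_def b'_def)
  qed
  with a b show ?thesis by simp
qed

lemma expected_max_add_le:
  assumes T: "finite T" "T \<noteq> {}"
  shows "expected_max K T (\<lambda>t k. c t k + c' t k) \<le> expected_max K T c + expected_max K T c'"
proof -
  have "expected_max K T (\<lambda>t k. c t k + c' t k)
    \<le> (\<integral>g. Max ((\<lambda>t. linform K (c t) g) ` T) + Max ((\<lambda>t. linform K (c' t) g) ` T) \<partial>gaussian K)"
    unfolding expected_max_def
  proof (intro integral_mono Bochner_Integration.integrable_add integrable_Max_linform T)
    fix g
    show "Max ((\<lambda>t. linform K (\<lambda>k. c t k + c' t k) g) ` T)
       \<le> Max ((\<lambda>t. linform K (c t) g) ` T) + Max ((\<lambda>t. linform K (c' t) g) ` T)"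
      using T by (subst Max_le_iff) (auto simp: distrib_right sum.distrib intro!: add_mono Max_ge)
  qed
  also have "\<dots> = expected_max K T c + expected_max K T c'"
    unfolding expected_max_def by (intro Bochner_Integration.integral_add integrable_Max_linform T)
  finally show ?thesis .
qed

lemma expected_max_scale:
  assumes T: "finite T" "T \<noteq> {}" and r: "0 \<le> r"
  shows "expected_max K T (\<lambda>t k. r * c t k) = r * expected_max K T c"
proof -
  have "Max ((\<lambda>t. linform K (\<lambda>k. r * c t k) g) ` T) = r * Max ((\<lambda>t. linform K (c t) g) ` T)" for g
  proof -
    have "r * Max ((\<lambda>t. linform K (c t) g) ` T) = Max ((*) r ` (\<lambda>t. linform K (c t) g) ` T)"
      using T r by (intro mono_Max_commute) (auto simp: mono_def mult_left_mono)
    then show ?thesis by (simp add: image_image sum_distrib_left ac_simps)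
  qed
  then show ?thesis unfolding expected_max_def by simp
qed

text \<open>Each single linear form is centred and lies below the maximum.\<close>

lemma expected_max_nonneg:
  assumes T: "finite T" "T \<noteq> {}"
  shows "0 \<le> expected_max K T c"
proof -
  obtain t where t: "t \<in> T" using T by auto
  have "(\<integral>g. linform K (c t) g \<partial>gaussian K) = 0"
    by (subst Bochner_Integration.integral_sum)
       (auto intro!: integrable_gaussian_id sum.neutral simp: integral_gaussian_component[where f = "\<lambda>x. x"] integral_std_normal_id)
  moreover have "(\<integral>g. linform K (c t) g \<partial>gaussian K) \<le> expected_max K T c"
    unfolding expected_max_def using T t
    by (intro integral_mono integrable_linform integrable_Max_linform) auto
  ultimately show ?thesis by simp
qed

section \<open>Second moments of Gaussian linear forms\<close>

lemma integrable_gaussian_mult: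
  fixes K :: "'i set"
  assumes "finite K" "i \<in> K" "j \<in> K"
  shows "integrable (gaussian K) (\<lambda>g. g i * g j)"
proof (rule Bochner_Integration.integrable_bound)
  show "integrable (gaussian K) (\<lambda>g. (g i)\<^sup>2 + (g j)\<^sup>2)"
    using assms by (intro Bochner_Integration.integrable_add integrable_gaussian_component[where f = "\<lambda>x. x\<^sup>2"] integrable_std_normal_power)
  show "AE g in gaussian K. norm (g i * g j) \<le> norm ((g i)\<^sup>2 + (g j)\<^sup>2)"
  proof (intro AE_I2)
    fix g :: "'i \<Rightarrow> real"
    have "\<bar>g i * g j\<bar> \<le> (g i)\<^sup>2 + (g j)\<^sup>2"
      using sum_squares_bound[of "\<bar>g i\<bar>" "\<bar>g j\<bar>"] abs_ge_zero[of "g i * g j"]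
      by (simp only: abs_mult mult.assoc power2_abs)
    then show "norm (g i * g j) \<le> norm ((g i)\<^sup>2 + (g j)\<^sup>2)" by simp
  qed
qed (use assms in measurable)

lemma integral_gaussian_mult:
  assumes K: "finite K" "i \<in> K" "j \<in> K"
  shows "(\<integral>g. g i * g j \<partial>gaussian K) = (if i = j then 1 else 0)"
proof (cases "i = j")
  case True
  then show ?thesis
    using integral_gaussian_component[OF K(2), of "\<lambda>x. x\<^sup>2"] integral_std_normal_square by (simp add: power2_eq_square)
next
  case False
  define I where "I = K - {i}"
  have KI: "K = insert i I" "i \<notin> I" "finite I" "j \<in> I" using K False by (auto simp: I_def)
  have "(\<integral>g. g i * g j \<partial>gaussian K) = (\<integral>g. (\<integral>y. (g(i := y)) i * (g(i := y)) j \<partial>std_normal) \<partial>gaussian I)"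
    unfolding KI(1) using integrable_gaussian_mult[OF K] KI by (intro gaussian_insert_integral) auto
  also have "\<dots> = 0" using False by (simp add: integral_std_normal_id)
  finally show ?thesis using False by simp
qed

lemma linform_square:
  "(linform K c g)\<^sup>2 = (\<Sum>i\<in>K. \<Sum>j\<in>K. c i * c j * (g i * g j))"
  unfolding power2_eq_square sum_product by (intro sum.cong refl) (simp add: ac_simps)

lemma integrable_linform_square:
  assumes K: "finite K"
  shows "integrable (gaussian K) (\<lambda>g. (linform K c g)\<^sup>2)"
  unfolding linform_square
  by (intro Bochner_Integration.integrable_sum integrable_mult_right integrable_gaussian_mult K)

lemma integral_linform_square:
  assumes K: "finite K"
  shows "(\<integral>g. (linform K c g)\<^sup>2 \<partial>gaussian K) = (\<Sum>k\<in>K. (c k)\<^sup>2)"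
proof -
  have "(\<integral>g. (linform K c g)\<^sup>2 \<partial>gaussian K) = (\<Sum>i\<in>K. \<Sum>j\<in>K. c i * c j * (\<integral>g. g i * g j \<partial>gaussian K))"
    unfolding linform_square using K
    by (simp add: Bochner_Integration.integral_sum integrable_gaussian_mult Bochner_Integration.integrable_sum)
  also have "\<dots> = (\<Sum>i\<in>K. \<Sum>j\<in>K. if i = j then c i * c j else 0)"
    using K by (intro sum.cong refl) (simp add: integral_gaussian_mult)
  also have "\<dots> = (\<Sum>k\<in>K. (c k)\<^sup>2)" using K by (simp add: power2_eq_square)
  finally show ?thesis .
qed

section \<open>Invariance of a pair of Gaussian vectors under rotation by 45 degrees\<close>

lemma std_normal_density_rotate:
  assumes "r\<^sup>2 = 1 / 2"
  shows "std_normal_density (r * (u + v)) * std_normal_density (r * (u - v))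
       = std_normal_density u * std_normal_density v"
proof -
  have "(r * (u + v))\<^sup>2 + (r * (u - v))\<^sup>2 = u\<^sup>2 + v\<^sup>2"
    unfolding power_mult_distrib assms by (simp add: power2_eq_square algebra_simps)
  then have "exp (- (r * (u + v))\<^sup>2 / 2) * exp (- (r * (u - v))\<^sup>2 / 2) = exp (- u\<^sup>2 / 2) * exp (- v\<^sup>2 / 2)"
    unfolding exp_add[symmetric] by (simp add: field_simps)
  then show ?thesis by (simp add: std_normal_density_def)
qed

lemma nn_integral_std_normal:
  assumes "f \<in> borel_measurable borel"
  shows "(\<integral>\<^sup>+x. f x \<partial>std_normal) = (\<integral>\<^sup>+x. ennreal (std_normal_density x) * f x \<partial>lborel)"
  using assms by (intro nn_integral_density) auto

text \<open>The rotation is carried out as two one-dimensional affine substitutions with Fubini in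
  between: \<open>y = sqrt 2 * u - x\<close> for fixed \<open>x\<close>, then
  \<open>x = r * (u + v)\<close> for fixed \<open>u\<close>. Their Jacobians \<open>sqrt 2\<close>
  and \<open>r\<close> cancel.\<close>

lemma std_normal_rotate:
  fixes f :: "real \<Rightarrow> real \<Rightarrow> ennreal"
  assumes f [measurable]: "case_prod f \<in> borel_measurable (borel \<Otimes>\<^sub>M borel)" and r: "r = 1 / sqrt 2"
  shows "(\<integral>\<^sup>+x. \<integral>\<^sup>+y. f (r * (x + y)) (r * (x - y)) \<partial>std_normal \<partial>std_normal)
       = (\<integral>\<^sup>+x. \<integral>\<^sup>+y. f x y \<partial>std_normal \<partial>std_normal)"
proof -
  let ?d = std_normal_density
  have r0: "0 < r" "r * sqrt 2 = 1" "sqrt 2 * r = 1" "r\<^sup>2 = 1 / 2" using r by (auto simp: power_divide)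
  have r2: "r * (2 * x) = sqrt 2 * x" for x
    unfolding r by (simp add: field_simps)
  have arg: "r * (u + v) = x \<Longrightarrow> sqrt 2 * u - x = r * (u - v)" for u v x
    unfolding r2[of u, symmetric] by (auto simp: algebra_simps)
  have arg': "sqrt 2 * (r * (u + v)) - u = v" for u v
    using r0(3) by (metis add_diff_cancel_left' mult.assoc mult_1)
  have "(\<integral>\<^sup>+x. \<integral>\<^sup>+y. f (r * (x + y)) (r * (x - y)) \<partial>std_normal \<partial>std_normal)
    = (\<integral>\<^sup>+x. \<integral>\<^sup>+y. ennreal (?d x * ?d y) * f (r * (x + y)) (r * (x - y)) \<partial>lborel \<partial>lborel)"
    by (simp add: nn_integral_std_normal nn_integral_cmult[symmetric] ennreal_mult mult.assoc)
  also have "\<dots> = (\<integral>\<^sup>+x. ennreal (sqrt 2) * (\<integral>\<^sup>+u. ennreal (?d x * ?d (sqrt 2 * u - x)) * f u (sqrt 2 * x - u) \<partial>lborel) \<partial>lborel)"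
  proof (intro nn_integral_cong)
    fix x :: real
    have e: "r * (x + (- x + sqrt 2 * u)) = u" "r * (x - (- x + sqrt 2 * u)) = sqrt 2 * x - u"
      "- x + sqrt 2 * u = sqrt 2 * u - x" for u
    proof -
      have "r * (sqrt 2 * u) = u" using r0(2) by (simp only: mult.assoc[symmetric] mult_1)
      moreover have "r * (x - (- x + sqrt 2 * u)) = r * (2 * x) - r * (sqrt 2 * u)" by (simp add: algebra_simps)
      ultimately show "r * (x + (- x + sqrt 2 * u)) = u" "r * (x - (- x + sqrt 2 * u)) = sqrt 2 * x - u"
        unfolding r2 by simp_all
    qed simp
    have "(\<integral>\<^sup>+y. ennreal (?d x * ?d y) * f (r * (x + y)) (r * (x - y)) \<partial>lborel)
      = \<bar>sqrt 2\<bar> * (\<integral>\<^sup>+u. ennreal (?d x * ?d (- x + sqrt 2 * u)) * f (r * (x + (- x + sqrt 2 * u))) (r * (x - (- x + sqrt 2 * u))) \<partial>lborel)"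
      by (rule nn_integral_real_affine) auto
    then show "(\<integral>\<^sup>+y. ennreal (?d x * ?d y) * f (r * (x + y)) (r * (x - y)) \<partial>lborel)
      = ennreal (sqrt 2) * (\<integral>\<^sup>+u. ennreal (?d x * ?d (sqrt 2 * u - x)) * f u (sqrt 2 * x - u) \<partial>lborel)"
      unfolding e(1,2) unfolding e(3) by simp
  qed
  also have "\<dots> = ennreal (sqrt 2) * (\<integral>\<^sup>+x. (\<integral>\<^sup>+u. ennreal (?d x * ?d (sqrt 2 * u - x)) * f u (sqrt 2 * x - u) \<partial>lborel) \<partial>lborel)"
    by (intro nn_integral_cmult) measurable
  also have "(\<integral>\<^sup>+x. (\<integral>\<^sup>+u. ennreal (?d x * ?d (sqrt 2 * u - x)) * f u (sqrt 2 * x - u) \<partial>lborel) \<partial>lborel)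
     = (\<integral>\<^sup>+u. (\<integral>\<^sup>+x. ennreal (?d x * ?d (sqrt 2 * u - x)) * f u (sqrt 2 * x - u) \<partial>lborel) \<partial>lborel)"
    by (rule lborel_pair.Fubini') measurable
  also have "\<dots> = (\<integral>\<^sup>+u. ennreal r * (\<integral>\<^sup>+v. ennreal (?d u * ?d v) * f u v \<partial>lborel) \<partial>lborel)"
  proof (intro nn_integral_cong)
    fix u :: real
    have "(\<integral>\<^sup>+x. ennreal (?d x * ?d (sqrt 2 * u - x)) * f u (sqrt 2 * x - u) \<partial>lborel)
      = ennreal r * (\<integral>\<^sup>+v. ennreal (?d (r * u + r * v) * ?d (sqrt 2 * u - (r * u + r * v))) * f u (sqrt 2 * (r * u + r * v) - u) \<partial>lborel)"
      using r0 by (subst nn_integral_real_affine[where c = r and t = "r * u"]) auto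
    also have "\<dots> = ennreal r * (\<integral>\<^sup>+v. ennreal (?d u * ?d v) * f u v \<partial>lborel)"
    proof (rule arg_cong[where f = "(*) (ennreal r)"], rule nn_integral_cong)
      fix v :: real
      show "ennreal (?d (r * u + r * v) * ?d (sqrt 2 * u - (r * u + r * v))) * f u (sqrt 2 * (r * u + r * v) - u)
        = ennreal (?d u * ?d v) * f u v"
      proof -
        have a: "r * u + r * v = r * (u + v)" by (simp only: distrib_left)
        show ?thesis unfolding a arg[OF refl] arg' std_normal_density_rotate[OF r0(4)] ..
      qed
    qed
    finally show "(\<integral>\<^sup>+x. ennreal (?d x * ?d (sqrt 2 * u - x)) * f u (sqrt 2 * x - u) \<partial>lborel)
      = ennreal r * (\<integral>\<^sup>+v. ennreal (?d u * ?d v) * f u v \<partial>lborel)" .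
  qed
  also have "\<dots> = ennreal r * (\<integral>\<^sup>+u. (\<integral>\<^sup>+v. ennreal (?d u * ?d v) * f u v \<partial>lborel) \<partial>lborel)"
    by (intro nn_integral_cmult) measurable
  also have "ennreal (sqrt 2) * \<dots> = (\<integral>\<^sup>+u. (\<integral>\<^sup>+v. ennreal (?d u * ?d v) * f u v \<partial>lborel) \<partial>lborel)"
    using r0 by (simp add: mult.assoc[symmetric] ennreal_mult[symmetric])
  also have "\<dots> = (\<integral>\<^sup>+x. \<integral>\<^sup>+y. f x y \<partial>std_normal \<partial>std_normal)"
    by (simp add: nn_integral_std_normal nn_integral_cmult[symmetric] ennreal_mult mult.assoc)
  finally show ?thesis .
qed

text \<open>Splits coordinate \<open>i\<close> off both vectors and moves the two scalars innermost,
  where the planar rotation can act on them.\<close>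

lemma gaussian_pair_nn_integral_insert:
  fixes F :: "('i \<Rightarrow> real) \<Rightarrow> ('i \<Rightarrow> real) \<Rightarrow> ennreal"
  assumes I: "finite I" "i \<notin> I"
    and F: "case_prod F \<in> borel_measurable (gaussian (insert i I) \<Otimes>\<^sub>M gaussian (insert i I))"
  shows "(\<integral>\<^sup>+A. \<integral>\<^sup>+B. F A B \<partial>gaussian (insert i I) \<partial>gaussian (insert i I))
       = (\<integral>\<^sup>+A. \<integral>\<^sup>+B. \<integral>\<^sup>+a. \<integral>\<^sup>+b. F (A(i := a)) (B(i := b)) \<partial>std_normal \<partial>std_normal \<partial>gaussian I \<partial>gaussian I)"
proof -
  note F' [measurable] = F[unfolded gaussian_def]
  let ?P = "PiM I (\<lambda>_. std_normal)" and ?Q = "PiM (insert i I) (\<lambda>_. std_normal)"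
  interpret P: sigma_finite_measure ?P
    using prob_space_gaussian[of I] by (simp add: gaussian_def prob_space_imp_sigma_finite)
  interpret Q: sigma_finite_measure ?Q
    using prob_space_gaussian[of "insert i I"] by (simp add: gaussian_def prob_space_imp_sigma_finite)
  interpret PN: pair_sigma_finite std_normal ?P ..
  have "(\<integral>\<^sup>+A. \<integral>\<^sup>+B. F A B \<partial>?Q \<partial>?Q) = (\<integral>\<^sup>+A. \<integral>\<^sup>+a. \<integral>\<^sup>+B. F (A(i := a)) B \<partial>?Q \<partial>std_normal \<partial>?P)"
    by (rule gprod.product_nn_integral_insert[OF I]) measurable
  also have "\<dots> = (\<integral>\<^sup>+A. \<integral>\<^sup>+a. \<integral>\<^sup>+B. \<integral>\<^sup>+b. F (A(i := a)) (B(i := b)) \<partial>std_normal \<partial>?P \<partial>std_normal \<partial>?P)"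
  proof (intro nn_integral_cong)
    fix A a assume A: "A \<in> space ?P" and a: "a \<in> space std_normal"
    have "A(i := a) \<in> space ?Q"
      using measurable_space[OF measurable_component_update[OF A I(2)] a] .
    then have "F (A(i := a)) \<in> borel_measurable ?Q"
      using measurable_Pair2[OF F'] by simp
    then show "(\<integral>\<^sup>+B. F (A(i := a)) B \<partial>?Q) = (\<integral>\<^sup>+B. \<integral>\<^sup>+b. F (A(i := a)) (B(i := b)) \<partial>std_normal \<partial>?P)"
      by (rule gprod.product_nn_integral_insert[OF I])
  qed
  also have "\<dots> = (\<integral>\<^sup>+A. \<integral>\<^sup>+B. \<integral>\<^sup>+a. \<integral>\<^sup>+b. F (A(i := a)) (B(i := b)) \<partial>std_normal \<partial>std_normal \<partial>?P \<partial>?P)"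
  proof (intro nn_integral_cong)
    fix A assume A [measurable]: "A \<in> space ?P"
    have u: "(\<lambda>v. A(i := v)) \<in> measurable std_normal ?Q"
      by (rule measurable_component_update[OF A I(2)])
    have [measurable]: "(\<lambda>x. F (A(i := fst (fst x))) ((snd (fst x))(i := snd x))) \<in> borel_measurable ((std_normal \<Otimes>\<^sub>M ?P) \<Otimes>\<^sub>M std_normal)"
    proof (rule measurable_compose[OF _ F', of "\<lambda>x. (A(i := fst (fst x)), (snd (fst x))(i := snd x))", simplified])
      have "(\<lambda>x. A(i := fst (fst x))) \<in> measurable ((std_normal \<Otimes>\<^sub>M ?P) \<Otimes>\<^sub>M std_normal) ?Q"
        by (rule measurable_compose[OF _ u]) measurable
      moreover have "(\<lambda>x. (snd (fst x))(i := snd x)) \<in> measurable ((std_normal \<Otimes>\<^sub>M ?P) \<Otimes>\<^sub>M std_normal) ?Q"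
        using measurable_compose[OF _ measurable_add_dim[where I = I and M = "\<lambda>_. std_normal" and i = i], of "\<lambda>x. (snd (fst x), snd x)"]
        by simp
      ultimately show "(\<lambda>x. (A(i := fst (fst x)), (snd (fst x))(i := snd x))) \<in> measurable ((std_normal \<Otimes>\<^sub>M ?P) \<Otimes>\<^sub>M std_normal) (?Q \<Otimes>\<^sub>M ?Q)"
        by (rule measurable_Pair)
    qed
    show "(\<integral>\<^sup>+a. \<integral>\<^sup>+B. \<integral>\<^sup>+b. F (A(i := a)) (B(i := b)) \<partial>std_normal \<partial>?P \<partial>std_normal)
      = (\<integral>\<^sup>+B. \<integral>\<^sup>+a. \<integral>\<^sup>+b. F (A(i := a)) (B(i := b)) \<partial>std_normal \<partial>std_normal \<partial>?P)"
    proof (rule PN.Fubini'[symmetric])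
      have "(\<lambda>x. \<integral>\<^sup>+ b. F (A(i := fst x)) ((snd x)(i := b)) \<partial>std_normal) \<in> borel_measurable (std_normal \<Otimes>\<^sub>M ?P)"
        by (rule sigma_finite_measure.borel_measurable_nn_integral[OF std_normal.sigma_finite_measure_axioms])
          (simp add: case_prod_beta)
      then show "(\<lambda>(x, y). \<integral>\<^sup>+ b. F (A(i := x)) (y(i := b)) \<partial>std_normal) \<in> borel_measurable (std_normal \<Otimes>\<^sub>M ?P)"
        by (simp add: case_prod_beta)
    qed
  qed
  finally show ?thesis by (simp only: gaussian_def)
qed

text \<open>The rotation acts on every pair \<open>(A i, B i)\<close> separately, hence induction
  over the coordinates. Nonnegative integrals spare all integrability conditions.\<close>

lemma gaussian_rotate:
  fixes F :: "('i \<Rightarrow> real) \<Rightarrow> ('i \<Rightarrow> real) \<Rightarrow> ennreal"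
  assumes r: "r = 1 / sqrt 2" and I: "finite I"
    and F: "case_prod F \<in> borel_measurable (gaussian I \<Otimes>\<^sub>M gaussian I)"
  shows "(\<integral>\<^sup>+A. \<integral>\<^sup>+B. F (\<lambda>i\<in>I. r * (A i + B i)) (\<lambda>i\<in>I. r * (A i - B i)) \<partial>gaussian I \<partial>gaussian I)
       = (\<integral>\<^sup>+A. \<integral>\<^sup>+B. F A B \<partial>gaussian I \<partial>gaussian I)"
  using I F
proof (induction I arbitrary: F rule: finite_induct)
  case empty
  \<comment> \<open>Over the empty index set the space has a single point, the function that is
    \<open>undefined\<close> everywhere.\<close>
  have "(\<lambda>i\<in>{}. f i) = A" if "A \<in> space (gaussian {})" for A f :: "'i \<Rightarrow> real"
    using that by (simp add: space_gaussian restrict_def)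
  then show ?case by (intro nn_integral_cong arg_cong2[where f = F])
next
  case (insert i I)
  note F [measurable] = insert.prems
  let ?I = "insert i I"
  have rot: "(\<lambda>x. \<lambda>j\<in>J. r * (fst x j + snd x j)) \<in> measurable (gaussian J \<Otimes>\<^sub>M gaussian J) (gaussian J)"
    "(\<lambda>x. \<lambda>j\<in>J. r * (fst x j - snd x j)) \<in> measurable (gaussian J \<Otimes>\<^sub>M gaussian J) (gaussian J)" for J :: "'i set"
    unfolding gaussian_def by (intro measurable_restrict; measurable)+
  have FR: "(\<lambda>(A, B). F (\<lambda>j\<in>?I. r * (A j + B j)) (\<lambda>j\<in>?I. r * (A j - B j))) \<in> borel_measurable (gaussian ?I \<Otimes>\<^sub>M gaussian ?I)"
    using measurable_compose[OF measurable_Pair[OF rot] F] by (simp add: case_prod_beta)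
  \<comment> \<open>The rotated new coordinate is integrated out first. The induction hypothesis
    then rotates the arguments of \<open>G\<close>, and the planar case undoes the rotation inside
    \<open>G\<close>.\<close>
  define G where "G A B = (\<integral>\<^sup>+a. \<integral>\<^sup>+b. F (A(i := r * (a + b))) (B(i := r * (a - b))) \<partial>std_normal \<partial>std_normal)" for A B
  have upd: "(\<lambda>x. (fst x)(i := snd x)) \<in> measurable (gaussian I \<Otimes>\<^sub>M borel) (gaussian ?I)"
  proof -
    have "(\<lambda>x. (fst x)(i := snd x)) \<in> measurable (PiM I (\<lambda>_. std_normal) \<Otimes>\<^sub>M std_normal) (PiM ?I (\<lambda>_. std_normal))"
      using measurable_add_dim[where I = I and M = "\<lambda>_. std_normal" and i = i] by (simp add: case_prod_beta')
    then show ?thesis unfolding gaussian_def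
      by (subst measurable_cong_sets[OF _ refl]) (auto intro!: sets_pair_measure_cong)
  qed
  have G: "case_prod G \<in> borel_measurable (gaussian I \<Otimes>\<^sub>M gaussian I)"
  proof -
    let ?M = "((gaussian I \<Otimes>\<^sub>M gaussian I) \<Otimes>\<^sub>M std_normal) \<Otimes>\<^sub>M std_normal"
    have 1: "(\<lambda>x. (fst (fst (fst x)))(i := r * (snd (fst x) + snd x))) \<in> measurable ?M (gaussian ?I)"
      by (rule measurable_compose[OF _ upd, of "\<lambda>x. (fst (fst (fst x)), r * (snd (fst x) + snd x))", simplified]) measurable
    have 2: "(\<lambda>x. (snd (fst (fst x)))(i := r * (snd (fst x) - snd x))) \<in> measurable ?M (gaussian ?I)"
      by (rule measurable_compose[OF _ upd, of "\<lambda>x. (snd (fst (fst x)), r * (snd (fst x) - snd x))", simplified]) measurable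
    have 3: "(\<lambda>x. F ((fst (fst (fst x)))(i := r * (snd (fst x) + snd x))) ((snd (fst (fst x)))(i := r * (snd (fst x) - snd x)))) \<in> borel_measurable ?M"
      using measurable_compose[OF measurable_Pair[OF 1 2] F] by simp
    have 4: "(\<lambda>x. \<integral>\<^sup>+b. F ((fst (fst x))(i := r * (snd x + b))) ((snd (fst x))(i := r * (snd x - b))) \<partial>std_normal)
        \<in> borel_measurable ((gaussian I \<Otimes>\<^sub>M gaussian I) \<Otimes>\<^sub>M std_normal)"
      by (rule std_normal.borel_measurable_nn_integral) (use 3 in \<open>simp add: case_prod_beta\<close>)
    have "(\<lambda>x. \<integral>\<^sup>+a. \<integral>\<^sup>+b. F ((fst x)(i := r * (a + b))) ((snd x)(i := r * (a - b))) \<partial>std_normal \<partial>std_normal)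
        \<in> borel_measurable (gaussian I \<Otimes>\<^sub>M gaussian I)"
      by (rule std_normal.borel_measurable_nn_integral) (use 4 in \<open>simp add: case_prod_beta\<close>)
    then show ?thesis by (simp add: G_def[abs_def] case_prod_beta')
  qed
  have pt: "(\<lambda>j\<in>?I. r * ((A(i := a)) j + (B(i := b)) j)) = (\<lambda>j\<in>I. r * (A j + B j))(i := r * (a + b))"
    "(\<lambda>j\<in>?I. r * ((A(i := a)) j - (B(i := b)) j)) = (\<lambda>j\<in>I. r * (A j - B j))(i := r * (a - b))" for A B a b
    using insert.hyps(2) by (auto simp: fun_eq_iff restrict_def)
  have "(\<integral>\<^sup>+A. \<integral>\<^sup>+B. F (\<lambda>j\<in>?I. r * (A j + B j)) (\<lambda>j\<in>?I. r * (A j - B j)) \<partial>gaussian ?I \<partial>gaussian ?I)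
    = (\<integral>\<^sup>+A. \<integral>\<^sup>+B. G (\<lambda>j\<in>I. r * (A j + B j)) (\<lambda>j\<in>I. r * (A j - B j)) \<partial>gaussian I \<partial>gaussian I)"
    unfolding G_def using gaussian_pair_nn_integral_insert[OF insert.hyps(1,2) FR] unfolding pt .
  also have "\<dots> = (\<integral>\<^sup>+A. \<integral>\<^sup>+B. G A B \<partial>gaussian I \<partial>gaussian I)"
    by (rule insert.IH[OF G])
  also have "\<dots> = (\<integral>\<^sup>+A. \<integral>\<^sup>+B. \<integral>\<^sup>+a. \<integral>\<^sup>+b. F (A(i := a)) (B(i := b)) \<partial>std_normal \<partial>std_normal \<partial>gaussian I \<partial>gaussian I)"
  proof (intro nn_integral_cong)
    fix A B :: "'i \<Rightarrow> real" assume AB: "A \<in> space (gaussian I)" "B \<in> space (gaussian I)"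
    have 1: "(\<lambda>x. A(i := fst x)) \<in> measurable (borel \<Otimes>\<^sub>M borel) (gaussian ?I)"
      by (rule measurable_compose[OF _ upd, of "\<lambda>x. (A, fst x)", simplified]) (use AB in measurable)
    have 2: "(\<lambda>x. B(i := snd x)) \<in> measurable (borel \<Otimes>\<^sub>M borel) (gaussian ?I)"
      by (rule measurable_compose[OF _ upd, of "\<lambda>x. (B, snd x)", simplified]) (use AB in measurable)
    show "G A B = (\<integral>\<^sup>+a. \<integral>\<^sup>+b. F (A(i := a)) (B(i := b)) \<partial>std_normal \<partial>std_normal)"
      unfolding G_def
      by (rule std_normal_rotate[of "\<lambda>a b. F (A(i := a)) (B(i := b))", OF _ r])
        (use measurable_compose[OF measurable_Pair[OF 1 2] F] in \<open>simp add: case_prod_beta\<close>)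
  qed
  also have "\<dots> = (\<integral>\<^sup>+A. \<integral>\<^sup>+B. F A B \<partial>gaussian ?I \<partial>gaussian ?I)"
    by (rule gaussian_pair_nn_integral_insert[OF insert.hyps(1,2) F, symmetric])
  finally show ?case .
qed

section \<open>Random matrices on finite sets\<close>

interpretation gaussian_pair: pair_prob_space "gaussian I" "gaussian J" for I J
  by unfold_locales

lemma L2_set_scale: "L2_set (\<lambda>k. f k * r) A = L2_set f A * \<bar>r\<bar>"
  unfolding L2_set_def power_mult_distrib sum_distrib_right[symmetric] real_sqrt_mult by simp

lemma L2_set_power2: "(L2_set f A)\<^sup>2 = (\<Sum>k\<in>A. (f k)\<^sup>2)"
  unfolding L2_set_def by (simp add: sum_nonneg)

lemma L2_set_abs_diff_le: "\<bar>L2_set a D - L2_set b D\<bar> \<le> L2_set (\<lambda>k. a k - b k) D"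
proof -
  have "L2_set a D \<le> L2_set (\<lambda>k. a k - b k) D + L2_set b D"
    using L2_set_triangle_ineq[of "\<lambda>k. a k - b k" b D] by simp
  moreover have "L2_set b D \<le> L2_set (\<lambda>k. a k - b k) D + L2_set a D"
    using L2_set_triangle_ineq[of "\<lambda>k. b k - a k" a D]
    by (simp add: L2_set_def power2_commute)
  ultimately show ?thesis by linarith
qed

section \<open>Gaussian processes with tensor coefficients\<close>

lemma L2_set_normalized_diff_le:
  fixes e :: real
  assumes e: "0 < e"
  shows "L2_set (\<lambda>k. a k / (L2_set a D + e) - b k / (L2_set b D + e)) D
       \<le> 2 * L2_set (\<lambda>k. a k - b k) D / (L2_set b D + e)"
proof -
  let ?a = "L2_set a D" and ?b = "L2_set b D" and ?\<delta> = "L2_set (\<lambda>k. a k - b k) D"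
  have pos: "0 < ?a + e" "0 < ?b + e" "0 \<le> ?a" using e by (auto intro: add_nonneg_pos)
  have "L2_set (\<lambda>k. a k / (?a + e) - b k / (?b + e)) D
      = L2_set (\<lambda>k. (a k - b k) * (1 / (?b + e)) + a k * ((?b - ?a) / ((?a + e) * (?b + e)))) D"
  proof (intro L2_set_cong refl)
    have "u / p - v / q = (u - v) * (1 / q) + u * ((q - p) / (p * q))" if "0 < p" "0 < q" for u v p q :: real
      using that by (simp add: divide_simps) (simp add: algebra_simps)
    from this[OF pos(1,2)]
    show "a k / (?a + e) - b k / (?b + e) = (a k - b k) * (1 / (?b + e)) + a k * ((?b - ?a) / ((?a + e) * (?b + e)))" for k
      by simp
  qed
  also have "\<dots> \<le> ?\<delta> * \<bar>1 / (?b + e)\<bar> + ?a * \<bar>(?b - ?a) / ((?a + e) * (?b + e))\<bar>"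
    using L2_set_triangle_ineq[of "\<lambda>k. (a k - b k) * (1 / (?b + e))" "\<lambda>k. a k * ((?b - ?a) / ((?a + e) * (?b + e)))" D]
    unfolding L2_set_scale .
  also have "?a * \<bar>(?b - ?a) / ((?a + e) * (?b + e))\<bar> = (?a / (?a + e)) * (\<bar>?a - ?b\<bar> / (?b + e))"
    using pos by (simp add: abs_mult abs_minus_commute)
  also have "\<dots> \<le> 1 * (?\<delta> / (?b + e))"
    using pos e by (intro mult_mono divide_right_mono L2_set_abs_diff_le) (auto simp: divide_le_eq_1_pos[OF pos(1)])
  finally show ?thesis using pos by simp
qed

text \<open>A product rule: with \<open>\<phi> t = t / (|t| + e)\<close> the increment is
  \<open>(x s - x t) \<phi> s + x t (\<phi> s - \<phi> t)\<close>. In the first term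
  \<open>|\<phi> s| \<le> 1\<close>; in the second the factor \<open>|t| + e\<close> from the bound
  on \<open>|x t|\<close> cancels the one in the Lipschitz estimate for
  \<open>\<phi>\<close>.\<close>

lemma tensor_increment:
  fixes e :: real and x :: "(nat \<Rightarrow> real) \<Rightarrow> nat \<Rightarrow> real"
  assumes e: "0 < e" and \<rho>: "L2_set (x t) {..<m} \<le> \<rho> * (L2_set t {..<d} + e)"
  shows "(\<Sum>(i, k)\<in>{..<m} \<times> {..<d}. (x s i * s k / (L2_set s {..<d} + e) - x t i * t k / (L2_set t {..<d} + e))\<^sup>2)
       \<le> 2 * (\<Sum>i<m. (x s i - x t i)\<^sup>2) + 8 * \<rho>\<^sup>2 * (\<Sum>k<d. (s k - t k)\<^sup>2)"
proof -
  let ?n = "\<lambda>t. L2_set t {..<d}"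
  define \<phi> where "\<phi> t k = t k / (?n t + e)" for t k
  have pos: "0 < ?n t + e" for t using e by (auto intro: add_nonneg_pos)
  have "(\<Sum>(i, k)\<in>{..<m} \<times> {..<d}. (x s i * s k / (?n s + e) - x t i * t k / (?n t + e))\<^sup>2)
    = (\<Sum>i<m. \<Sum>k<d. ((x s i - x t i) * \<phi> s k + x t i * (\<phi> s k - \<phi> t k))\<^sup>2)"
    unfolding sum.cartesian_product[symmetric] \<phi>_def
    by (intro sum.cong refl arg_cong[where f = "\<lambda>x. x\<^sup>2"]) (simp add: algebra_simps diff_divide_distrib)
  also have "\<dots> \<le> (\<Sum>i<m. \<Sum>k<d. 2 * ((x s i - x t i)\<^sup>2 * (\<phi> s k)\<^sup>2) + 2 * ((x t i)\<^sup>2 * (\<phi> s k - \<phi> t k)\<^sup>2))"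
  proof (intro sum_mono)
    fix i k
    have "(p + q)\<^sup>2 \<le> 2 * p\<^sup>2 + 2 * q\<^sup>2" for p q :: real
      using sum_squares_bound[of p q] by (simp add: power2_sum)
    from this[of "(x s i - x t i) * \<phi> s k" "x t i * (\<phi> s k - \<phi> t k)"]
    show "((x s i - x t i) * \<phi> s k + x t i * (\<phi> s k - \<phi> t k))\<^sup>2 \<le> 2 * ((x s i - x t i)\<^sup>2 * (\<phi> s k)\<^sup>2) + 2 * ((x t i)\<^sup>2 * (\<phi> s k - \<phi> t k)\<^sup>2)"
      by (simp add: power_mult_distrib)
  qed
  also have "\<dots> = 2 * ((\<Sum>i<m. (x s i - x t i)\<^sup>2) * (L2_set (\<phi> s) {..<d})\<^sup>2)
      + 2 * ((L2_set (x t) {..<m})\<^sup>2 * (L2_set (\<lambda>k. \<phi> s k - \<phi> t k) {..<d})\<^sup>2)"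
    unfolding L2_set_power2 sum_product by (simp add: sum.distrib sum_distrib_left)
  also have "\<dots> \<le> 2 * ((\<Sum>i<m. (x s i - x t i)\<^sup>2) * 1)
      + 2 * ((\<rho> * (?n t + e))\<^sup>2 * (2 * L2_set (\<lambda>k. s k - t k) {..<d} / (?n t + e))\<^sup>2)"
  proof (intro add_mono mult_left_mono mult_mono power_mono \<rho>)
    have "L2_set (\<phi> s) {..<d} = ?n s / (?n s + e)"
      using L2_set_scale[of s "1 / (?n s + e)"] pos[of s] by (simp add: \<phi>_def[abs_def])
    then have "L2_set (\<phi> s) {..<d} \<le> 1" using pos[of s] e by simp
    then show "(L2_set (\<phi> s) {..<d})\<^sup>2 \<le> 1" by (simp add: power_le_one)
    show "L2_set (\<lambda>k. \<phi> s k - \<phi> t k) {..<d} \<le> 2 * L2_set (\<lambda>k. s k - t k) {..<d} / (?n t + e)"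
      unfolding \<phi>_def by (rule L2_set_normalized_diff_le[OF e])
  qed (auto intro: sum_nonneg)
  also have "\<dots> = 2 * (\<Sum>i<m. (x s i - x t i)\<^sup>2) + 8 * \<rho>\<^sup>2 * (L2_set (\<lambda>k. s k - t k) {..<d})\<^sup>2"
    using pos[of t] by (simp add: power_mult_distrib power_divide)
  finally show ?thesis unfolding L2_set_power2 .
qed

text \<open>The bound on the increments is exactly the squared increment of a sum of two independent
  linear processes, with coefficients \<open>sqrt 2 * x t\<close> and
  \<open>sqrt 8 * \<rho> * t\<close>. This is a comparison in the manner of Chevet's
  inequality.\<close>

lemma expected_max_tensor_le:
  fixes e :: real and x :: "(nat \<Rightarrow> real) \<Rightarrow> nat \<Rightarrow> real"
  assumes T: "finite T" "T \<noteq> {}" and e: "0 < e" and "0 \<le> \<rho>"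
    and \<rho>: "\<And>t. t \<in> T \<Longrightarrow> L2_set (x t) {..<m} \<le> \<rho> * (L2_set t {..<d} + e)"
  shows "expected_max ({..<m} \<times> {..<d}) T (\<lambda>t (i, k). x t i * t k / (L2_set t {..<d} + e))
       \<le> sqrt 2 * expected_max {..<m} T x + sqrt 8 * \<rho> * expected_max {..<d} T (\<lambda>t. t)"
proof -
  define J :: "(nat + nat) set" where "J = {..<m} <+> {..<d}"
  define b1 where "b1 t j = (case j of Inl i \<Rightarrow> sqrt 2 * x t i | Inr k \<Rightarrow> 0)" for t and j :: "nat + nat"
  define b2 where "b2 t j = (case j of Inl i \<Rightarrow> 0 | Inr k \<Rightarrow> sqrt 8 * \<rho> * t k)" for t :: "nat \<Rightarrow> real" and j :: "nat + nat"
  have J: "finite J" unfolding J_def by auto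
  have "expected_max ({..<m} \<times> {..<d}) T (\<lambda>t (i, k). x t i * t k / (L2_set t {..<d} + e))
      \<le> expected_max J T (\<lambda>t j. b1 t j + b2 t j)"
  proof (rule sudakov_fernique[OF _ J T])
    fix s t assume st: "s \<in> T" "t \<in> T"
    have "(\<Sum>j\<in>J. ((b1 s j + b2 s j) - (b1 t j + b2 t j))\<^sup>2) = (\<Sum>i<m. (sqrt 2 * (x s i - x t i))\<^sup>2) + (\<Sum>k<d. (sqrt 8 * \<rho> * (s k - t k))\<^sup>2)"
      unfolding J_def by (simp add: sum.Plus b1_def b2_def right_diff_distrib)
    also have "\<dots> = 2 * (\<Sum>i<m. (x s i - x t i)\<^sup>2) + 8 * \<rho>\<^sup>2 * (\<Sum>k<d. (s k - t k)\<^sup>2)"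
      by (simp add: power_mult_distrib sum_distrib_left)
    finally show "(\<Sum>i\<in>{..<m} \<times> {..<d}. ((case i of (i, k) \<Rightarrow> x s i * s k / (L2_set s {..<d} + e))
        - (case i of (i, k) \<Rightarrow> x t i * t k / (L2_set t {..<d} + e)))\<^sup>2)
        \<le> (\<Sum>j\<in>J. ((b1 s j + b2 s j) - (b1 t j + b2 t j))\<^sup>2)"
      using tensor_increment[where x = x and s = s, OF e \<rho>[OF st(2)]] by (simp add: case_prod_beta)
  qed simp
  also have "\<dots> \<le> expected_max J T b1 + expected_max J T b2"
    by (rule expected_max_add_le[OF T])
  also have "expected_max J T b1 = expected_max {..<m} T (\<lambda>t i. sqrt 2 * x t i)"
    by (rule expected_max_reindex[where f = Inl, OF _ _ J T]) (auto simp: J_def b1_def)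
  also have "\<dots> = sqrt 2 * expected_max {..<m} T x"
    by (rule expected_max_scale[OF T]) simp
  also have "expected_max J T b2 = expected_max {..<d} T (\<lambda>t k. sqrt 8 * \<rho> * t k)"
    by (rule expected_max_reindex[where f = Inr, OF _ _ J T]) (auto simp: J_def b2_def)
  also have "\<dots> = sqrt 8 * \<rho> * expected_max {..<d} T (\<lambda>t. t)"
    by (rule expected_max_scale[OF T]) (use \<open>0 \<le> \<rho>\<close> in simp)
  finally show ?thesis .
qed

text \<open>The zero form \<open>t0\<close> makes the maxima of the process and of its negative both
  nonnegative, so their sum dominates the maximum of the absolute values. The two have the same
  increments, hence the factor 2.\<close>

lemma integral_Max_abs_le:
  assumes K: "finite K" and T: "finite T" and t0: "t0 \<in> T" "\<And>k. k \<in> K \<Longrightarrow> c t0 k = 0"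
  shows "integrable (gaussian K) (\<lambda>g. Max ((\<lambda>t. \<bar>linform K (c t) g\<bar>) ` T))" (is ?int)
    and "(\<integral>g. Max ((\<lambda>t. \<bar>linform K (c t) g\<bar>) ` T) \<partial>gaussian K) \<le> 2 * expected_max K T c" (is ?le)
proof -
  have T': "T \<noteq> {}" using t0 by auto
  let ?X = "\<lambda>g. Max ((\<lambda>t. linform K (c t) g) ` T)" and ?Y = "\<lambda>g. Max ((\<lambda>t. linform K (\<lambda>k. - c t k) g) ` T)"
  have z: "linform K (c t0) g = 0" for g using t0 by (intro sum.neutral) auto
  have z': "linform K (\<lambda>k. - c t0 k) g = 0" for g using t0 by (intro sum.neutral) auto
  have "linform K (c t0) g \<le> ?X g" for g
    using T t0(1) by (intro Max_ge) auto
  moreover have "linform K (\<lambda>k. - c t0 k) g \<le> ?Y g" for g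
    using T t0(1) by (intro Max_ge) auto
  ultimately have pos: "0 \<le> ?X g" "0 \<le> ?Y g" for g
    unfolding z z' by blast+
  have le: "Max ((\<lambda>t. \<bar>linform K (c t) g\<bar>) ` T) \<le> ?X g + ?Y g" for g
  proof (rule Max.boundedI)
    fix x assume "x \<in> (\<lambda>t. \<bar>linform K (c t) g\<bar>) ` T"
    then obtain t where t: "t \<in> T" "x = \<bar>linform K (c t) g\<bar>" by auto
    have "linform K (c t) g \<le> ?X g" using T t(1) by (intro Max_ge) auto
    moreover have "linform K (\<lambda>k. - c t k) g \<le> ?Y g" using T t(1) by (intro Max_ge) auto
    moreover have "linform K (\<lambda>k. - c t k) g = - linform K (c t) g" by (simp add: sum_negf)
    ultimately show "x \<le> ?X g + ?Y g" using pos[of g] unfolding t(2) by linarith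
  qed (use T T' in simp_all)
  have pos': "0 \<le> Max ((\<lambda>t. \<bar>linform K (c t) g\<bar>) ` T)" for g
    using T t0 by (intro Max_ge_iff[THEN iffD2]) auto
  have int: "integrable (gaussian K) (\<lambda>g. ?X g + ?Y g)"
    by (intro Bochner_Integration.integrable_add integrable_Max_linform T T')
  show i: ?int
    by (rule Bochner_Integration.integrable_bound[OF int]) (use T le pos pos' in \<open>auto intro!: AE_I2 order.trans[OF le]\<close>)
  have "(\<integral>g. Max ((\<lambda>t. \<bar>linform K (c t) g\<bar>) ` T) \<partial>gaussian K) \<le> (\<integral>g. ?X g + ?Y g \<partial>gaussian K)"
    by (intro integral_mono i int le)
  also have "\<dots> = expected_max K T c + expected_max K T (\<lambda>t k. - c t k)"
    unfolding expected_max_def by (intro Bochner_Integration.integral_add integrable_Max_linform T T')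
  also have "expected_max K T (\<lambda>t k. - c t k) \<le> expected_max K T c"
    by (rule sudakov_fernique[OF K K T T']) (simp add: power2_commute add.commute)
  finally show ?le by simp
qed

section \<open>The weighted quadratic deviation of a Gaussian matrix\<close>

definition row_product :: "nat \<Rightarrow> (nat \<times> nat \<Rightarrow> real) \<Rightarrow> (nat \<Rightarrow> real) \<Rightarrow> nat \<Rightarrow> real" where
  "row_product d A t i = (\<Sum>k<d. A (i, k) * t k)"

lemma row_product_linform:
  assumes "i < m"
  shows "row_product d A t i = linform ({..<m} \<times> {..<d}) (\<lambda>(j, k). if j = i then t k else 0) A"
proof -
  have "linform ({..<m} \<times> {..<d}) (\<lambda>(j, k). if j = i then t k else 0) A
      = (\<Sum>j<m. \<Sum>k<d. (if j = i then t k else 0) * A (j, k))"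
    unfolding sum.cartesian_product[of _ "{..<d}"] by (simp add: case_prod_beta)
  also have "\<dots> = (\<Sum>j<m. if j = i then row_product d A t i else 0)"
    by (intro sum.cong refl) (simp add: row_product_def mult.commute)
  also have "\<dots> = row_product d A t i" using assms by simp
  finally show ?thesis ..
qed

lemma measurable_row_product:
  assumes "i < m"
  shows "(\<lambda>A. row_product d A t i) \<in> borel_measurable (gaussian ({..<m} \<times> {..<d}))"
  unfolding row_product_linform[OF assms] by measurable

lemma row_product_square_integral:
  assumes i: "i < m"
  shows "integrable (gaussian ({..<m} \<times> {..<d})) (\<lambda>A. (row_product d A t i)\<^sup>2)"
    and "(\<integral>A. (row_product d A t i)\<^sup>2 \<partial>gaussian ({..<m} \<times> {..<d})) = (\<Sum>k<d. (t k)\<^sup>2)"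
proof -
  show "integrable (gaussian ({..<m} \<times> {..<d})) (\<lambda>A. (row_product d A t i)\<^sup>2)"
    unfolding row_product_linform[OF i] by (intro integrable_linform_square) simp
  have "(\<integral>A. (row_product d A t i)\<^sup>2 \<partial>gaussian ({..<m} \<times> {..<d}))
      = (\<Sum>x\<in>{..<m} \<times> {..<d}. (case x of (j, k) \<Rightarrow> if j = i then t k else 0)\<^sup>2)"
    unfolding row_product_linform[OF i] by (intro integral_linform_square) simp
  also have "\<dots> = (\<Sum>j<m. \<Sum>k<d. (if j = i then t k else 0)\<^sup>2)"
    unfolding sum.cartesian_product[of _ "{..<d}"] by (intro sum.cong refl) auto
  also have "\<dots> = (\<Sum>j<m. if j = i then (\<Sum>k<d. (t k)\<^sup>2) else 0)"
    by (intro sum.cong refl) auto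
  also have "\<dots> = (\<Sum>k<d. (t k)\<^sup>2)" using i by simp
  finally show "(\<integral>A. (row_product d A t i)\<^sup>2 \<partial>gaussian ({..<m} \<times> {..<d})) = (\<Sum>k<d. (t k)\<^sup>2)" .
qed

lemma row_product_rotate:
  assumes "i < m"
  shows "row_product d (\<lambda>x\<in>{..<m} \<times> {..<d}. r * (A x + B x)) t i = r * (row_product d A t i + row_product d B t i)"
    and "row_product d (\<lambda>x\<in>{..<m} \<times> {..<d}. r * (A x - B x)) t i = r * (row_product d A t i - row_product d B t i)"
  using assms unfolding row_product_def
  by (simp_all add: sum_distrib_left distrib_left distrib_right left_diff_distrib right_diff_distrib
      sum.distrib sum_subtractf mult.assoc)

text \<open>Because of the weight, a bound on this quantity is a relative bound for unit vectors and
  still gives an additive one for short vectors; the summand \<open>e\<close> also keeps the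
  denominator positive at 0.\<close>

definition quad_dev :: "nat \<Rightarrow> nat \<Rightarrow> real \<Rightarrow> (nat \<Rightarrow> real) set \<Rightarrow> (nat \<times> nat \<Rightarrow> real) \<Rightarrow> real" where
  "quad_dev m d e T A = Max ((\<lambda>t. \<bar>(\<Sum>i<m. (row_product d A t i)\<^sup>2) - m * (\<Sum>k<d. (t k)\<^sup>2)\<bar>
      / (L2_set t {..<d} + e)) ` T)"

lemma quad_dev_ge:
  "finite T \<Longrightarrow> t \<in> T \<Longrightarrow>
    \<bar>(\<Sum>i<m. (row_product d A t i)\<^sup>2) - m * (\<Sum>k<d. (t k)\<^sup>2)\<bar> / (L2_set t {..<d} + e) \<le> quad_dev m d e T A"
  unfolding quad_dev_def by (intro Max_ge) auto

lemma quad_dev_nonneg: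
  fixes e :: real
  assumes "finite T" "t \<in> T" "0 < e"
  shows "0 \<le> quad_dev m d e T A"
  by (rule order.trans[OF _ quad_dev_ge[OF assms(1,2)]]) (use assms in \<open>auto intro!: divide_nonneg_nonneg\<close>)

lemma measurable_quad_dev:
  assumes "finite T"
  shows "quad_dev m d e T \<in> borel_measurable (gaussian ({..<m} \<times> {..<d}))"
proof -
  note [measurable] = measurable_row_product
  show ?thesis unfolding quad_dev_def using assms by measurable
qed

lemma integrable_quad_dev:
  fixes e :: real
  assumes T: "finite T" "t0 \<in> T" and e: "0 < e"
  shows "integrable (gaussian ({..<m} \<times> {..<d})) (quad_dev m d e T)"
proof (rule Bochner_Integration.integrable_bound)
  let ?f = "\<lambda>A. \<Sum>t\<in>T. ((\<Sum>i<m. (row_product d A t i)\<^sup>2) + m * (\<Sum>k<d. (t k)\<^sup>2)) / (L2_set t {..<d} + e)"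
  show "integrable (gaussian ({..<m} \<times> {..<d})) ?f"
    by (intro Bochner_Integration.integrable_sum integrable_divide Bochner_Integration.integrable_add row_product_square_integral) auto
  show "AE A in gaussian ({..<m} \<times> {..<d}). norm (quad_dev m d e T A) \<le> norm (?f A)"
  proof (intro AE_I2)
    fix A
    have pos: "0 \<le> L2_set t {..<d} + e" for t using e by (simp add: add_nonneg_nonneg)
    have "quad_dev m d e T A \<in> (\<lambda>t. \<bar>(\<Sum>i<m. (row_product d A t i)\<^sup>2) - m * (\<Sum>k<d. (t k)\<^sup>2)\<bar> / (L2_set t {..<d} + e)) ` T"
      unfolding quad_dev_def using T by (intro Max_in) auto
    then obtain t :: "nat \<Rightarrow> real" where t: "t \<in> T" "quad_dev m d e T A = \<bar>(\<Sum>i<m. (row_product d A t i)\<^sup>2) - m * (\<Sum>k<d. (t k)\<^sup>2)\<bar> / (L2_set t {..<d} + e)"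
      by auto
    have "\<bar>(\<Sum>i<m. (row_product d A t i)\<^sup>2) - m * (\<Sum>k<d. (t k)\<^sup>2)\<bar> \<le> (\<Sum>i<m. (row_product d A t i)\<^sup>2) + m * (\<Sum>k<d. (t k)\<^sup>2)"
      by (intro abs_leI) (auto simp: sum_nonneg add_nonneg_nonneg intro!: order.trans[OF _ add_nonneg_nonneg])
    then have "quad_dev m d e T A \<le> ((\<Sum>i<m. (row_product d A t i)\<^sup>2) + m * (\<Sum>k<d. (t k)\<^sup>2)) / (L2_set t {..<d} + e)"
      unfolding t(2) using pos by (intro divide_right_mono) auto
    also have "\<dots> \<le> ?f A"
    proof -
      define g where "g t = ((\<Sum>i<m. (row_product d A t i)\<^sup>2) + m * (\<Sum>k<d. (t k)\<^sup>2)) / (L2_set t {..<d} + e)" for t :: "nat \<Rightarrow> real"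
      have "g t \<le> (\<Sum>t\<in>T. g t)"
        using T t(1) pos less_imp_le[OF e] unfolding g_def
        by (intro member_le_sum divide_nonneg_nonneg add_nonneg_nonneg mult_nonneg_nonneg sum_nonneg) auto
      then show ?thesis by (simp only: g_def)
    qed
    finally show "norm (quad_dev m d e T A) \<le> norm (?f A)"
      using quad_dev_nonneg[OF T e, of m d A] by simp
  qed
qed (rule measurable_quad_dev[OF T(1)])

text \<open>The row products of \<open>(A + B) / sqrt 2\<close> and \<open>(A - B) / sqrt 2\<close> have a difference of squares that is
  bilinear in \<open>A\<close> and \<open>B\<close>; by rotation invariance this decouples the quadratic deviation.\<close>

lemma quad_dev_decouple:
  fixes m d :: nat and T :: "(nat \<Rightarrow> real) set" and e :: real
  assumes T: "finite T" "t0 \<in> T" and e: "0 < e"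
  defines "K \<equiv> {..<m} \<times> {..<d}"
  shows "(\<integral>\<^sup>+A. ennreal (quad_dev m d e T A) \<partial>gaussian K)
    \<le> (\<integral>\<^sup>+A. \<integral>\<^sup>+B. ennreal (Max ((\<lambda>t. \<bar>2 * (\<Sum>i<m. row_product d A t i * row_product d B t i)\<bar>
        / (L2_set t {..<d} + e)) ` T)) \<partial>gaussian K \<partial>gaussian K)"
proof -
  define Q where "Q t A = (\<Sum>i<m. (row_product d A t i)\<^sup>2)" for t :: "nat \<Rightarrow> real" and A
  define n where "n t = L2_set t {..<d} + e" for t :: "nat \<Rightarrow> real"
  define F where "F A B = ennreal (Max ((\<lambda>t. \<bar>Q t A - Q t B\<bar> / n t) ` T))" for A B
  note [measurable] = measurable_row_product[of _ m d, folded K_def]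
  have n: "0 < n t" for t :: "nat \<Rightarrow> real" using e by (auto simp: n_def intro: add_nonneg_pos)
  have Q_meas [measurable]: "Q t \<in> borel_measurable (gaussian K)" for t :: "nat \<Rightarrow> real" unfolding Q_def by measurable
  have Q_int: "integrable (gaussian K) (Q t)" for t :: "nat \<Rightarrow> real"
    unfolding Q_def K_def by (intro Bochner_Integration.integrable_sum row_product_square_integral) auto
  have Q_val: "(\<integral>A. Q t A \<partial>gaussian K) = m * (\<Sum>k<d. (t k)\<^sup>2)" for t :: "nat \<Rightarrow> real"
    unfolding Q_def K_def by (subst Bochner_Integration.integral_sum) (auto simp: row_product_square_integral)
  have F: "case_prod F \<in> borel_measurable (gaussian K \<Otimes>\<^sub>M gaussian K)"
    unfolding F_def[abs_def] case_prod_beta' using T by measurable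
  have "(\<integral>\<^sup>+A. ennreal (quad_dev m d e T A) \<partial>gaussian K) \<le> (\<integral>\<^sup>+A. \<integral>\<^sup>+B. F A B \<partial>gaussian K \<partial>gaussian K)"
  proof (intro nn_integral_mono)
    fix A
    have int: "integrable (gaussian K) (\<lambda>B. \<bar>Q t A - Q t B\<bar> / n t)" for t :: "nat \<Rightarrow> real"
      using Q_int by (intro integrable_divide integrable_abs Bochner_Integration.integrable_diff) auto
    have int2: "integrable (gaussian K) (\<lambda>B. Max ((\<lambda>t. \<bar>Q t A - Q t B\<bar> / n t) ` T))"
    proof (rule Bochner_Integration.integrable_bound)
      show "integrable (gaussian K) (\<lambda>B. \<Sum>t\<in>T. \<bar>Q t A - Q t B\<bar> / n t)"
        by (intro Bochner_Integration.integrable_sum int)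
      show "AE B in gaussian K. norm (Max ((\<lambda>t. \<bar>Q t A - Q t B\<bar> / n t) ` T)) \<le> norm (\<Sum>t\<in>T. \<bar>Q t A - Q t B\<bar> / n t)"
      proof (intro AE_I2)
        fix B
        have "Max ((\<lambda>t. \<bar>Q t A - Q t B\<bar> / n t) ` T) \<in> (\<lambda>t. \<bar>Q t A - Q t B\<bar> / n t) ` T"
          using T by (intro Max_in) auto
        then obtain t :: "nat \<Rightarrow> real" where t: "t \<in> T" "Max ((\<lambda>t. \<bar>Q t A - Q t B\<bar> / n t) ` T) = \<bar>Q t A - Q t B\<bar> / n t"
          by (auto simp: image_iff)
        have "\<bar>Q t A - Q t B\<bar> / n t \<le> (\<Sum>t\<in>T. \<bar>Q t A - Q t B\<bar> / n t)"
          using T t(1) less_imp_le[OF n] by (intro member_le_sum[where f = "\<lambda>t. \<bar>Q t A - Q t B\<bar> / n t"]) auto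
        then show "norm (Max ((\<lambda>t. \<bar>Q t A - Q t B\<bar> / n t) ` T)) \<le> norm (\<Sum>t\<in>T. \<bar>Q t A - Q t B\<bar> / n t)"
          using less_imp_le[OF n[of t]] unfolding t(2) by simp
      qed
    qed (use T in measurable)
    have nonneg: "0 \<le> Max ((\<lambda>t. \<bar>Q t A - Q t B\<bar> / n t) ` T)" for B
      using T less_imp_le[OF n] by (intro Max_ge_iff[THEN iffD2]) auto
    \<comment> \<open>The mean \<open>m |t|^2\<close> is the integral of an independent copy
      \<open>Q t B\<close>. The absolute value and then the maximum are moved inside that integral
      at the price of an inequality.\<close>
    have "quad_dev m d e T A \<le> (\<integral>B. Max ((\<lambda>t. \<bar>Q t A - Q t B\<bar> / n t) ` T) \<partial>gaussian K)"
      unfolding quad_dev_def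
    proof (subst Max_le_iff; (use T in auto)?)
      fix t assume t: "t \<in> T"
      have "\<bar>Q t A - m * (\<Sum>k<d. (t k)\<^sup>2)\<bar> = \<bar>\<integral>B. Q t A - Q t B \<partial>gaussian K\<bar>"
        using Q_int by (simp add: Bochner_Integration.integral_diff gaussian.prob_space flip: Q_val)
      also have "\<dots> \<le> (\<integral>B. \<bar>Q t A - Q t B\<bar> \<partial>gaussian K)"
        by (rule integral_abs_bound)
      finally have "\<bar>Q t A - m * (\<Sum>k<d. (t k)\<^sup>2)\<bar> / n t \<le> (\<integral>B. \<bar>Q t A - Q t B\<bar> / n t \<partial>gaussian K)"
        using less_imp_le[OF n[of t]] by (simp add: divide_right_mono)
      also have "\<dots> \<le> (\<integral>B. Max ((\<lambda>t. \<bar>Q t A - Q t B\<bar> / n t) ` T) \<partial>gaussian K)"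
        using T t by (intro integral_mono int int2 Max_ge) auto
      finally show "\<bar>(\<Sum>i<m. (row_product d A t i)\<^sup>2) - m * (\<Sum>k<d. (t k)\<^sup>2)\<bar> / (L2_set t {..<d} + e)
          \<le> (\<integral>B. Max ((\<lambda>t. \<bar>Q t A - Q t B\<bar> / n t) ` T) \<partial>gaussian K)"
        by (simp add: Q_def n_def)
    qed
    then have "ennreal (quad_dev m d e T A) \<le> ennreal (\<integral>B. Max ((\<lambda>t. \<bar>Q t A - Q t B\<bar> / n t) ` T) \<partial>gaussian K)"
      by (rule ennreal_leI)
    also have "\<dots> = (\<integral>\<^sup>+B. F A B \<partial>gaussian K)"
      unfolding F_def using nonneg by (intro nn_integral_eq_integral[symmetric] int2) auto
    finally show "ennreal (quad_dev m d e T A) \<le> (\<integral>\<^sup>+B. F A B \<partial>gaussian K)" .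
  qed
  also have "\<dots> = (\<integral>\<^sup>+A. \<integral>\<^sup>+B. F (\<lambda>i\<in>K. (1 / sqrt 2) * (A i + B i)) (\<lambda>i\<in>K. (1 / sqrt 2) * (A i - B i)) \<partial>gaussian K \<partial>gaussian K)"
    by (rule gaussian_rotate[OF refl _ F, symmetric]) (simp add: K_def)
  also have "\<dots> = (\<integral>\<^sup>+A. \<integral>\<^sup>+B. ennreal (Max ((\<lambda>t. \<bar>2 * (\<Sum>i<m. row_product d A t i * row_product d B t i)\<bar>
        / (L2_set t {..<d} + e)) ` T)) \<partial>gaussian K \<partial>gaussian K)"
  proof -
    have "Q t (\<lambda>i\<in>K. (1 / sqrt 2) * (A i + B i)) - Q t (\<lambda>i\<in>K. (1 / sqrt 2) * (A i - B i))
        = 2 * (\<Sum>i<m. row_product d A t i * row_product d B t i)" for A B t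
    proof -
      have "(1 / sqrt 2 * (p + q))\<^sup>2 - (1 / sqrt 2 * (p - q))\<^sup>2 = 2 * (p * q)" for p q :: real
        by (simp add: power_mult_distrib power_divide power2_eq_square field_simps)
      then show ?thesis
        unfolding Q_def K_def sum_subtractf[symmetric] sum_distrib_left
        by (intro sum.cong refl) (simp only: row_product_rotate lessThan_iff)
    qed
    then show ?thesis unfolding F_def n_def by simp
  qed
  finally show ?thesis .
qed

text \<open>With \<open>q\<close> the deviation and \<open>N = |t| + e\<close>, one has
  \<open>|A t|^2 \<le> m N^2 + q N \<le> (m + q / e) N^2\<close>, and completing the square bounds
  the coefficient by \<open>(sqrt m + q / (2 e sqrt m))^2\<close>. The result is linear in
  \<open>q\<close>, so its expectation involves only the expected deviation.\<close>

lemma row_product_norm_le: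
  fixes e :: real
  assumes T: "finite T" "t \<in> T" and e: "0 < e" and m: "0 < m"
  shows "L2_set (row_product d A t) {..<m} \<le> (sqrt m + quad_dev m d e T A / (2 * e * sqrt m)) * (L2_set t {..<d} + e)"
proof -
  let ?n = "L2_set t {..<d}" and ?q = "quad_dev m d e T A" and ?x = "L2_set (row_product d A t) {..<m}"
  have n: "0 \<le> ?n" by simp
  have pos: "0 < ?n + e" using n e by linarith
  have q: "0 \<le> ?q" using quad_dev_nonneg[OF T e] .
  have "\<bar>?x\<^sup>2 - m * ?n\<^sup>2\<bar> / (?n + e) \<le> ?q"
    using quad_dev_ge[OF T] by (simp add: L2_set_power2)
  then have "\<bar>?x\<^sup>2 - m * ?n\<^sup>2\<bar> \<le> ?q * (?n + e)" using pos by (simp add: field_simps)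
  then have "?x\<^sup>2 \<le> m * ?n\<^sup>2 + ?q * (?n + e)" by linarith
  also have "\<dots> \<le> m * (?n + e)\<^sup>2 + (?q / e) * (?n + e)\<^sup>2"
  proof (intro add_mono mult_left_mono power_mono)
    have "e * (?n + e) \<le> (?n + e)\<^sup>2" using n e by (simp add: power2_eq_square algebra_simps)
    then have "(?q / e) * (e * (?n + e)) \<le> (?q / e) * (?n + e)\<^sup>2" using q e by (intro mult_left_mono) auto
    then show "?q * (?n + e) \<le> (?q / e) * (?n + e)\<^sup>2" using e by simp
  qed (use n e in auto)
  also have "\<dots> \<le> (sqrt m + ?q / (2 * e * sqrt m))\<^sup>2 * (?n + e)\<^sup>2"
  proof -
    have "2 * sqrt m * (?q / (2 * e * sqrt m)) = ?q / e" using m by simp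
    then have "m + ?q / e \<le> (sqrt m + ?q / (2 * e * sqrt m))\<^sup>2" by (simp add: power2_sum)
    then show ?thesis using mult_right_mono[of _ _ "(?n + e)\<^sup>2"] by (fastforce simp: distrib_right)
  qed
  finally have "?x\<^sup>2 \<le> ((sqrt m + ?q / (2 * e * sqrt m)) * (?n + e))\<^sup>2" by (simp add: power_mult_distrib)
  then show ?thesis
  proof (rule power2_le_imp_le)
    have "0 \<le> ?q / (2 * e * sqrt m)" using q e by simp
    then show "0 \<le> (sqrt m + ?q / (2 * e * sqrt m)) * (?n + e)" using pos by simp
  qed
qed

text \<open>Instead of Jensen, the arithmetic-geometric bound
  \<open>|h| \<le> |h|^2 / (2 sqrt m) + sqrt m / 2\<close> is integrated; the weight
  \<open>sqrt m\<close> makes it sharp enough.\<close>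

lemma integral_L2_set_le:
  fixes m :: nat
  assumes m: "0 < m"
  shows "(\<integral>\<^sup>+h. ennreal (L2_set h {..<m}) \<partial>gaussian {..<m}) \<le> ennreal (sqrt m)"
proof -
  have sq: "integrable (gaussian {..<m}) (\<lambda>h. (h i)\<^sup>2)" "(\<integral>h. (h i)\<^sup>2 \<partial>gaussian {..<m}) = 1" if "i < m" for i
    using integrable_gaussian_mult[OF finite_lessThan[of m], of i i] integral_gaussian_mult[OF finite_lessThan[of m], of i i] that
    by (auto simp: power2_eq_square)
  have int: "integrable (gaussian {..<m}) (\<lambda>h. (\<Sum>i<m. (h i)\<^sup>2) / (2 * sqrt m) + sqrt m / 2)"
    by (intro Bochner_Integration.integrable_add integrable_divide Bochner_Integration.integrable_sum sq) auto
  have "(\<integral>\<^sup>+h. ennreal (L2_set h {..<m}) \<partial>gaussian {..<m})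
      \<le> (\<integral>\<^sup>+h. ennreal ((\<Sum>i<m. (h i)\<^sup>2) / (2 * sqrt m) + sqrt m / 2) \<partial>gaussian {..<m})"
  proof (intro nn_integral_mono ennreal_leI)
    fix h :: "nat \<Rightarrow> real"
    have "2 * L2_set h {..<m} * sqrt m \<le> (L2_set h {..<m})\<^sup>2 + (sqrt m)\<^sup>2" by (rule sum_squares_bound)
    then have "2 * L2_set h {..<m} * sqrt m \<le> (\<Sum>i<m. (h i)\<^sup>2) + sqrt m * sqrt m" by (simp add: L2_set_power2)
    then show "L2_set h {..<m} \<le> (\<Sum>i<m. (h i)\<^sup>2) / (2 * sqrt m) + sqrt m / 2" using m by (simp add: field_simps)
  qed
  also have "\<dots> = ennreal (\<integral>h. (\<Sum>i<m. (h i)\<^sup>2) / (2 * sqrt m) + sqrt m / 2 \<partial>gaussian {..<m})"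
    by (intro nn_integral_eq_integral int) (auto intro!: AE_I2 add_nonneg_nonneg divide_nonneg_nonneg sum_nonneg)
  also have "(\<integral>h. (\<Sum>i<m. (h i)\<^sup>2) / (2 * sqrt m) + sqrt m / 2 \<partial>gaussian {..<m}) = m / (2 * sqrt m) + sqrt m / 2"
    using sq by (subst Bochner_Integration.integral_add)
      (auto intro!: integrable_divide Bochner_Integration.integrable_sum simp: Bochner_Integration.integral_sum gaussian.prob_space)
  also have "\<dots> = sqrt m" using m by (simp add: real_div_sqrt field_simps)
  finally show ?thesis .
qed

text \<open>After exchanging the integrals, for fixed \<open>h\<close> the form
  \<open>\<langle>A t, h\<rangle>\<close> in the matrix \<open>A\<close> has the increments of
  \<open>|h|\<close> times a linear process on \<open>T\<close>. So the inner integral is at most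
  \<open>|h|\<close> times the width, and \<open>|h|\<close> has mean at most
  \<open>sqrt m\<close>.\<close>

lemma expected_max_row_product_le:
  fixes m d :: nat and T :: "(nat \<Rightarrow> real) set" and e :: real
  assumes T: "finite T" "(\<lambda>_. 0) \<in> T" and m: "0 < m"
  defines "K \<equiv> {..<m} \<times> {..<d}"
  shows "(\<integral>\<^sup>+A. ennreal (expected_max {..<m} T (row_product d A)) \<partial>gaussian K)
       \<le> ennreal (sqrt m * expected_max {..<d} T (\<lambda>t. t))"
proof -
  let ?W = "expected_max {..<d} T (\<lambda>t. t)"
  note [measurable] = measurable_row_product[of _ m d, folded K_def]
  have T': "T \<noteq> {}" using T by auto
  have W: "0 \<le> ?W" by (rule expected_max_nonneg[OF T(1) T'])
  define M where "M A h = Max ((\<lambda>t. \<Sum>i<m. row_product d A t i * h i) ` T)" for A h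
  have z: "row_product d A (\<lambda>_. 0) i = 0" for A i by (simp add: row_product_def)
  have M_nonneg: "0 \<le> M A h" for A h
  proof -
    have "(\<Sum>i<m. row_product d A (\<lambda>_. 0) i * h i) \<le> M A h" unfolding M_def using T by (intro Max_ge) auto
    then show ?thesis by (simp add: z)
  qed
  have M_meas: "case_prod M \<in> borel_measurable (gaussian K \<Otimes>\<^sub>M gaussian {..<m})"
    unfolding M_def[abs_def] case_prod_beta' using T by measurable
  have "(\<integral>\<^sup>+A. ennreal (expected_max {..<m} T (row_product d A)) \<partial>gaussian K)
      = (\<integral>\<^sup>+A. \<integral>\<^sup>+h. ennreal (M A h) \<partial>gaussian {..<m} \<partial>gaussian K)"
    unfolding expected_max_def M_def using M_nonneg[unfolded M_def]
    by (intro nn_integral_cong nn_integral_eq_integral[symmetric] integrable_Max_linform T T') auto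
  also have "\<dots> = (\<integral>\<^sup>+h. \<integral>\<^sup>+A. ennreal (M A h) \<partial>gaussian K \<partial>gaussian {..<m})"
    by (rule gaussian_pair.Fubini'[symmetric]) (use M_meas in \<open>simp add: case_prod_beta'\<close>)
  also have "\<dots> \<le> (\<integral>\<^sup>+h. ennreal (L2_set h {..<m}) * ennreal ?W \<partial>gaussian {..<m})"
  proof (intro nn_integral_mono)
    fix h :: "nat \<Rightarrow> real"
    have lin: "(\<Sum>i<m. row_product d A t i * h i) = linform K (\<lambda>(i, k). h i * t k) A" for A t
      unfolding K_def row_product_def sum_distrib_right sum.cartesian_product
      by (intro sum.cong refl) (auto simp: ac_simps)
    have "(\<integral>\<^sup>+A. ennreal (M A h) \<partial>gaussian K) = ennreal (expected_max K T (\<lambda>t (i, k). h i * t k))"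
      unfolding expected_max_def M_def using M_nonneg[of _ h, unfolded M_def] unfolding lin
      by (intro nn_integral_eq_integral integrable_Max_linform T T') auto
    also have "expected_max K T (\<lambda>t (i, k). h i * t k) \<le> expected_max {..<d} T (\<lambda>t k. L2_set h {..<m} * t k)"
    proof (rule sudakov_fernique[OF _ _ T(1) T'])
      fix s t :: "nat \<Rightarrow> real"
      have "(\<Sum>i\<in>K. ((case i of (i, k) \<Rightarrow> h i * s k) - (case i of (i, k) \<Rightarrow> h i * t k))\<^sup>2)
        = (\<Sum>i<m. \<Sum>k<d. (h i)\<^sup>2 * (s k - t k)\<^sup>2)"
        unfolding K_def sum.cartesian_product
        by (intro sum.cong refl) (auto simp: power_mult_distrib right_diff_distrib[symmetric])
      also have "\<dots> = (\<Sum>k<d. (L2_set h {..<m} * s k - L2_set h {..<m} * t k)\<^sup>2)"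
        unfolding right_diff_distrib[symmetric] power_mult_distrib L2_set_power2
        by (simp add: sum_product sum_distrib_left[symmetric])
      finally show "(\<Sum>i\<in>K. ((case i of (i, k) \<Rightarrow> h i * s k) - (case i of (i, k) \<Rightarrow> h i * t k))\<^sup>2)
        \<le> (\<Sum>k<d. (L2_set h {..<m} * s k - L2_set h {..<m} * t k)\<^sup>2)" by simp
    qed (auto simp: K_def)
    also have "\<dots> = L2_set h {..<m} * ?W"
      by (rule expected_max_scale[OF T(1) T']) simp
    finally show "(\<integral>\<^sup>+A. ennreal (M A h) \<partial>gaussian K) \<le> ennreal (L2_set h {..<m}) * ennreal ?W"
      by (simp add: ennreal_mult[symmetric] W ennreal_leI)
  qed
  also have "\<dots> = (\<integral>\<^sup>+h. ennreal (L2_set h {..<m}) \<partial>gaussian {..<m}) * ennreal ?W"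
    unfolding L2_set_def by (intro nn_integral_multc) measurable
  also have "\<dots> \<le> ennreal (sqrt m) * ennreal ?W"
    by (rule mult_right_mono[OF integral_L2_set_le[OF m]]) simp
  also have "\<dots> = ennreal (sqrt m * ?W)" using W by (simp add: ennreal_mult)
  finally show ?thesis .
qed

text \<open>After decoupling, the integral over \<open>B\<close> with \<open>A\<close> fixed is a
  maximum of a tensor process. Its bound contains the norms \<open>|A t|\<close>, which are in turn
  bounded by the deviation; thus \<open>D\<close> reappears on the right.\<close>

lemma quad_dev_expectation_self_bound:
  fixes m d :: nat and T :: "(nat \<Rightarrow> real) set" and e :: real
  assumes T: "finite T" "(\<lambda>_. 0) \<in> T" and e: "0 < e" and m: "0 < m"
  defines "K \<equiv> {..<m} \<times> {..<d}" and "W \<equiv> expected_max {..<d} T (\<lambda>t. t)"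
  defines "D \<equiv> (\<integral>A. quad_dev m d e T A \<partial>gaussian K)"
  shows "D \<le> 4 * sqrt 2 * (sqrt m * W) + 4 * sqrt 8 * W * (sqrt m + D / (2 * e * sqrt m))"
proof -
  have T': "T \<noteq> {}" using T by auto
  have W: "0 \<le> W" unfolding W_def by (rule expected_max_nonneg[OF T(1) T'])
  define H where "H A = expected_max {..<m} T (row_product d A)" for A
  define R where "R A = sqrt m + quad_dev m d e T A / (2 * e * sqrt m)" for A
  have qd: "0 \<le> quad_dev m d e T A" for A by (rule quad_dev_nonneg[OF T e])
  have R: "0 \<le> R A" for A unfolding R_def using qd[of A] e by (intro add_nonneg_nonneg divide_nonneg_nonneg) auto
  have H: "0 \<le> H A" for A unfolding H_def by (rule expected_max_nonneg[OF T(1) T'])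
  have int_qd: "integrable (gaussian K) (quad_dev m d e T)" unfolding K_def by (rule integrable_quad_dev[OF T e])
  have D: "(\<integral>\<^sup>+A. ennreal (quad_dev m d e T A) \<partial>gaussian K) = ennreal D"
    unfolding D_def using qd by (intro nn_integral_eq_integral int_qd) auto
  have D0: "0 \<le> D" unfolding D_def using qd by (intro integral_nonneg_AE) auto
  \<comment> \<open>Both constants carry a factor 4: one factor 2 stands in front of the bilinear
    form, the other comes from passing to absolute values.\<close>
  have cond: "(\<integral>\<^sup>+B. ennreal (Max ((\<lambda>t. \<bar>2 * (\<Sum>i<m. row_product d A t i * row_product d B t i)\<bar>
        / (L2_set t {..<d} + e)) ` T)) \<partial>gaussian K)
      \<le> ennreal (4 * sqrt 2) * ennreal (H A) + ennreal (4 * sqrt 8 * W) * ennreal (R A)" for A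
  proof -
    define c where "c t = (\<lambda>(i, k). row_product d A t i * t k / (L2_set t {..<d} + e))" for t :: "nat \<Rightarrow> real"
    have lin: "\<bar>2 * (\<Sum>i<m. row_product d A t i * row_product d B t i)\<bar> / (L2_set t {..<d} + e) = 2 * \<bar>linform K (c t) B\<bar>" for B t
    proof -
      have "0 < L2_set t {..<d} + e" using e by (intro add_nonneg_pos) auto
      moreover have "linform K (c t) B = (\<Sum>i<m. row_product d A t i * row_product d B t i) / (L2_set t {..<d} + e)"
        unfolding K_def c_def row_product_def[of d B] sum_distrib_left sum_divide_distrib sum.cartesian_product
        by (intro sum.cong refl) (auto simp: ac_simps)
      ultimately show ?thesis by (simp add: abs_mult)
    qed
    have Mx: "Max ((\<lambda>t. 2 * \<bar>linform K (c t) B\<bar>) ` T) = 2 * Max ((\<lambda>t. \<bar>linform K (c t) B\<bar>) ` T)" for B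
      using mono_Max_commute[of "(*) (2::real)" "(\<lambda>t. \<bar>linform K (c t) B\<bar>) ` T"] T T'
      by (simp add: mono_def image_image)
    have K: "finite K" by (simp add: K_def)
    have c0: "c (\<lambda>_. 0) k = 0" for k by (simp add: c_def split: prod.splits)
    note abs = integral_Max_abs_le[OF K T(1) T(2), of c, OF c0]
    have "0 \<le> Max ((\<lambda>t. \<bar>linform K (c t) B\<bar>) ` T)" for B
      using T by (intro Max_ge_iff[THEN iffD2]) auto
    then have "(\<integral>\<^sup>+B. ennreal (2 * Max ((\<lambda>t. \<bar>linform K (c t) B\<bar>) ` T)) \<partial>gaussian K)
      = ennreal (\<integral>B. 2 * Max ((\<lambda>t. \<bar>linform K (c t) B\<bar>) ` T) \<partial>gaussian K)"
      by (intro nn_integral_eq_integral integrable_mult_right abs) auto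
    also have "(\<integral>B. 2 * Max ((\<lambda>t. \<bar>linform K (c t) B\<bar>) ` T) \<partial>gaussian K) \<le> 4 * expected_max K T c"
      using abs(2) by simp
    also have "expected_max K T c \<le> sqrt 2 * H A + sqrt 8 * R A * W"
      unfolding c_def K_def H_def W_def
      by (rule expected_max_tensor_le[OF T(1) T' e R]) (use row_product_norm_le[OF T(1) _ e m] in \<open>simp add: R_def\<close>)
    finally have "(\<integral>\<^sup>+B. ennreal (2 * Max ((\<lambda>t. \<bar>linform K (c t) B\<bar>) ` T)) \<partial>gaussian K)
       \<le> ennreal (4 * (sqrt 2 * H A + sqrt 8 * R A * W))"
      by (simp add: ennreal_leI)
    also have "4 * (sqrt 2 * H A + sqrt 8 * R A * W) = (4 * sqrt 2) * H A + (4 * sqrt 8 * W) * R A"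
      by (simp add: algebra_simps)
    also have "ennreal \<dots> = ennreal (4 * sqrt 2) * ennreal (H A) + ennreal (4 * sqrt 8 * W) * ennreal (R A)"
      using H R W by (simp add: ennreal_plus ennreal_mult)
    finally show ?thesis unfolding lin Mx .
  qed
  have H_meas: "(\<lambda>A. ennreal (H A)) \<in> borel_measurable (gaussian K)"
  proof -
    note [measurable] = measurable_row_product[of _ m d, folded K_def]
    have "(\<lambda>x. Max ((\<lambda>t. \<Sum>i<m. row_product d (fst x) t i * snd x i) ` T)) \<in> borel_measurable (gaussian K \<Otimes>\<^sub>M gaussian {..<m})"
      using T by measurable
    then have "H \<in> borel_measurable (gaussian K)"
      unfolding H_def expected_max_def
      by (intro gaussian.borel_measurable_lebesgue_integral) (simp add: case_prod_beta')
    then show ?thesis by measurable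
  qed
  have R_meas: "(\<lambda>A. ennreal (R A)) \<in> borel_measurable (gaussian K)"
    using measurable_quad_dev[OF T(1), of m d e, folded K_def] unfolding R_def by measurable
  have int_R: "(\<integral>\<^sup>+A. ennreal (R A) \<partial>gaussian K) = ennreal (sqrt m + D / (2 * e * sqrt m))"
  proof -
    have "(\<integral>\<^sup>+A. ennreal (R A) \<partial>gaussian K) = ennreal (\<integral>A. R A \<partial>gaussian K)"
      using R unfolding R_def by (intro nn_integral_eq_integral Bochner_Integration.integrable_add integrable_divide int_qd) auto
    also have "(\<integral>A. R A \<partial>gaussian K) = sqrt m + D / (2 * e * sqrt m)"
      unfolding R_def D_def using int_qd
      by (subst Bochner_Integration.integral_add) (auto simp: gaussian.prob_space)
    finally show ?thesis .
  qed
  have "ennreal D \<le> (\<integral>\<^sup>+A. (ennreal (4 * sqrt 2) * ennreal (H A) + ennreal (4 * sqrt 8 * W) * ennreal (R A)) \<partial>gaussian K)"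
    unfolding D[symmetric]
    using quad_dev_decouple[OF T e, of m d, folded K_def] cond by (rule order.trans[OF _ nn_integral_mono])
  also have "\<dots> = ennreal (4 * sqrt 2) * (\<integral>\<^sup>+A. ennreal (H A) \<partial>gaussian K) + ennreal (4 * sqrt 8 * W) * ennreal (sqrt m + D / (2 * e * sqrt m))"
    using H_meas R_meas by (simp add: nn_integral_add nn_integral_cmult int_R)
  also have "\<dots> \<le> ennreal (4 * sqrt 2) * ennreal (sqrt m * W) + ennreal (4 * sqrt 8 * W) * ennreal (sqrt m + D / (2 * e * sqrt m))"
    unfolding H_def K_def W_def
    by (intro add_right_mono mult_left_mono expected_max_row_product_le T m) simp
  also have "\<dots> = ennreal (4 * sqrt 2 * (sqrt m * W) + 4 * sqrt 8 * W * (sqrt m + D / (2 * e * sqrt m)))"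
    using W D0 e by (simp add: ennreal_plus ennreal_mult add_nonneg_nonneg)
  finally show ?thesis
    using W D0 e by (subst (asm) ennreal_le_iff) (auto intro!: add_nonneg_nonneg mult_nonneg_nonneg divide_nonneg_nonneg)
qed

text \<open>Integrability makes \<open>D\<close> a finite number, so it can be absorbed. With
  \<open>sqrt 2 \<le> 3 / 2\<close> and the constant 300, the coefficient of \<open>D\<close> on the
  right is \<open>6 / 300 = 1 / 50\<close> and the remaining term is
  \<open>18 / 300 * m * e\<close>; this leaves \<open>D \<le> 3 / 49 * m * e\<close>, which is below
  \<open>m * e / 8\<close>.\<close>

lemma quad_dev_expectation_le:
  fixes m d :: nat and T :: "(nat \<Rightarrow> real) set" and e :: real
  assumes T: "finite T" "(\<lambda>_. 0) \<in> T" and e: "0 < e" and m: "0 < m"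
    and W: "300 * expected_max {..<d} T (\<lambda>t. t) \<le> e * sqrt m"
  shows "(\<integral>A. quad_dev m d e T A \<partial>gaussian ({..<m} \<times> {..<d})) \<le> m * e / 8"
proof -
  define W' where "W' = expected_max {..<d} T (\<lambda>t. t)"
  define D where "D = (\<integral>A. quad_dev m d e T A \<partial>gaussian ({..<m} \<times> {..<d}))"
  have W0: "0 \<le> W'" unfolding W'_def using T by (intro expected_max_nonneg) auto
  have D0: "0 \<le> D" unfolding D_def using quad_dev_nonneg[OF T e] by (intro integral_nonneg_AE) auto
  have s2: "sqrt 8 = 2 * sqrt 2" using real_sqrt_mult[of 4 2] by simp
  have s2': "sqrt 2 \<le> 3 / 2" by (rule real_le_lsqrt) (auto simp: power2_eq_square)
  have sm: "0 < sqrt m" "sqrt m * sqrt m = m" using m by auto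
  have W': "W' \<le> e * sqrt m / 300" using W by (simp add: W'_def)
  have "D \<le> 4 * sqrt 2 * (sqrt m * W') + 4 * sqrt 8 * W' * (sqrt m + D / (2 * e * sqrt m))"
    unfolding D_def W'_def by (rule quad_dev_expectation_self_bound[OF T e m])
  also have "\<dots> = 12 * sqrt 2 * (sqrt m * W') + 4 * sqrt 2 * (W' / (e * sqrt m)) * D"
    unfolding s2 using sm e by (simp add: field_simps)
  also have "\<dots> \<le> 12 * (3 / 2) * (sqrt m * (e * sqrt m / 300)) + 4 * (3 / 2) * (1 / 300) * D"
  proof (intro add_mono mult_mono s2' mult_left_mono W')
    show "W' / (e * sqrt m) \<le> 1 / 300" using W' e sm by (simp add: field_simps)
  qed (use W0 D0 e sm in auto)
  also have "sqrt m * (e * sqrt m / 300) = m * e / 300" using sm by (simp add: ac_simps)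
  finally have "49 / 50 * D \<le> 3 / 50 * (m * e)" by (simp add: mult.commute[of e])
  moreover have "0 \<le> m * e" using e by simp
  ultimately show ?thesis unfolding D_def[symmetric] by linarith
qed

text \<open>Markov's inequality at twice the bound on the mean. The probability does not depend on
  the size of \<open>T\<close>, so it survives a limit of growing sets.\<close>

lemma quad_dev_le_prob:
  fixes m d :: nat and T :: "(nat \<Rightarrow> real) set" and e :: real
  assumes T: "finite T" "(\<lambda>_. 0) \<in> T" and e: "0 < e" and m: "0 < m"
    and W: "300 * expected_max {..<d} T (\<lambda>t. t) \<le> e * sqrt m"
  defines "K \<equiv> {..<m} \<times> {..<d}"
  shows "1 / 2 \<le> measure (gaussian K) {A \<in> space (gaussian K). quad_dev m d e T A \<le> m * e / 4}"
proof -
  note [measurable] = measurable_quad_dev[OF T(1), of m d e, folded K_def]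
  have me: "0 < m * e / 4" using e m by simp
  have "measure (gaussian K) {A \<in> space (gaussian K). m * e / 4 \<le> quad_dev m d e T A}
      \<le> (\<integral>A. quad_dev m d e T A \<partial>gaussian K) / (m * e / 4)"
    using me quad_dev_nonneg[OF T e] integrable_quad_dev[OF T e, of m d, folded K_def]
    by (intro integral_Markov_inequality_measure[where A = "{}"]) auto
  also have "\<dots> \<le> (m * e / 8) / (m * e / 4)"
    using me quad_dev_expectation_le[OF T e m W] by (intro divide_right_mono) (auto simp: K_def)
  also have "\<dots> = 1 / 2" using e m by (simp add: field_simps)
  finally have "measure (gaussian K) {A \<in> space (gaussian K). m * e / 4 \<le> quad_dev m d e T A} \<le> 1 / 2" .
  moreover have "1 - measure (gaussian K) {A \<in> space (gaussian K). m * e / 4 \<le> quad_dev m d e T A}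
      = measure (gaussian K) (space (gaussian K) - {A \<in> space (gaussian K). m * e / 4 \<le> quad_dev m d e T A})"
    by (intro gaussian.prob_compl[symmetric]) measurable
  moreover have "\<dots> \<le> measure (gaussian K) {A \<in> space (gaussian K). quad_dev m d e T A \<le> m * e / 4}"
    by (intro gaussian.finite_measure_mono) auto
  ultimately show ?thesis by linarith
qed

text \<open>The good events decrease as the sets grow and all have probability at least 1/2; by
  continuity from above so does their intersection, which is therefore nonempty.\<close>

lemma exists_matrix_quad_dev_le:
  fixes m d :: nat and T :: "nat \<Rightarrow> (nat \<Rightarrow> real) set" and e :: real
  assumes fin: "\<And>n. finite (T n)" and zero: "\<And>n. (\<lambda>_. 0) \<in> T n" and inc: "incseq T"
    and e: "0 < e" and m: "0 < m"
    and W: "\<And>n. 300 * expected_max {..<d} (T n) (\<lambda>t. t) \<le> e * sqrt m"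
  shows "\<exists>A. \<forall>n. \<forall>t\<in>T n. \<bar>(\<Sum>i<m. (row_product d A t i)\<^sup>2) - m * (\<Sum>k<d. (t k)\<^sup>2)\<bar>
    \<le> m * e / 4 * (L2_set t {..<d} + e)"
proof -
  define K where "K = {..<m} \<times> {..<d}"
  define E where "E n = {A \<in> space (gaussian K). quad_dev m d e (T n) A \<le> m * e / 4}" for n
  have E_meas: "E n \<in> sets (gaussian K)" for n
  proof -
    note [measurable] = measurable_quad_dev[OF fin[of n], of m d e, folded K_def]
    show ?thesis unfolding E_def by measurable
  qed
  have "decseq E"
  proof (rule decseq_SucI, rule subsetI)
    fix n A assume A: "A \<in> E (Suc n)"
    have "quad_dev m d e (T n) A \<le> quad_dev m d e (T (Suc n)) A"
    proof -
      have "T n \<subseteq> T (Suc n)" using inc by (simp add: incseq_Suc_iff)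
      moreover have "T n \<noteq> {}" using zero by blast
      ultimately show ?thesis unfolding quad_dev_def by (intro Max_mono image_mono) (simp_all add: fin)
    qed
    then show "A \<in> E n" using A by (auto simp: E_def)
  qed
  then have "(\<lambda>n. measure (gaussian K) (E n)) \<longlonglongrightarrow> measure (gaussian K) (\<Inter>n. E n)"
    using E_meas by (intro gaussian.finite_Lim_measure_decseq) auto
  then have "1 / 2 \<le> measure (gaussian K) (\<Inter>n. E n)"
    by (rule LIMSEQ_le_const)
      (use quad_dev_le_prob[OF fin zero e m W] in \<open>auto simp: E_def K_def\<close>)
  then have "(\<Inter>n. E n) \<noteq> {}" by (auto simp: measure_empty)
  then obtain A where A: "\<And>n. A \<in> E n" by auto
  show ?thesis
  proof (intro exI[of _ A] allI ballI)
    fix n t assume t: "t \<in> T n"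
    have "0 < L2_set t {..<d} + e" using e by (intro add_nonneg_pos) auto
    moreover have "\<bar>(\<Sum>i<m. (row_product d A t i)\<^sup>2) - m * (\<Sum>k<d. (t k)\<^sup>2)\<bar> / (L2_set t {..<d} + e) \<le> m * e / 4"
      by (rule order.trans[OF quad_dev_ge[OF fin t]]) (use A[of n] in \<open>unfold E_def, blast\<close>)
    ultimately show "\<bar>(\<Sum>i<m. (row_product d A t i)\<^sup>2) - m * (\<Sum>k<d. (t k)\<^sup>2)\<bar> \<le> m * e / 4 * (L2_set t {..<d} + e)"
      by (simp add: pos_divide_le_eq)
  qed
qed

text \<open>The maximum over \<open>{s, - s}\<close> is distributed like the absolute value of a
  standard normal variable, whose mean is \<open>sqrt (2 / pi)\<close>. Comparison with a process
  over a one-point index set makes this precise.\<close>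

lemma expected_max_symmetric_pair_ge:
  fixes s :: "nat \<Rightarrow> real"
  assumes s: "(\<Sum>k<d. (s k)\<^sup>2) = 1"
  shows "1 / 2 \<le> expected_max {..<d} UNIV (\<lambda>b k. if b then s k else - s k)"
proof -
  have "1 / 2 \<le> sqrt (2 / pi)"
    using pi_less_4 by (intro real_le_rsqrt) (auto simp: power2_eq_square field_simps)
  also have "\<dots> = (\<integral>g. \<bar>g ()\<bar> \<partial>gaussian (UNIV :: unit set))"
    by (simp add: integral_gaussian_component[where f = abs] integral_std_normal_abs)
  also have "\<dots> = expected_max (UNIV :: unit set) UNIV (\<lambda>b k. if b then 1 else - 1)"
    unfolding expected_max_def UNIV_bool by (intro Bochner_Integration.integral_cong refl) (auto simp: UNIV_unit)
  also have "\<dots> \<le> expected_max {..<d} UNIV (\<lambda>b k. if b then s k else - s k)"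
  proof (rule sudakov_fernique)
    fix b c :: bool
    have "(\<Sum>k<d. (s k + s k)\<^sup>2) = 4 * (\<Sum>k<d. (s k)\<^sup>2)"
      unfolding sum_distrib_left by (intro sum.cong refl) (simp add: power2_eq_square)
    moreover have "(\<Sum>k<d. (- s k - s k)\<^sup>2) = 4 * (\<Sum>k<d. (s k)\<^sup>2)"
      unfolding sum_distrib_left by (intro sum.cong refl) (simp add: power2_eq_square algebra_simps)
    ultimately show "(\<Sum>i\<in>(UNIV :: unit set). ((if b then 1 else - 1) - (if c then 1 else - 1))\<^sup>2)
      \<le> (\<Sum>k<d. ((if b then s k else - s k) - (if c then s k else - s k))\<^sup>2)"
      using s by (auto simp: UNIV_unit power2_eq_square)
  qed auto
  finally show ?thesis .
qed

section \<open>Metric projection onto sets of positive reach\<close>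

text \<open>The dimension is not part of the type, so Euclidean space appears as a subspace
  \<open>V\<close> of a larger inner product space in which closed bounded sets may fail to be
  compact.\<close>

locale heine_borel_subspace =
  fixes V :: "'a::real_inner set"
  assumes subspace_V: "subspace V" and closed_V: "closed V"
    and heine_borel: "\<And>S. S \<subseteq> V \<Longrightarrow> closed S \<Longrightarrow> bounded S \<Longrightarrow> compact S"
begin

lemma compact_Int_cball:
  assumes "closed X" "X \<subseteq> V"
  shows "compact (X \<inter> cball a r)"
  using assms by (intro heine_borel) (auto intro: bounded_subset[OF bounded_cball])

lemma nearest_point_exists:
  assumes X: "closed X" "X \<subseteq> V" "X \<noteq> {}"
  obtains p where "p \<in> X" "dist u p = infdist u X"
proof -
  obtain x where x: "x \<in> X" using X by auto
  let ?C = "X \<inter> cball u (dist u x)"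
  have "\<exists>p\<in>?C. \<forall>y\<in>?C. dist u p \<le> dist u y"
    using x by (intro continuous_attains_inf compact_Int_cball X continuous_intros) auto
  then obtain p where p: "p \<in> ?C" "\<And>y. y \<in> ?C \<Longrightarrow> dist u p \<le> dist u y" by blast
  have "dist u p \<le> dist u y" if "y \<in> X" for y
    using p(2)[of y] p(2)[of x] x that by (cases "dist u y \<le> dist u x") (auto simp: mem_cball)
  then have "dist u p \<le> infdist u X"
    using X by (auto simp: infdist_notempty intro!: cINF_greatest)
  moreover have "infdist u X \<le> dist u p" using p(1) by (intro infdist_le) auto
  ultimately show ?thesis using p(1) that[of p] by auto
qed

end

locale positive_reach = heine_borel_subspace V for V :: "'a::real_inner set" +
  fixes X :: "'a set" and \<sigma> :: real
  assumes X: "closed X" "X \<subseteq> V" "X \<noteq> {}"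
    and unique_nearest: "\<And>x y z. x \<in> V \<Longrightarrow> infdist x X < \<sigma> \<Longrightarrow> y \<in> X \<Longrightarrow> z \<in> X \<Longrightarrow>
      dist x y = infdist x X \<Longrightarrow> dist x z = infdist x X \<Longrightarrow> y = z"
begin

text \<open>By compactness and uniqueness, points of \<open>X\<close> at distance at least \<gamma>
  from \<open>q\<close> are farther from \<open>y\<close> than some \<mu> exceeding the distance to
  \<open>X\<close>. After a small move of \<open>y\<close> they are still not nearest.\<close>

lemma nearest_point_continuous:
  assumes y: "y \<in> V" "infdist y X < \<sigma>" and q: "q \<in> X" "dist y q = infdist y X" and \<gamma>: "0 < \<gamma>"
  obtains h where "0 < h" "\<And>x q'. x \<in> V \<Longrightarrow> dist x y < h \<Longrightarrow> q' \<in> X \<Longrightarrow> dist x q' = infdist x X \<Longrightarrow> dist q' q < \<gamma>"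
proof -
  let ?D = "infdist y X"
  define C where "C = X \<inter> cball y (?D + 1) \<inter> {q'. \<gamma> \<le> dist q' q}"
  have cl: "closed {q'. \<gamma> \<le> dist q' q}" by (intro closed_Collect_le continuous_intros)
  have C: "compact C" unfolding C_def by (intro compact_Int_closed compact_Int_cball X(1,2) cl)
  have "\<exists>\<mu>>?D. \<forall>q'\<in>C. \<mu> \<le> dist y q'"
  proof (cases "C = {}")
    case True then show ?thesis by (auto intro!: exI[of _ "?D + 1"])
  next
    case False
    then have "\<exists>c\<in>C. \<forall>q'\<in>C. dist y c \<le> dist y q'"
      using C by (intro continuous_attains_inf continuous_intros) auto
    then obtain c where c: "c \<in> C" "\<forall>q'\<in>C. dist y c \<le> dist y q'" by blast
    have "c \<in> X" "c \<noteq> q" using c(1) \<gamma> by (auto simp: C_def)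
    then have "dist y c \<noteq> ?D" using unique_nearest[OF y _ q(1) _ q(2)] by blast
    moreover have "?D \<le> dist y c" using \<open>c \<in> X\<close> by (rule infdist_le)
    ultimately show ?thesis using c(2) by (intro exI[of _ "dist y c"]) auto
  qed
  then obtain \<mu> where \<mu>: "?D < \<mu>" "\<And>q'. q' \<in> C \<Longrightarrow> \<mu> \<le> dist y q'" by blast
  show ?thesis
  \<comment> \<open>A nearest point of \<open>x\<close> has distance at most
    \<open>?D + 2 * dist x y\<close> from \<open>y\<close>. The bound 1/2 keeps it in the ball used
    to define \<open>C\<close>, the other bound keeps it closer than \<mu>.\<close>
  proof (rule that[of "min (1 / 2) ((\<mu> - ?D) / 2)"])
    show "0 < min (1 / 2) ((\<mu> - ?D) / 2)" using \<mu>(1) by auto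
    fix x q' assume x: "x \<in> V" "dist x y < min (1 / 2) ((\<mu> - ?D) / 2)" and q': "q' \<in> X" "dist x q' = infdist x X"
    have "dist y q' \<le> dist x y + infdist x X" using dist_triangle[of y q' x] q'(2) by (simp add: dist_commute)
    also have "infdist x X \<le> ?D + dist x y" using infdist_triangle[of x X y] by simp
    finally have "dist y q' \<le> ?D + 2 * dist x y" by simp
    then have "dist y q' < \<mu>" "dist y q' \<le> ?D + 1" using x(2) by auto
    then have "q' \<notin> C" using \<mu>(2) by force
    then show "dist q' q < \<gamma>" using q'(1) \<open>dist y q' \<le> ?D + 1\<close> by (auto simp: C_def)
  qed
qed

text \<open>The distance function is differentiable where the nearest point is unique, with gradient
  \<open>(y - q) / |y - q|\<close>; hence a maximiser over a ball around \<open>a\<close> lies in that direction from \<open>a\<close>.\<close>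

lemma infdist_maximizer_direction:
  assumes a: "a \<in> V" and \<eta>: "0 < \<eta>" and y: "y \<in> V" "y \<in> cball a \<eta>"
    and max: "\<And>x. x \<in> V \<Longrightarrow> x \<in> cball a \<eta> \<Longrightarrow> infdist x X \<le> infdist y X"
    and D: "0 < infdist y X" "infdist y X < \<sigma>" and q: "q \<in> X" "dist y q = infdist y X"
  shows "y - a = (\<eta> / dist y q) *\<^sub>R (y - q)"
proof (rule ccontr)
  assume ne: "y - a \<noteq> (\<eta> / dist y q) *\<^sub>R (y - q)"
  let ?D = "dist y q"
  define n where "n = (1 / ?D) *\<^sub>R (y - q)"
  define b where "b = y - a"
  \<comment> \<open>If \<open>y\<close> is not the claimed point, moving it along \<open>e\<close>
    stays in the ball by convexity, while \<open>n \<bullet> e > 0\<close> makes the distance to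
    \<open>X\<close> grow; this contradicts maximality.\<close>
  define e where "e = \<eta> *\<^sub>R n - b"
  have Dp: "0 < ?D" using D q by simp
  have n1: "norm n = 1" using Dp unfolding n_def by (simp add: dist_norm)
  have yq: "y - q = ?D *\<^sub>R n" using Dp by (simp add: n_def)
  have b: "norm b \<le> \<eta>" using y(2) by (simp add: b_def dist_norm norm_minus_commute)
  have e0: "e \<noteq> 0" using ne by (auto simp: e_def n_def b_def)
  have inn: "n \<bullet> n = 1" using n1 by (simp add: dot_square_norm)
  have "0 < n \<bullet> e"
  proof -
    have "(norm e)\<^sup>2 = \<eta>\<^sup>2 - 2 * \<eta> * (n \<bullet> b) + (norm b)\<^sup>2"
      unfolding e_def power2_norm_eq_inner
      by (simp add: inner_diff_left inner_diff_right inn inner_commute power2_eq_square algebra_simps)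
    moreover have "(norm b)\<^sup>2 \<le> \<eta>\<^sup>2" using b by (intro power_mono) auto
    moreover have "0 < (norm e)\<^sup>2" using e0 by simp
    ultimately have "0 < \<eta> * (\<eta> - n \<bullet> b)" by (simp add: power2_eq_square algebra_simps)
    then have "n \<bullet> b < \<eta>" using \<eta> by (simp add: zero_less_mult_iff)
    then show ?thesis by (simp add: e_def inner_diff_right inn)
  qed
  define c where "c = e \<bullet> (y - q)"
  have c: "0 < c" unfolding c_def yq using Dp \<open>0 < n \<bullet> e\<close> by (simp add: inner_commute)
  \<comment> \<open>Replacing \<open>q\<close> by a nearest point \<open>q'\<close> within \<gamma>
    changes \<open>e \<bullet> (y - q)\<close> by at most half of \<open>c\<close>, so the sign is
    kept.\<close>
  define \<gamma> where "\<gamma> = c / (2 * norm e)"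
  have \<gamma>: "0 < \<gamma>" using c e0 by (simp add: \<gamma>_def)
  obtain h0 where h0: "0 < h0" "\<And>x q'. x \<in> V \<Longrightarrow> dist x y < h0 \<Longrightarrow> q' \<in> X \<Longrightarrow> dist x q' = infdist x X \<Longrightarrow> dist q' q < \<gamma>"
    using nearest_point_continuous[OF y(1) D(2) q \<gamma>] by blast
  define h where "h = min 1 (h0 / (2 * norm e))"
  have h: "0 < h" "h \<le> 1" using h0 e0 by (auto simp: h_def)
  define x where "x = y + h *\<^sub>R e"
  have eV: "e \<in> V"
    using subspace_V a y(1) q(1) X(2) by (auto simp: e_def n_def b_def intro!: subspace_diff subspace_scale)
  have xV: "x \<in> V" using subspace_V y(1) eV by (auto simp: x_def intro!: subspace_add subspace_scale)
  have "x - a = (1 - h) *\<^sub>R b + (h * \<eta>) *\<^sub>R n" by (simp add: x_def e_def b_def algebra_simps)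
  then have "norm (x - a) \<le> (1 - h) * norm b + h * \<eta>"
    using norm_triangle_ineq[of "(1 - h) *\<^sub>R b" "(h * \<eta>) *\<^sub>R n"] h \<eta> n1 by simp
  also have "\<dots> \<le> (1 - h) * \<eta> + h * \<eta>" using b h by (intro add_right_mono mult_left_mono) auto
  finally have xa: "x \<in> cball a \<eta>" by (simp add: dist_norm norm_minus_commute algebra_simps)
  have "dist x y = h * norm e" using h by (simp add: x_def dist_norm)
  also have "\<dots> \<le> h0 / (2 * norm e) * norm e" by (intro mult_right_mono) (auto simp: h_def)
  also have "\<dots> < h0" using h0(1) e0 by simp
  finally have xy: "dist x y < h0" .
  obtain q' where q': "q' \<in> X" "dist x q' = infdist x X" using nearest_point_exists[OF X] .
  have "dist q' q < \<gamma>" by (rule h0(2)[OF xV xy q'])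
  then have "norm e * norm (q - q') \<le> norm e * \<gamma>" by (intro mult_left_mono) (auto simp: dist_norm norm_minus_commute)
  moreover have "\<bar>e \<bullet> (q - q')\<bar> \<le> norm e * norm (q - q')" by (rule Cauchy_Schwarz_ineq2)
  ultimately have "- (c / 2) \<le> e \<bullet> (q - q')" using e0 by (simp add: \<gamma>_def abs_le_iff)
  then have "0 < e \<bullet> (y - q')" using c inner_add_right[of e "y - q" "q - q'"] by (simp add: c_def)
  then have "0 < 2 * h * (e \<bullet> (y - q')) + h\<^sup>2 * (norm e)\<^sup>2" using h by (intro add_pos_nonneg) auto
  then have "(dist y q')\<^sup>2 < (dist x q')\<^sup>2"
    unfolding dist_norm x_def power2_norm_eq_inner
    by (simp add: inner_diff_left inner_diff_right inner_add_left inner_add_right inner_commute power2_eq_square algebra_simps)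
  then have "dist y q' < dist x q'" by (rule power2_less_imp_less) simp
  moreover have "infdist y X \<le> dist y q'" using q'(1) by (rule infdist_le)
  ultimately show False using max[OF xV xa] q'(2) by simp
qed

text \<open>\<open>p\<close> remains a nearest point along the normal ray as long as the distance
  stays below \<sigma>. At a last such point \<open>a\<close>, with parameter \<open>r\<close>,
  maximise the distance over an \<eta>-ball. The maximiser \<open>y\<close> has a nearest point
  \<open>q\<close> with \<open>dist a q = dist y q - \<eta>\<close>, and this is at most
  \<open>r\<close>; so \<open>q\<close> is also nearest to \<open>a\<close>, uniqueness gives
  \<open>q = p\<close>, and \<open>y\<close> lies on the ray at \<open>r + \<eta>\<close>, beyond
  the supposed end.\<close>

lemma infdist_normal_ray:
  assumes u: "u \<in> V" and p: "p \<in> X" "dist u p = infdist u X" and t: "t = dist u p" "0 < t" and s: "t \<le> s" "s < \<sigma>"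
  shows "infdist (p + (s / t) *\<^sub>R (u - p)) X = s"
proof -
  define n where "n = (1 / t) *\<^sub>R (u - p)"
  have n1: "norm n = 1" using t by (simp add: n_def dist_norm)
  have pV: "p \<in> V" using p X by auto
  have nV: "n \<in> V" using subspace_V u pV by (auto simp: n_def intro!: subspace_diff subspace_scale)
  have ray: "p + r *\<^sub>R n \<in> V" for r using subspace_V pV nV by (intro subspace_add subspace_scale)
  define A where "A = {r \<in> {t..s}. infdist (p + r *\<^sub>R n) X = r}"
  have "closed A"
  proof -
    have "closed ({t..s} \<inter> {r. infdist (p + r *\<^sub>R n) X = r})"
      by (intro closed_Int closed_Collect_eq continuous_intros continuous_on_infdist closed_atLeastAtMost)
    then show ?thesis by (simp add: A_def Int_def)
  qed
  have "t \<in> A" using s t p(2) by (simp add: A_def n_def)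
  have bdd: "bdd_above A" by (auto simp: A_def intro!: bdd_aboveI[of _ s])
  define r where "r = Sup A"
  have r: "r \<in> A" unfolding r_def using \<open>closed A\<close> \<open>t \<in> A\<close> bdd by (intro closed_contains_Sup) auto
  have "r = s"
  proof (rule ccontr)
    assume "r \<noteq> s"
    then have rs: "t \<le> r" "r < s" "infdist (p + r *\<^sub>R n) X = r" using r by (auto simp: A_def)
    define a where "a = p + r *\<^sub>R n"
    have aV: "a \<in> V" unfolding a_def by (rule ray)
    have ap: "dist a p = infdist a X" using rs t(2) n1 by (simp add: a_def dist_norm abs_of_nonneg[OF order.trans[OF less_imp_le[OF t(2)] rs(1)]])
    have "0 < r" using rs(1) t(2) by linarith
    \<comment> \<open>\<open>r / 2\<close> keeps the radius below the distance from \<open>y\<close>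
      to \<open>q\<close>, and \<open>s - r\<close> keeps the whole ball below \<sigma>.\<close>
    define \<eta> where "\<eta> = min (r / 2) (s - r)"
    have \<eta>: "0 < \<eta>" "\<eta> < r" "r + \<eta> \<le> s" using rs(2) \<open>0 < r\<close> by (auto simp: \<eta>_def)
    have "compact (V \<inter> cball a \<eta>)" by (rule compact_Int_cball[OF closed_V subset_refl])
    then have "\<exists>y\<in>V \<inter> cball a \<eta>. \<forall>x\<in>V \<inter> cball a \<eta>. infdist x X \<le> infdist y X"
      using aV \<eta> by (intro continuous_attains_sup continuous_on_infdist continuous_intros) auto
    then obtain y where y: "y \<in> V" "y \<in> cball a \<eta>" and max: "\<And>x. x \<in> V \<Longrightarrow> x \<in> cball a \<eta> \<Longrightarrow> infdist x X \<le> infdist y X"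
      by blast
    have y1: "r \<le> infdist y X" using max[OF aV] \<eta> rs(3) by (simp add: a_def)
    have "infdist y X \<le> infdist a X + dist y a" by (rule infdist_triangle)
    then have y2: "infdist y X \<le> r + \<eta>" using y(2) rs(3) by (simp add: a_def dist_commute)
    have y3: "0 < infdist y X" "infdist y X < \<sigma>" using y1 y2 \<eta> s by auto
    obtain q where q: "q \<in> X" "dist y q = infdist y X" using nearest_point_exists[OF X] .
    have dir: "y - a = (\<eta> / dist y q) *\<^sub>R (y - q)"
      by (rule infdist_maximizer_direction[OF aV \<eta>(1) y max y3 q])
    have aq: "a - q = (1 - \<eta> / dist y q) *\<^sub>R (y - q)"
    proof -
      have "a - q = (y - q) - (y - a)" by simp
      then show ?thesis unfolding dir by (simp add: algebra_simps)
    qed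
    have Dq: "0 < dist y q" "\<eta> < dist y q" using y1 y3 q \<eta> by auto
    have "dist a q = (1 - \<eta> / dist y q) * dist y q"
      using Dq unfolding dist_norm[of a q] aq by (simp add: dist_norm)
    then have "dist a q = dist y q - \<eta>" using Dq by (simp add: field_simps)
    also have "\<dots> \<le> infdist a X" using y2 q rs(3) by (simp add: a_def)
    finally have "dist a q = infdist a X" using infdist_le[OF q(1), of a] by simp
    have "infdist a X < \<sigma>" using rs(2,3) s(2) by (simp add: a_def)
    then have "q = p"
      by (rule unique_nearest[OF aV _ q(1) p(1) \<open>dist a q = infdist a X\<close> ap])
    have Dr: "dist y q = r + \<eta>"
      using \<open>dist a q = dist y q - \<eta>\<close> \<open>dist a q = infdist a X\<close> rs(3) by (simp add: a_def)
    have "r *\<^sub>R n = (1 - \<eta> / dist y q) *\<^sub>R (y - p)" using aq unfolding \<open>q = p\<close> by (simp add: a_def)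
    also have "1 - \<eta> / dist y q = r / (r + \<eta>)" unfolding Dr using \<eta> by (simp add: field_simps)
    finally have "((r + \<eta>) / r) *\<^sub>R (r *\<^sub>R n) = y - p" using \<eta> by simp
    moreover have "((r + \<eta>) / r) *\<^sub>R (r *\<^sub>R n) = (r + \<eta>) *\<^sub>R n" using \<open>0 < r\<close> by simp
    ultimately have "y - p = (r + \<eta>) *\<^sub>R n" by simp
    then have "y = p + (r + \<eta>) *\<^sub>R n" unfolding diff_eq_eq by (simp only: add.commute)
    then have "r + \<eta> \<in> A" using Dr q(2) \<eta> rs by (auto simp: A_def)
    then have "r + \<eta> \<le> r" using bdd unfolding r_def by (intro cSup_upper)
    then show False using \<eta> by simp
  qed
  with r show ?thesis by (simp add: A_def n_def)
qed

text \<open>Federer's inequality: the point at distance \<open>s\<close> from \<open>p\<close> on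
  the ray through \<open>u\<close> has no point of \<open>X\<close> closer than \<open>s\<close>.
  Expanding the square of its distance to \<open>q\<close> gives the claim.\<close>

lemma normal_inequality:
  assumes u: "u \<in> V" and p: "p \<in> X" "dist u p = infdist u X" and q: "q \<in> X"
    and s: "dist u p \<le> s" "0 < s" "s < \<sigma>"
  shows "2 * s * ((u - p) \<bullet> (q - p)) \<le> dist u p * (dist q p)\<^sup>2"
proof (cases "dist u p = 0")
  case True then show ?thesis by simp
next
  case False
  define t where "t = dist u p"
  have t: "0 < t" using False by (simp add: t_def)
  have "s = infdist (p + (s / t) *\<^sub>R (u - p)) X"
    by (rule infdist_normal_ray[symmetric, OF u p t_def t]) (use s in \<open>auto simp: t_def\<close>)
  also have "\<dots> \<le> dist (p + (s / t) *\<^sub>R (u - p)) q" by (rule infdist_le[OF q])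
  finally have "s\<^sup>2 \<le> (norm ((s / t) *\<^sub>R (u - p) - (q - p)))\<^sup>2"
    using s(2) by (intro power_mono) (auto simp: dist_norm algebra_simps)
  also have "\<dots> = (s / t)\<^sup>2 * (norm (u - p))\<^sup>2 - 2 * (s / t) * ((u - p) \<bullet> (q - p)) + (norm (q - p))\<^sup>2"
  proof -
    have "(norm (c *\<^sub>R a - b))\<^sup>2 = c\<^sup>2 * (norm a)\<^sup>2 - 2 * c * (a \<bullet> b) + (norm b)\<^sup>2" for c and a b :: 'a
      unfolding power2_norm_eq_inner
      by (simp add: inner_diff_left inner_diff_right inner_commute power2_eq_square algebra_simps)
    then show ?thesis .
  qed
  also have "(s / t)\<^sup>2 * (norm (u - p))\<^sup>2 = s\<^sup>2" using t by (simp add: t_def dist_norm power_divide)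
  finally have "2 * (s / t) * ((u - p) \<bullet> (q - p)) \<le> (dist q p)\<^sup>2" by (simp add: dist_norm)
  then show ?thesis using t by (simp add: t_def field_simps)
qed

text \<open>At distance at most \<open>s / 2\<close> the normal inequality bounds each inner product
  by a quarter of \<open>|p - q|^2\<close>. Adding it at \<open>p\<close> and at \<open>q\<close>
  leaves half of \<open>|p - q|^2\<close> below \<open>\<langle>v - u, q - p\<rangle>\<close>, to
  which Cauchy-Schwarz applies.\<close>

lemma nearest_point_lipschitz:
  assumes u: "u \<in> V" "p \<in> X" "dist u p = infdist u X" "infdist u X \<le> s / 2"
    and v: "v \<in> V" "q \<in> X" "dist v q = infdist v X" "infdist v X \<le> s / 2"
    and s: "0 < s" "s < \<sigma>"
  shows "dist p q \<le> 2 * dist u v"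
proof -
  have half: "(x - a) \<bullet> (b - a) \<le> (dist a b)\<^sup>2 / 4"
    if "x \<in> V" "a \<in> X" "dist x a = infdist x X" "infdist x X \<le> s / 2" "b \<in> X" for x a b
  proof -
    have "2 * s * ((x - a) \<bullet> (b - a)) \<le> dist x a * (dist b a)\<^sup>2"
      by (rule normal_inequality) (use that s in auto)
    also have "\<dots> \<le> (s / 2) * (dist b a)\<^sup>2" using that by (intro mult_right_mono) auto
    finally show ?thesis using s by (simp add: dist_commute field_simps)
  qed
  have "(u - p) \<bullet> (q - p) + (v - q) \<bullet> (p - q) \<le> (dist p q)\<^sup>2 / 2"
    using half[OF u v(2)] half[OF v u(2)] by (simp add: dist_commute)
  moreover have "(u - p) \<bullet> (q - p) + (v - q) \<bullet> (p - q) = (dist p q)\<^sup>2 - (v - u) \<bullet> (q - p)"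
    unfolding dist_norm power2_norm_eq_inner
    by (simp add: inner_diff_left inner_diff_right inner_commute)
  moreover have "(v - u) \<bullet> (q - p) \<le> norm (v - u) * norm (q - p)" by (rule norm_cauchy_schwarz)
  ultimately have "dist p q * dist p q \<le> (2 * dist u v) * dist p q"
    by (simp add: dist_norm norm_minus_commute power2_eq_square)
  then show ?thesis
    using mult_right_le_imp_le[of "dist p q" "dist p q" "2 * dist u v"] zero_le_dist[of p q] zero_le_dist[of u v]
    by (cases "dist p q = 0") (auto simp del: zero_le_dist)
qed

end

section \<open>Minimal outer extensions\<close>

text \<open>Stands in for differentiation: it extracts first-order conditions from minimality along
  a segment.\<close>

lemma nonneg_slope:
  fixes c b :: real
  assumes "\<And>h. 0 < h \<Longrightarrow> h < 1 \<Longrightarrow> 0 \<le> h * c + h\<^sup>2 * b"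
  shows "0 \<le> c"
proof (rule ccontr)
  assume "\<not> 0 \<le> c"
  then have c: "c < 0" by simp
  define h where "h = min (1 / 2) (- c / (2 * (\<bar>b\<bar> + 1)))"
  have "0 < - c / (2 * (\<bar>b\<bar> + 1))" using c by (intro divide_pos_pos) auto
  then have h: "0 < h" "h < 1" by (auto simp: h_def)
  have "h \<le> - c / (2 * (\<bar>b\<bar> + 1))" by (simp add: h_def)
  then have "h * (2 * (\<bar>b\<bar> + 1)) \<le> - c" by (subst (asm) pos_le_divide_eq) auto
  moreover have "h * b \<le> h * (\<bar>b\<bar> + 1)" using h by (intro mult_left_mono) auto
  ultimately have "c + h * b < 0" using c by (simp add: algebra_simps)
  then have "h * (c + h * b) < 0" using h by (simp add: mult_pos_neg)
  then show False using assms[OF h] by (simp add: power2_eq_square algebra_simps)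
qed

text \<open>The minimiser \<open>y\<close> of \<open>|P y|^2 / 2 - \<langle>z, y\<rangle> + 2 e |z| \<Lambda>\<close> over the cone of all \<open>y = \<Lambda> t\<close>, \<open>t \<in> T\<close>,
  yields the required vector \<open>P y\<close>: its first-order conditions are the constraints.\<close>

lemma outer_extension_exists:
  fixes P :: "'a::real_inner \<Rightarrow> 'b::real_inner"
  assumes T: "compact T" "convex T" "T \<noteq> {}" and P: "bounded_linear P" and e: "0 < e"
    and low: "\<And>t. t \<in> T \<Longrightarrow> norm t - e \<le> norm (P t)"
  obtains v where "v \<in> range P" "norm v \<le> norm z" "\<And>s. s \<in> T \<Longrightarrow> z \<bullet> s - v \<bullet> P s \<le> 2 * e * norm z"
proof (cases "z = 0")
  case True
  interpret P: bounded_linear P by (rule P)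
  show ?thesis by (rule that[of 0]) (use True P.zero in \<open>auto intro: range_eqI[of 0 P 0]\<close>)
next
  case False
  interpret P: bounded_linear P by (rule P)
  define k where "k = 2 * e * norm z"
  have z: "0 < norm z" "0 < k" using False e by (auto simp: k_def)
  define J where "J y \<Lambda> = (norm (P y))\<^sup>2 / 2 - z \<bullet> y + k * \<Lambda>" for y \<Lambda>
  \<comment> \<open>The lower bound on \<open>P\<close> gives
    \<open>J \<ge> (|P y| - |z|)^2 / 2 - |z|^2 / 2 + e |z| \<Lambda>\<close>, which is nonnegative
    from \<open>\<Lambda> = L\<close> on. As \<open>J\<close> vanishes at the origin, minimising
    over the compact set \<open>{0..L} \<times> T\<close> suffices.\<close>
  define L where "L = norm z / (2 * e)"
  have L: "0 < L" using z e by (simp add: L_def)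
  have far: "0 \<le> J (\<Lambda> *\<^sub>R t) \<Lambda>" if t: "t \<in> T" and \<Lambda>: "L \<le> \<Lambda>" for t \<Lambda>
  proof -
    have \<Lambda>0: "0 \<le> \<Lambda>" using \<Lambda> L by simp
    have "z \<bullet> (\<Lambda> *\<^sub>R t) \<le> norm z * (\<Lambda> * norm t)"
      using norm_cauchy_schwarz[of z "\<Lambda> *\<^sub>R t"] \<Lambda>0 by simp
    also have "\<dots> \<le> norm z * (\<Lambda> * (norm (P t) + e))"
      using low[OF t] \<Lambda>0 by (intro mult_left_mono) auto
    finally have 1: "z \<bullet> (\<Lambda> *\<^sub>R t) \<le> norm z * norm (P (\<Lambda> *\<^sub>R t)) + norm z * \<Lambda> * e"
      using \<Lambda>0 by (simp add: P.scaleR algebra_simps)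
    have "norm z * \<Lambda> * e = norm z * e * \<Lambda>" by simp
    moreover have "norm z * e * L \<le> norm z * e * \<Lambda>" using \<Lambda> z e by (intro mult_left_mono) auto
    moreover have "norm z * e * L = (norm z)\<^sup>2 / 2" using e by (simp add: L_def power2_eq_square)
    moreover have "0 \<le> (norm (P (\<Lambda> *\<^sub>R t)) - norm z)\<^sup>2" by simp
    ultimately show ?thesis using 1 unfolding J_def k_def by (simp add: power2_diff algebra_simps)
  qed
  have "continuous_on ({0..L} \<times> T) (\<lambda>x. J (fst x *\<^sub>R snd x) (fst x))"
    unfolding J_def by (intro continuous_intros P.continuous_on) auto
  then have "\<exists>x\<in>{0..L} \<times> T. \<forall>x'\<in>{0..L} \<times> T. J (fst x *\<^sub>R snd x) (fst x) \<le> J (fst x' *\<^sub>R snd x') (fst x')"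
    using T L by (intro continuous_attains_inf compact_Times) auto
  then obtain x where x: "x \<in> {0..L} \<times> T" and xmin: "\<And>x'. x' \<in> {0..L} \<times> T \<Longrightarrow> J (fst x *\<^sub>R snd x) (fst x) \<le> J (fst x' *\<^sub>R snd x') (fst x')"
    by blast
  define \<Lambda> where "\<Lambda> = fst x"
  define t where "t = snd x"
  define y where "y = \<Lambda> *\<^sub>R t"
  have \<Lambda>: "0 \<le> \<Lambda>" and t: "t \<in> T" using x by (auto simp: \<Lambda>_def t_def)
  have min: "J y \<Lambda> \<le> J (\<Lambda>' *\<^sub>R t') \<Lambda>'" if "0 \<le> \<Lambda>'" "t' \<in> T" for \<Lambda>' t'
  proof (cases "\<Lambda>' \<le> L")
    case True
    then show ?thesis using xmin[of "(\<Lambda>', t')"] that by (simp add: y_def \<Lambda>_def t_def)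
  next
    case False
    have "J y \<Lambda> \<le> J (0 *\<^sub>R t) 0" using xmin[of "(0, t)"] t L by (simp add: y_def \<Lambda>_def t_def)
    also have "\<dots> = 0" by (simp add: J_def P.zero)
    also have "0 \<le> J (\<Lambda>' *\<^sub>R t') \<Lambda>'" using far that False by auto
    finally show ?thesis .
  qed
  define v where "v = P y"
  have con: "z \<bullet> s - v \<bullet> P s \<le> k" if s: "s \<in> T" for s
  proof -
    have "0 \<le> v \<bullet> P s - z \<bullet> s + k"
    proof (rule nonneg_slope[where b = "(norm (P s))\<^sup>2 / 2"])
      fix h :: real assume h: "0 < h" "h < 1"
      \<comment> \<open>By convexity the cone contains \<open>y + h s\<close> with parameter
        \<open>\<Lambda> + h\<close>, so a step towards \<open>s\<close> raises the penalty by only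
        \<open>k * h\<close>.\<close>
      define t' where "t' = (\<Lambda> / (\<Lambda> + h)) *\<^sub>R t + (h / (\<Lambda> + h)) *\<^sub>R s"
      have "t' \<in> T" unfolding t'_def using T(2) t s \<Lambda> h
        by (intro convexD) (auto simp: add_divide_distrib[symmetric])
      then have "J y \<Lambda> \<le> J ((\<Lambda> + h) *\<^sub>R t') (\<Lambda> + h)" using \<Lambda> h by (intro min) auto
      also have "(\<Lambda> + h) *\<^sub>R t' = y + h *\<^sub>R s"
        using \<Lambda> h by (simp add: t'_def y_def scaleR_add_right)
      also have "J (y + h *\<^sub>R s) (\<Lambda> + h) = J y \<Lambda> + (h * (v \<bullet> P s - z \<bullet> s + k) + h\<^sup>2 * ((norm (P s))\<^sup>2 / 2))"
      proof -
        have "(norm (P (y + h *\<^sub>R s)))\<^sup>2 = (norm (P y))\<^sup>2 + 2 * h * (P y \<bullet> P s) + h\<^sup>2 * (norm (P s))\<^sup>2"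
          unfolding P.add P.scaleR power2_norm_eq_inner
          by (simp add: inner_add_left inner_add_right inner_commute power2_eq_square algebra_simps)
        then show ?thesis unfolding J_def v_def by (simp add: inner_add_right algebra_simps)
      qed
      finally show "0 \<le> h * (v \<bullet> P s - z \<bullet> s + k) + h\<^sup>2 * ((norm (P s))\<^sup>2 / 2)" by simp
    qed
    then show ?thesis by simp
  qed
  \<comment> \<open>Minimality under shrinking \<open>y\<close> towards the origin supplies the
    other first-order condition, which bounds \<open>|v|^2\<close>.\<close>
  have "0 \<le> z \<bullet> y - k * \<Lambda> - (norm v)\<^sup>2"
  proof (rule nonneg_slope[where b = "(norm v)\<^sup>2 / 2"])
    fix h :: real assume h: "0 < h" "h < 1"
    have "J y \<Lambda> \<le> J (((1 - h) * \<Lambda>) *\<^sub>R t) ((1 - h) * \<Lambda>)" using \<Lambda> h t by (intro min) auto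
    also have "((1 - h) * \<Lambda>) *\<^sub>R t = (1 - h) *\<^sub>R y" by (simp add: y_def)
    also have "J ((1 - h) *\<^sub>R y) ((1 - h) * \<Lambda>) = (1 - h)\<^sup>2 * (norm v)\<^sup>2 / 2 - (1 - h) * (z \<bullet> y) + k * ((1 - h) * \<Lambda>)"
      using h by (simp add: J_def P.scaleR power_mult_distrib v_def)
    also have "\<dots> = J y \<Lambda> + (h * (z \<bullet> y - k * \<Lambda> - (norm v)\<^sup>2) + h\<^sup>2 * ((norm v)\<^sup>2 / 2))"
      unfolding J_def v_def by (simp add: power2_eq_square field_simps)
    finally show "0 \<le> h * (z \<bullet> y - k * \<Lambda> - (norm v)\<^sup>2) + h\<^sup>2 * ((norm v)\<^sup>2 / 2)" by simp
  qed
  then have "(norm v)\<^sup>2 \<le> z \<bullet> y - k * \<Lambda>" by simp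
  also have "z \<bullet> y \<le> norm z * norm y" by (rule norm_cauchy_schwarz)
  also have "norm z * norm y - k * \<Lambda> \<le> norm z * norm v"
  proof -
    \<comment> \<open>The lower bound on \<open>P\<close>, scaled by \<Lambda>, loses
      \<open>e * \<Lambda>\<close>; the penalty term \<open>2 * e * norm z * \<Lambda>\<close> more
      than covers the loss.\<close>
    have "\<Lambda> * (norm t - e) \<le> \<Lambda> * norm (P t)" using low[OF t] \<Lambda> by (intro mult_left_mono)
    then have "norm y - e * \<Lambda> \<le> norm v" using \<Lambda> by (simp add: y_def v_def P.scaleR algebra_simps)
    then have "norm y - 2 * e * \<Lambda> \<le> norm v" using mult_nonneg_nonneg[OF less_imp_le[OF e] \<Lambda>] by linarith
    then have "norm z * (norm y - 2 * e * \<Lambda>) \<le> norm z * norm v" by (intro mult_left_mono) auto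
    then show ?thesis by (simp add: k_def algebra_simps)
  qed
  finally have "norm v * norm v \<le> norm z * norm v" by (simp add: power2_eq_square)
  then have "norm v \<le> norm z"
    by (cases "norm v = 0") (auto simp: mult_le_cancel_right)
  then show ?thesis using con that[of v] by (auto simp: v_def k_def)
qed

text \<open>In the application \<open>S\<close> is the set of unit secants and \<open>T\<close> its
  closed convex hull. The lower bound is imposed on all of \<open>T\<close> because the dual
  minimiser is a multiple of some point of the hull.\<close>

locale near_isometry = W: heine_borel_subspace W for W :: "'b::real_inner set" +
  fixes P :: "'a::real_inner \<Rightarrow> 'b" and T S :: "'a set" and e :: real
  assumes P: "bounded_linear P" "range P \<subseteq> W"
    and T: "compact T" "convex T" "T \<noteq> {}"
    and S: "S \<subseteq> T" "\<And>s. s \<in> S \<Longrightarrow> - s \<in> S" "\<And>s. s \<in> S \<Longrightarrow> norm s = 1"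
    and e: "0 < e" "4 * e < 1"
    and low: "\<And>t. t \<in> T \<Longrightarrow> norm t - e \<le> norm (P t)"
begin

sublocale P: bounded_linear P by (rule P(1))

definition feasible :: "real \<Rightarrow> 'a \<Rightarrow> 'b set" where
  "feasible k z = {v \<in> W. \<forall>s\<in>S. \<bar>v \<bullet> P s - z \<bullet> s\<bar> \<le> k * norm z}"

text \<open>Symmetry of \<open>S\<close> turns the one-sided constraints into two-sided ones. The
  slack \<open>2 * e\<close> is half of the one used for the selection, which makes these points
  strictly feasible whenever \<open>z\<close> is nonzero.\<close>

lemma slater_point:
  obtains v where "v \<in> feasible (2 * e) z" "norm v \<le> norm z"
proof -
  obtain v where v: "v \<in> range P" "norm v \<le> norm z" "\<And>s. s \<in> T \<Longrightarrow> z \<bullet> s - v \<bullet> P s \<le> 2 * e * norm z"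
    using outer_extension_exists[OF T P(1) e(1) low] by metis
  have "\<bar>v \<bullet> P s - z \<bullet> s\<bar> \<le> 2 * e * norm z" if s: "s \<in> S" for s
  proof -
    have "z \<bullet> s - v \<bullet> P s \<le> 2 * e * norm z" "z \<bullet> (- s) - v \<bullet> P (- s) \<le> 2 * e * norm z"
      using v(3) S s by blast+
    then show ?thesis by (simp add: P.neg abs_le_iff)
  qed
  then show ?thesis using that[of v] v P(2) by (auto simp: feasible_def)
qed

lemma feasible_mono: "k \<le> k' \<Longrightarrow> feasible k z \<subseteq> feasible k' z"
  unfolding feasible_def using mult_right_mono[of k k' "norm z"] by fastforce

lemma closed_feasible: "closed (feasible k z)"
proof -
  have "feasible k z = W \<inter> (\<Inter>s\<in>S. {v. \<bar>v \<bullet> P s - z \<bullet> s\<bar> \<le> k * norm z})" by (auto simp: feasible_def)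
  then show ?thesis
    by (auto intro!: closed_Int W.closed_V closed_INT closed_Collect_le continuous_intros)
qed

lemma feasible_convex:
  assumes "v \<in> feasible k z" "w \<in> feasible k z" "0 \<le> h" "h \<le> 1"
  shows "v + h *\<^sub>R (w - v) \<in> feasible k z"
proof -
  have "\<bar>(v + h *\<^sub>R (w - v)) \<bullet> P s - z \<bullet> s\<bar> \<le> k * norm z" if s: "s \<in> S" for s
  proof -
    have "(v + h *\<^sub>R (w - v)) \<bullet> P s - z \<bullet> s = (1 - h) * (v \<bullet> P s - z \<bullet> s) + h * (w \<bullet> P s - z \<bullet> s)"
      by (simp add: inner_add_left inner_diff_left algebra_simps)
    also have "\<bar>\<dots>\<bar> \<le> (1 - h) * \<bar>v \<bullet> P s - z \<bullet> s\<bar> + h * \<bar>w \<bullet> P s - z \<bullet> s\<bar>"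
      using assms(3,4) by (intro order.trans[OF abs_triangle_ineq]) (simp add: abs_mult)
    also have "\<dots> \<le> (1 - h) * (k * norm z) + h * (k * norm z)"
      using assms s by (intro add_mono mult_left_mono) (auto simp: feasible_def)
    finally show ?thesis by (simp add: algebra_simps)
  qed
  then show ?thesis
    using assms W.subspace_V by (auto simp: feasible_def intro!: subspace_add subspace_scale subspace_diff)
qed

lemma min_norm_exists:
  "\<exists>v. v \<in> feasible (4 * e) z \<and> norm v \<le> norm z \<and> (\<forall>w\<in>feasible (4 * e) z. norm v \<le> norm w)"
proof -
  obtain v0 where v0: "v0 \<in> feasible (2 * e) z" "norm v0 \<le> norm z" by (rule slater_point)
  have v0': "v0 \<in> feasible (4 * e) z" using v0(1) feasible_mono[of "2 * e" "4 * e" z] e by auto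
  let ?C = "feasible (4 * e) z \<inter> cball 0 (norm z)"
  have "compact ?C" by (rule W.compact_Int_cball[OF closed_feasible]) (auto simp: feasible_def)
  moreover have "v0 \<in> ?C" using v0 v0' by simp
  ultimately have "\<exists>v\<in>?C. \<forall>w\<in>?C. norm v \<le> norm w"
    by (intro continuous_attains_inf continuous_intros) auto
  then obtain v where v: "v \<in> ?C" "\<And>w. w \<in> ?C \<Longrightarrow> norm v \<le> norm w" by blast
  have "norm v \<le> norm w" if "w \<in> feasible (4 * e) z" for w
    using v(2)[of w] v(1) that by (cases "norm w \<le> norm z") auto
  then show ?thesis using v(1) by auto
qed

text \<open>The vectors found by duality come without control in \<open>z\<close>; the element of
  least norm of a convex set is stable, which gives the regularity below.\<close>

definition outer :: "'a \<Rightarrow> 'b" where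
  "outer z = (SOME v. v \<in> feasible (4 * e) z \<and> norm v \<le> norm z \<and> (\<forall>w\<in>feasible (4 * e) z. norm v \<le> norm w))"

lemma outer_feasible: "outer z \<in> feasible (4 * e) z"
  and outer_norm_le: "norm (outer z) \<le> norm z"
  and outer_min: "w \<in> feasible (4 * e) z \<Longrightarrow> norm (outer z) \<le> norm w"
  using someI_ex[OF min_norm_exists[of z], folded outer_def] by auto

text \<open>Minimality along the segment to \<open>w\<close> gives the obtuse-angle condition
  \<open>\<langle>v, w - v\<rangle> \<ge> 0\<close> for \<open>v = outer z\<close>; expanding
  \<open>|w|^2\<close> about \<open>v\<close> finishes.\<close>

lemma outer_dist_le:
  assumes w: "w \<in> feasible (4 * e) z"
  shows "(norm (w - outer z))\<^sup>2 \<le> (norm w)\<^sup>2 - (norm (outer z))\<^sup>2"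
proof -
  let ?v = "outer z"
  have "0 \<le> 2 * (?v \<bullet> (w - ?v))"
  proof (rule nonneg_slope[where b = "(norm (w - ?v))\<^sup>2"])
    fix h :: real assume h: "0 < h" "h < 1"
    have "norm ?v \<le> norm (?v + h *\<^sub>R (w - ?v))"
      using h by (intro outer_min feasible_convex outer_feasible w) auto
    then have "(norm ?v)\<^sup>2 \<le> (norm (?v + h *\<^sub>R (w - ?v)))\<^sup>2" by (intro power_mono) auto
    also have "\<dots> = (norm ?v)\<^sup>2 + (h * (2 * (?v \<bullet> (w - ?v))) + h\<^sup>2 * (norm (w - ?v))\<^sup>2)"
    proof -
      have "(norm (a + h *\<^sub>R b))\<^sup>2 = (norm a)\<^sup>2 + (h * (2 * (a \<bullet> b)) + h\<^sup>2 * (norm b)\<^sup>2)" for a b :: 'b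
        unfolding power2_norm_eq_inner
        by (simp add: inner_add_left inner_add_right inner_commute power2_eq_square algebra_simps)
      then show ?thesis .
    qed
    finally show "0 \<le> h * (2 * (?v \<bullet> (w - ?v))) + h\<^sup>2 * (norm (w - ?v))\<^sup>2" by simp
  qed
  then show ?thesis
    unfolding power2_norm_eq_inner by (simp add: inner_diff_left inner_diff_right inner_commute)
qed

text \<open>Seen from \<open>z'\<close>, the vector \<open>v\<close> violates the constraints by at
  most \<open>2 * \<delta>\<close>, where \<open>4 * e < 1\<close> is used. Moving a fraction
  \<open>h\<close> of the way to a Slater point for \<open>z'\<close> repairs this, at a cost of at
  most \<open>8 \<delta> / k + \<delta> / k\<close> with \<open>k = 4 * e\<close>.\<close>

lemma feasible_perturb:
  assumes v: "v \<in> feasible (4 * e) z" "norm v \<le> norm z"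
  obtains w where "w \<in> feasible (4 * e) z'" "norm (w - v) \<le> 9 / (4 * e) * norm (z - z')"
proof (cases "z = z'")
  case True
  then show ?thesis using that[of v] v by simp
next
  case False
  define k where "k = 4 * e"
  define \<delta> where "\<delta> = norm (z - z')"
  have k: "0 < k" "k < 1" using e by (auto simp: k_def)
  have \<delta>: "0 < \<delta>" using False by (simp add: \<delta>_def)
  obtain v0 where v0: "v0 \<in> feasible (2 * e) z'" "norm v0 \<le> norm z'" by (rule slater_point)
  \<comment> \<open>The mixture has violation at most \<open>2 * \<delta> - h * N\<close>, so
    \<open>h = 2 * \<delta> / N\<close> restores feasibility exactly; the summand
    \<open>2 * \<delta>\<close> in \<open>N\<close> also guarantees
    \<open>h \<le> 1\<close>.\<close>
  define N where "N = 2 * \<delta> + k / 2 * norm z'"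
  have N: "0 < N" using \<delta> k by (auto simp: N_def intro: add_pos_nonneg)
  define h where "h = 2 * \<delta> / N"
  have h: "0 \<le> h" "h \<le> 1" using \<delta> k N by (auto simp: h_def N_def divide_le_eq)
  have hN: "h * N = 2 * \<delta>" using N by (simp add: h_def)
  have nz: "norm z \<le> norm z' + \<delta>" using norm_triangle_ineq[of z' "z - z'"] by (simp add: \<delta>_def)
  define w where "w = v + h *\<^sub>R (v0 - v)"
  have "\<bar>w \<bullet> P s - z' \<bullet> s\<bar> \<le> k * norm z'" if s: "s \<in> S" for s
  proof -
    have "\<bar>z \<bullet> s - z' \<bullet> s\<bar> \<le> \<delta>"
      using Cauchy_Schwarz_ineq2[of "z - z'" s] S(3)[OF s] by (simp add: inner_diff_left \<delta>_def)
    moreover have "\<bar>v \<bullet> P s - z \<bullet> s\<bar> \<le> k * norm z" using v(1) s by (simp add: feasible_def k_def)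
    moreover have "k * norm z \<le> k * norm z' + \<delta>"
    proof -
      have "k * norm z \<le> k * (norm z' + \<delta>)" using nz k by (intro mult_left_mono) auto
      moreover have "k * \<delta> \<le> 1 * \<delta>" using k \<delta> by (intro mult_right_mono) auto
      ultimately show ?thesis by (simp add: algebra_simps)
    qed
    ultimately have 1: "\<bar>v \<bullet> P s - z' \<bullet> s\<bar> \<le> k * norm z' + 2 * \<delta>" by linarith
    have 2: "\<bar>v0 \<bullet> P s - z' \<bullet> s\<bar> \<le> k / 2 * norm z'" using v0(1) s by (simp add: feasible_def k_def)
    have "w \<bullet> P s - z' \<bullet> s = (1 - h) * (v \<bullet> P s - z' \<bullet> s) + h * (v0 \<bullet> P s - z' \<bullet> s)"
      by (simp add: w_def inner_add_left inner_diff_left algebra_simps)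
    also have "\<bar>\<dots>\<bar> \<le> (1 - h) * \<bar>v \<bullet> P s - z' \<bullet> s\<bar> + h * \<bar>v0 \<bullet> P s - z' \<bullet> s\<bar>"
      using h by (intro order.trans[OF abs_triangle_ineq]) (simp add: abs_mult)
    also have "\<dots> \<le> (1 - h) * (k * norm z' + 2 * \<delta>) + h * (k / 2 * norm z')"
      using h by (intro add_mono mult_left_mono 1 2) auto
    also have "\<dots> = k * norm z' + 2 * \<delta> - h * N" by (simp add: N_def algebra_simps)
    finally show ?thesis using hN by simp
  qed
  then have wf: "w \<in> feasible (4 * e) z'"
    using v v0 W.subspace_V
    by (auto simp: w_def feasible_def k_def intro!: subspace_add subspace_scale subspace_diff)
  have "norm (w - v) = h * norm (v0 - v)" using h by (simp add: w_def)
  also have "\<dots> \<le> h * (2 * norm z' + \<delta>)"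
    using norm_triangle_ineq4[of v0 v] v(2) v0(2) nz h by (intro mult_left_mono) auto
  also have "\<dots> = 2 * (h * norm z') + h * \<delta>" by (simp add: algebra_simps)
  also have "\<dots> \<le> 2 * (4 * \<delta> / k) + 1 * (\<delta> / k)"
  proof (intro add_mono mult_left_mono mult_mono)
    have "h * (k / 2 * norm z') \<le> h * N" using h \<delta> by (intro mult_left_mono) (auto simp: N_def)
    then show "h * norm z' \<le> 4 * \<delta> / k" using hN k by (simp add: field_simps)
    show "\<delta> \<le> \<delta> / k" using k \<delta> by (simp add: field_simps)
  qed (use h \<delta> in auto)
  also have "\<dots> = 9 / (4 * e) * norm (z - z')" by (simp add: k_def \<delta>_def)
  finally show ?thesis using that[OF wf] by blast
qed

lemma norm_outer_lipschitz: "\<bar>norm (outer z) - norm (outer z')\<bar> \<le> 9 / (4 * e) * norm (z - z')"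
proof -
  have "norm (outer z') \<le> norm (outer z) + 9 / (4 * e) * norm (z - z')" for z z'
  proof -
    obtain w where w: "w \<in> feasible (4 * e) z'" "norm (w - outer z) \<le> 9 / (4 * e) * norm (z - z')"
      by (rule feasible_perturb[OF outer_feasible outer_norm_le])
    have "norm (outer z') \<le> norm w" by (rule outer_min[OF w(1)])
    also have "\<dots> \<le> norm (outer z) + norm (w - outer z)" using norm_triangle_ineq[of "outer z" "w - outer z"] by simp
    finally show ?thesis using w(2) by simp
  qed
  from this[of z' z] this[of z z'] show ?thesis by (simp add: abs_le_iff norm_minus_commute)
qed

text \<open>Near \<open>outer z\<close> there is a vector feasible for \<open>z'\<close> whose norm
  is minimal up to a Lipschitz error. By \<open>outer_dist_le\<close> its squared distance to
  \<open>outer z'\<close> is of that order, and the square root costs half of the exponent.\<close>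

lemma outer_hoelder:
  defines "\<kappa> \<equiv> 9 / (4 * e)"
  shows "norm (outer z - outer z') \<le> \<kappa> * norm (z - z') + sqrt (4 * \<kappa> * norm (z - z') * (norm z' + \<kappa> * norm (z - z')))"
proof -
  let ?\<delta> = "norm (z - z')"
  have \<kappa>: "0 < \<kappa>" using e by (simp add: \<kappa>_def)
  obtain w where w: "w \<in> feasible (4 * e) z'" "norm (w - outer z) \<le> \<kappa> * ?\<delta>"
    unfolding \<kappa>_def by (rule feasible_perturb[OF outer_feasible outer_norm_le])
  have "norm w \<le> norm (outer z) + norm (w - outer z)" using norm_triangle_ineq[of "outer z" "w - outer z"] by simp
  also have "\<dots> \<le> norm (outer z') + 2 * \<kappa> * ?\<delta>"
    using w(2) norm_outer_lipschitz[of z z', folded \<kappa>_def] by linarith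
  finally have nw: "norm w \<le> norm (outer z') + 2 * \<kappa> * ?\<delta>" .
  have "(norm (w - outer z'))\<^sup>2 \<le> (norm w)\<^sup>2 - (norm (outer z'))\<^sup>2" by (rule outer_dist_le[OF w(1)])
  also have "\<dots> \<le> (norm (outer z') + 2 * \<kappa> * ?\<delta>)\<^sup>2 - (norm (outer z'))\<^sup>2"
    using nw by (intro diff_right_mono power_mono) auto
  also have "\<dots> = 4 * \<kappa> * ?\<delta> * (norm (outer z') + \<kappa> * ?\<delta>)" by (simp add: power2_eq_square algebra_simps)
  also have "\<dots> \<le> 4 * \<kappa> * ?\<delta> * (norm z' + \<kappa> * ?\<delta>)"
    using \<kappa> outer_norm_le[of z'] by (intro mult_left_mono) auto
  finally have "norm (w - outer z') \<le> sqrt (4 * \<kappa> * ?\<delta> * (norm z' + \<kappa> * ?\<delta>))" by (rule real_le_rsqrt)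
  moreover have "norm (outer z - outer z') \<le> norm (w - outer z) + norm (w - outer z')"
    using norm_triangle_ineq[of "outer z - w" "w - outer z'"] by (simp add: norm_minus_commute)
  ultimately show ?thesis using w(2) by linarith
qed

end

section \<open>The terminal embedding in an inner product space\<close>

lemma abs_sqrt_diff_le:
  assumes "0 \<le> a" "0 \<le> b"
  shows "\<bar>sqrt a - sqrt b\<bar> \<le> sqrt \<bar>a - b\<bar>"
proof -
  have "sqrt x \<le> sqrt y + sqrt (x - y)" if "0 \<le> y" "y \<le> x" for x y :: real
    using sqrt_add_le_add_sqrt[of y "x - y"] that by simp
  from this[of a b] this[of b a] show ?thesis
    using assms by (cases "a \<le> b") (auto simp: abs_real_def)
qed

text \<open>The first summand comes from the image of the projection, the next two from
  \<open>outer\<close>, the last from the extra coordinate. Only the distance to the set and the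
  accuracy enter.\<close>

definition hoelder_const :: "real \<Rightarrow> real \<Rightarrow> real" where
  "hoelder_const t e = (let \<kappa> = 9 / (4 * e) in
     4 + 3 * \<kappa> + sqrt (12 * \<kappa> * (t + 1 + 3 * \<kappa>)) + sqrt (6 * (1 + \<kappa>) * (t + 1)))"

locale outer_extension = near_isometry W P T S e + V: heine_borel_subspace V
  for W :: "'b::real_inner set" and P :: "'a::real_inner \<Rightarrow> 'b" and T S e and V :: "'a set" +
  fixes X :: "'a set"
  assumes X: "closed X" "X \<subseteq> V" "X \<noteq> {}"
    and secant: "\<And>x y. x \<in> X \<Longrightarrow> y \<in> X \<Longrightarrow> x \<noteq> y \<Longrightarrow> (1 / norm (x - y)) *\<^sub>R (x - y) \<in> S"
    and iso: "\<And>s. s \<in> S \<Longrightarrow> \<bar>(norm (P s))\<^sup>2 - 1\<bar> \<le> e / 2"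
begin

definition proj :: "'a \<Rightarrow> 'a" where
  "proj u = (SOME p. p \<in> X \<and> dist u p = infdist u X)"

lemma proj: "proj u \<in> X" "dist u (proj u) = infdist u X"
proof -
  have "\<exists>p. p \<in> X \<and> dist u p = infdist u X" using V.nearest_point_exists[OF X, of u] by metis
  from someI_ex[OF this, folded proj_def] show "proj u \<in> X" "dist u (proj u) = infdist u X" by auto
qed

lemma proj_self: "x \<in> X \<Longrightarrow> proj x = x"
  using proj(2)[of x] by simp

text \<open>The last coordinate fills up the norm: the part added to \<open>P (proj u)\<close> has
  total length exactly \<open>norm (u - proj u)\<close>, so only cross terms can distort distances
  to points of \<open>X\<close>.\<close>

definition emb :: "'a \<Rightarrow> 'b \<times> real" where
  "emb u = (P (proj u) + outer (u - proj u), sqrt ((norm (u - proj u))\<^sup>2 - (norm (outer (u - proj u)))\<^sup>2))"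

lemma outer_zero: "outer 0 = 0"
  using outer_norm_le[of 0] by simp

lemma fst_emb_in_W: "fst (emb u) \<in> W"
  using P(2) outer_feasible[of "u - proj u"]
  by (auto simp: emb_def feasible_def intro!: subspace_add[OF W.subspace_V])

lemma radicand_nonneg: "0 \<le> (norm z)\<^sup>2 - (norm (outer z))\<^sup>2"
  using outer_norm_le[of z] by (simp add: power_mono)

lemma P_secant:
  assumes "x \<in> X" "y \<in> X"
  shows "\<bar>(norm (P (x - y)))\<^sup>2 - (norm (x - y))\<^sup>2\<bar> \<le> e / 2 * (norm (x - y))\<^sup>2"
    and "\<bar>outer z \<bullet> P (x - y) - z \<bullet> (x - y)\<bar> \<le> 4 * e * norm z * norm (x - y)"
proof -
  have "\<bar>(norm (P (x - y)))\<^sup>2 - (norm (x - y))\<^sup>2\<bar> \<le> e / 2 * (norm (x - y))\<^sup>2 \<and>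
    \<bar>outer z \<bullet> P (x - y) - z \<bullet> (x - y)\<bar> \<le> 4 * e * norm z * norm (x - y)"
  proof (cases "x = y")
    case True
    then show ?thesis using e by (simp add: P.zero)
  next
    case False
    define n where "n = norm (x - y)"
    define s where "s = (1 / n) *\<^sub>R (x - y)"
    have n: "0 < n" using False by (simp add: n_def)
    have s: "s \<in> S" unfolding s_def n_def by (rule secant[OF assms False])
    have xy: "x - y = n *\<^sub>R s" using n by (simp add: s_def)
    have "\<bar>(norm (P s))\<^sup>2 - 1\<bar> * n\<^sup>2 \<le> e / 2 * n\<^sup>2" by (intro mult_right_mono iso s) auto
    then have "\<bar>(norm (P (n *\<^sub>R s)))\<^sup>2 - n\<^sup>2\<bar> \<le> e / 2 * n\<^sup>2"
    proof -
      have "(norm (P (n *\<^sub>R s)))\<^sup>2 - n\<^sup>2 = ((norm (P s))\<^sup>2 - 1) * n\<^sup>2"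
        by (simp add: P.scaleR power_mult_distrib algebra_simps)
      then show "\<bar>(norm (P s))\<^sup>2 - 1\<bar> * n\<^sup>2 \<le> e / 2 * n\<^sup>2 \<Longrightarrow> ?thesis" by (simp add: abs_mult)
    qed
    moreover have "\<bar>outer z \<bullet> P s - z \<bullet> s\<bar> * n \<le> 4 * e * norm z * n"
      using outer_feasible[of z] s n by (intro mult_right_mono) (auto simp: feasible_def)
    then have "\<bar>outer z \<bullet> P (n *\<^sub>R s) - z \<bullet> (n *\<^sub>R s)\<bar> \<le> 4 * e * norm z * n"
    proof -
      have "outer z \<bullet> P (n *\<^sub>R s) - z \<bullet> (n *\<^sub>R s) = (outer z \<bullet> P s - z \<bullet> s) * n"
        by (simp add: P.scaleR algebra_simps)
      then show "\<bar>outer z \<bullet> P s - z \<bullet> s\<bar> * n \<le> 4 * e * norm z * n \<Longrightarrow> ?thesis" using n by (simp add: abs_mult)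
    qed
    moreover have "norm (n *\<^sub>R s) = n" using n_def xy by simp
    ultimately show ?thesis unfolding xy by simp
  qed
  then show "\<bar>(norm (P (x - y)))\<^sup>2 - (norm (x - y))\<^sup>2\<bar> \<le> e / 2 * (norm (x - y))\<^sup>2"
    "\<bar>outer z \<bullet> P (x - y) - z \<bullet> (x - y)\<bar> \<le> 4 * e * norm z * norm (x - y)" by auto
qed

text \<open>Expanding both squares, the terms \<open>|z|^2\<close> cancel. What is left is the error
  of \<open>P\<close> on \<open>p - x\<close> and the constraint error of \<open>outer z\<close>;
  with \<open>|z| \<le> l\<close> and \<open>|p - x| \<le> 2 l\<close> they contribute
  \<open>2 e l^2\<close> and \<open>16 e l^2\<close>.\<close>

lemma emb_distortion_square:
  assumes x: "x \<in> X"
  shows "\<bar>(dist (emb x) (emb u))\<^sup>2 - (dist x u)\<^sup>2\<bar> \<le> 18 * e * (dist x u)\<^sup>2"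
proof -
  define p where "p = proj u"
  define z where "z = u - p"
  define l where "l = dist x u"
  have p: "p \<in> X" unfolding p_def by (rule proj)
  have z: "norm z \<le> l"
    using proj(2)[of u] infdist_le[OF x, of u] by (simp add: z_def p_def l_def dist_norm norm_minus_commute)
  have px: "norm (p - x) \<le> 2 * l"
    using norm_triangle_ineq[of "p - u" "u - x"] z by (simp add: z_def l_def dist_norm norm_minus_commute)
  have ex: "emb x = (P x, 0)" using proj_self[OF x] by (simp add: emb_def outer_zero)
  have eu: "emb u = (P p + outer z, sqrt ((norm z)\<^sup>2 - (norm (outer z))\<^sup>2))"
    by (simp add: emb_def p_def z_def)
  have "(dist (emb x) (emb u))\<^sup>2 = (norm (P (p - x) + outer z))\<^sup>2 + ((norm z)\<^sup>2 - (norm (outer z))\<^sup>2)"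
  proof -
    have "P x - (P p + outer z) = - (P (p - x) + outer z)" by (simp add: P.diff)
    then have "dist (P x) (P p + outer z) = norm (P (p - x) + outer z)" by (simp only: dist_norm norm_minus_cancel)
    then show ?thesis
      unfolding ex eu dist_Pair_Pair
      using radicand_nonneg[of z] by (simp add: dist_norm)
  qed
  also have "\<dots> = (norm (P (p - x)))\<^sup>2 + 2 * (outer z \<bullet> P (p - x)) + (norm z)\<^sup>2"
    unfolding power2_norm_eq_inner by (simp add: inner_add_left inner_add_right inner_commute)
  finally have 1: "(dist (emb x) (emb u))\<^sup>2 = (norm (P (p - x)))\<^sup>2 + 2 * (outer z \<bullet> P (p - x)) + (norm z)\<^sup>2" .
  have ld: "l = norm ((p - x) + z)" by (simp add: l_def dist_norm norm_minus_commute z_def)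
  have 2: "l\<^sup>2 = (norm (p - x))\<^sup>2 + 2 * (z \<bullet> (p - x)) + (norm z)\<^sup>2"
    unfolding ld power2_norm_eq_inner
    by (simp add: inner_add_left inner_add_right inner_commute)
  have "\<bar>(dist (emb x) (emb u))\<^sup>2 - l\<^sup>2\<bar> \<le> e / 2 * (norm (p - x))\<^sup>2 + 2 * (4 * e * norm z * norm (p - x))"
    using P_secant(1)[OF p x] P_secant(2)[OF p x, of z] unfolding 1 2 by linarith
  also have "\<dots> \<le> e / 2 * (2 * l)\<^sup>2 + 2 * (4 * e * l * (2 * l))"
    using e z px by (intro add_mono mult_left_mono mult_mono power_mono) (auto simp: l_def)
  also have "\<dots> = 18 * e * l\<^sup>2" by (simp add: power2_eq_square)
  finally show ?thesis by (simp add: l_def)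
qed

lemma emb_distortion:
  assumes x: "x \<in> X" and \<epsilon>: "18 * e \<le> \<epsilon>" "\<epsilon> < 1"
  shows "(1 - \<epsilon>) * dist x u \<le> dist (emb x) (emb u)" "dist (emb x) (emb u) \<le> (1 + \<epsilon>) * dist x u"
proof -
  let ?l = "dist x u" and ?f = "dist (emb x) (emb u)"
  have e0: "0 < \<epsilon>" using \<epsilon> e by simp
  have "18 * e * ?l\<^sup>2 \<le> \<epsilon> * ?l\<^sup>2" by (intro mult_right_mono \<epsilon>) auto
  then have b: "\<bar>?f\<^sup>2 - ?l\<^sup>2\<bar> \<le> \<epsilon> * ?l\<^sup>2" using emb_distortion_square[OF x, of u] by linarith
  have "(1 - \<epsilon>)\<^sup>2 \<le> 1 - \<epsilon>" using e0 \<epsilon>(2) by (simp add: power2_eq_square mult_left_le)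
  then have "((1 - \<epsilon>) * ?l)\<^sup>2 \<le> (1 - \<epsilon>) * ?l\<^sup>2"
    unfolding power_mult_distrib by (intro mult_right_mono) auto
  also have "\<dots> \<le> ?f\<^sup>2" using b by (simp add: algebra_simps)
  finally show "(1 - \<epsilon>) * ?l \<le> ?f" by (rule power2_le_imp_le) simp
  have "?f\<^sup>2 \<le> (1 + \<epsilon>) * ?l\<^sup>2" using b by (simp add: algebra_simps)
  also have "1 + \<epsilon> \<le> (1 + \<epsilon>)\<^sup>2" using e0 by (simp add: power2_eq_square algebra_simps)
  then have "(1 + \<epsilon>) * ?l\<^sup>2 \<le> ((1 + \<epsilon>) * ?l)\<^sup>2"
    unfolding power_mult_distrib by (intro mult_right_mono) auto
  finally show "?f \<le> (1 + \<epsilon>) * ?l" by (rule power2_le_imp_le) (use e0 in simp)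
qed

text \<open>The projection moves by at most twice the distance \<delta>, so \<open>z\<close> moves
  by at most \<open>3 * \<delta>\<close>. The radicand of the last coordinate is Lipschitz and its
  root loses half of the exponent, as \<open>outer\<close> does; since
  \<open>\<delta> \<le> 1\<close>, the Lipschitz terms are bounded by \<open>sqrt \<delta>\<close>
  too.\<close>

lemma emb_hoelder_half:
  assumes pq: "dist (proj v) (proj w) \<le> 2 * dist v w"
    and t: "infdist v X \<le> t + 1" "infdist w X \<le> t + 1" and d: "dist v w \<le> 1" and t0: "0 \<le> t"
  shows "dist (emb v) (emb w) \<le> hoelder_const t e * sqrt (dist v w)"
proof -
  define \<delta> where "\<delta> = dist v w"
  define \<kappa> where "\<kappa> = 9 / (4 * e)"
  define p where "p = proj v"
  define q where "q = proj w"
  define z where "z = v - p"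
  define z' where "z' = w - q"
  have \<kappa>: "0 < \<kappa>" using e by (simp add: \<kappa>_def)
  have \<delta>: "0 \<le> \<delta>" "\<delta> \<le> 1" using d by (auto simp: \<delta>_def)
  have \<delta>s: "\<delta> \<le> sqrt \<delta>" using \<delta> by (intro real_le_rsqrt) (simp add: power2_eq_square mult_left_le)
  have p: "p \<in> X" "q \<in> X" unfolding p_def q_def by (rule proj)+
  have pq': "norm (p - q) \<le> 2 * \<delta>" using pq by (simp add: p_def q_def \<delta>_def dist_norm)
  have nz: "norm z \<le> t + 1" "norm z' \<le> t + 1"
    using t proj(2)[of v] proj(2)[of w] by (auto simp: z_def z'_def p_def q_def dist_norm)
  have zz: "norm (z - z') \<le> 3 * \<delta>"
  proof -
    have "z - z' = (v - w) - (p - q)" by (simp add: z_def z'_def)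
    then have "norm (z - z') \<le> norm (v - w) + norm (p - q)" using norm_triangle_ineq4[of "v - w" "p - q"] by simp
    then show ?thesis using pq' by (simp add: \<delta>_def dist_norm)
  qed
  have Ppq: "norm (P (p - q)) \<le> 2 * norm (p - q)"
  proof (rule power2_le_imp_le)
    have "(norm (P (p - q)))\<^sup>2 \<le> (1 + e / 2) * (norm (p - q))\<^sup>2" using abs_le_D1[OF P_secant(1)[OF p]] by (simp add: algebra_simps)
    also have "\<dots> \<le> 4 * (norm (p - q))\<^sup>2" using e by (intro mult_right_mono) auto
    finally show "(norm (P (p - q)))\<^sup>2 \<le> (2 * norm (p - q))\<^sup>2" by (simp add: power_mult_distrib)
  qed simp
  have 1: "norm (P (p - q)) \<le> 4 * sqrt \<delta>" using Ppq pq' \<delta>s by linarith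
  have 2: "norm (outer z - outer z') \<le> 3 * \<kappa> * sqrt \<delta> + sqrt (12 * \<kappa> * (t + 1 + 3 * \<kappa>)) * sqrt \<delta>"
  proof -
    have "norm (outer z - outer z') \<le> \<kappa> * norm (z - z') + sqrt (4 * \<kappa> * norm (z - z') * (norm z' + \<kappa> * norm (z - z')))"
      unfolding \<kappa>_def by (rule outer_hoelder)
    also have "\<dots> \<le> \<kappa> * (3 * \<delta>) + sqrt (4 * \<kappa> * (3 * \<delta>) * ((t + 1) + \<kappa> * (3 * \<delta>)))"
      using \<kappa> \<delta> zz nz t0
      by (intro add_mono mult_left_mono mult_mono real_sqrt_le_mono mult_nonneg_nonneg add_nonneg_nonneg) auto
    also have "\<dots> \<le> \<kappa> * (3 * sqrt \<delta>) + sqrt (4 * \<kappa> * (3 * \<delta>) * ((t + 1) + \<kappa> * (3 * 1)))"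
      using \<kappa> \<delta> \<delta>s t0
      by (intro add_mono mult_left_mono mult_mono real_sqrt_le_mono mult_nonneg_nonneg add_nonneg_nonneg) auto
    also have "4 * \<kappa> * (3 * \<delta>) * ((t + 1) + \<kappa> * (3 * 1)) = (12 * \<kappa> * (t + 1 + 3 * \<kappa>)) * \<delta>" by (simp add: algebra_simps)
    finally show ?thesis
      unfolding real_sqrt_mult[of "12 * \<kappa> * (t + 1 + 3 * \<kappa>)" \<delta>] by (simp add: ac_simps)
  qed
  define a where "a z = (norm z)\<^sup>2 - (norm (outer z))\<^sup>2" for z
  have 3: "\<bar>sqrt (a z) - sqrt (a z')\<bar> \<le> sqrt (6 * (1 + \<kappa>) * (t + 1)) * sqrt \<delta>"
  proof -
    have sq: "\<bar>x\<^sup>2 - y\<^sup>2\<bar> \<le> \<bar>x - y\<bar> * (2 * (t + 1))" if "0 \<le> x" "0 \<le> y" "x \<le> t + 1" "y \<le> t + 1" for x y :: real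
    proof -
      have "\<bar>x\<^sup>2 - y\<^sup>2\<bar> = \<bar>x - y\<bar> * (x + y)" using that by (simp add: power2_eq_square square_diff_square_factored abs_mult)
      also have "\<dots> \<le> \<bar>x - y\<bar> * (2 * (t + 1))" using that by (intro mult_left_mono) auto
      finally show ?thesis .
    qed
    have "\<bar>norm z - norm z'\<bar> \<le> 3 * \<delta>" using norm_triangle_ineq3[of z z'] zz by linarith
    then have "\<bar>norm z - norm z'\<bar> * (2 * (t + 1)) \<le> 3 * \<delta> * (2 * (t + 1))" using t0 by (intro mult_right_mono) auto
    then have a1: "\<bar>(norm z)\<^sup>2 - (norm z')\<^sup>2\<bar> \<le> 3 * \<delta> * (2 * (t + 1))"
      using sq[of "norm z" "norm z'"] nz by auto
    have "\<bar>norm (outer z) - norm (outer z')\<bar> \<le> \<kappa> * norm (z - z')" unfolding \<kappa>_def by (rule norm_outer_lipschitz)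
    also have "\<dots> \<le> \<kappa> * (3 * \<delta>)" using zz \<kappa> by (intro mult_left_mono) auto
    finally have "\<bar>norm (outer z) - norm (outer z')\<bar> * (2 * (t + 1)) \<le> \<kappa> * (3 * \<delta>) * (2 * (t + 1))"
      using t0 by (intro mult_right_mono) auto
    then have a2: "\<bar>(norm (outer z))\<^sup>2 - (norm (outer z'))\<^sup>2\<bar> \<le> \<kappa> * (3 * \<delta>) * (2 * (t + 1))"
      using sq[of "norm (outer z)" "norm (outer z')"] nz outer_norm_le[of z] outer_norm_le[of z'] by auto
    have "\<bar>sqrt (a z) - sqrt (a z')\<bar> \<le> sqrt \<bar>a z - a z'\<bar>"
      unfolding a_def by (intro abs_sqrt_diff_le radicand_nonneg)
    also have "\<dots> \<le> sqrt ((6 * (1 + \<kappa>) * (t + 1)) * \<delta>)"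
    proof (rule real_sqrt_le_mono)
      have "\<bar>a z - a z'\<bar> \<le> 3 * \<delta> * (2 * (t + 1)) + \<kappa> * (3 * \<delta>) * (2 * (t + 1))"
        unfolding a_def using a1 a2 by linarith
      also have "\<dots> = (6 * (1 + \<kappa>) * (t + 1)) * \<delta>" by (simp add: algebra_simps)
      finally show "\<bar>a z - a z'\<bar> \<le> (6 * (1 + \<kappa>) * (t + 1)) * \<delta>" .
    qed
    finally show ?thesis by (simp add: real_sqrt_mult)
  qed
  have "dist (emb v) (emb w) \<le> norm (P (p - q) + (outer z - outer z')) + \<bar>sqrt (a z) - sqrt (a z')\<bar>"
  proof -
    have "emb v - emb w = (P (p - q) + (outer z - outer z'), sqrt (a z) - sqrt (a z'))"
      by (simp add: emb_def p_def q_def z_def z'_def a_def P.diff)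
    then show ?thesis
      using norm_Pair_le[of "P (p - q) + (outer z - outer z')" "sqrt (a z) - sqrt (a z')"] by (simp add: dist_norm)
  qed
  also have "\<dots> \<le> norm (P (p - q)) + norm (outer z - outer z') + \<bar>sqrt (a z) - sqrt (a z')\<bar>"
    by (intro add_right_mono norm_triangle_ineq)
  also have "\<dots> \<le> 4 * sqrt \<delta> + (3 * \<kappa> * sqrt \<delta> + sqrt (12 * \<kappa> * (t + 1 + 3 * \<kappa>)) * sqrt \<delta>) + sqrt (6 * (1 + \<kappa>) * (t + 1)) * sqrt \<delta>"
    using 1 2 3 by (intro add_mono)
  also have "\<dots> = hoelder_const t e * sqrt \<delta>"
    unfolding hoelder_const_def Let_def \<kappa>_def[symmetric] by (simp only: distrib_right add.assoc)
  finally show ?thesis by (simp add: \<delta>_def)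
qed

lemma emb_locally_hoelder:
  assumes \<sigma>: "\<And>x y z. x \<in> V \<Longrightarrow> infdist x X < \<sigma> \<Longrightarrow> y \<in> X \<Longrightarrow> z \<in> X \<Longrightarrow>
      dist x y = infdist x X \<Longrightarrow> dist x z = infdist x X \<Longrightarrow> y = z"
    and u: "2 * infdist u X < \<sigma>"
  shows "\<exists>r>0. \<forall>v\<in>V. \<forall>w\<in>V. dist v u < r \<longrightarrow> dist w u < r \<longrightarrow>
    dist (emb v) (emb w) \<le> hoelder_const (infdist u X) e * dist v w powr (1 / 4)"
proof -
  interpret R: positive_reach V X \<sigma> by unfold_locales (use X \<sigma> in auto)
  define t where "t = infdist u X"
  have t0: "0 \<le> t" by (simp add: t_def infdist_nonneg)
  \<comment> \<open>The midpoint between \<open>2 * t\<close> and \<sigma>: large enough that a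
    neighbourhood of \<open>u\<close> lies within \<open>s / 2\<close> of \<open>X\<close>, and
    still below \<sigma>.\<close>
  define s where "s = t + \<sigma> / 2"
  have s: "0 < s" "s < \<sigma>" "2 * t < s" using u t0 by (auto simp: s_def t_def[symmetric])
  \<comment> \<open>Radius 1/2 makes any two points of the ball at most 1 apart, so smaller
    exponents give larger powers; \<open>s / 2 - t\<close> keeps the ball where the projection is
    Lipschitz.\<close>
  define r where "r = min (1 / 2) (s / 2 - t)"
  have r: "0 < r" "r \<le> 1 / 2" "t + r \<le> s / 2" using s by (auto simp: r_def min_def)
  show ?thesis
  proof (intro exI[of _ r] conjI ballI impI r(1))
    fix v w assume v: "v \<in> V" "dist v u < r" and w: "w \<in> V" "dist w u < r"
    have iv: "infdist v X \<le> t + r" using infdist_triangle[of v X u] v by (simp add: t_def)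
    have iw: "infdist w X \<le> t + r" using infdist_triangle[of w X u] w by (simp add: t_def)
    have d: "dist v w \<le> 1" using dist_triangle2[of v w u] v w r by simp
    have "dist (proj v) (proj w) \<le> 2 * dist v w"
      by (rule R.nearest_point_lipschitz[OF v(1) proj _ w(1) proj _ s(1,2)]) (use iv iw r in auto)
    then have "dist (emb v) (emb w) \<le> hoelder_const t e * sqrt (dist v w)"
      by (rule emb_hoelder_half) (use iv iw r d t0 in auto)
    also have "\<dots> \<le> hoelder_const t e * dist v w powr (1 / 4)"
    proof (intro mult_left_mono)
      have "sqrt (dist v w) = dist v w powr (1 / 2)" by (simp add: powr_half_sqrt)
      also have "\<dots> \<le> dist v w powr (1 / 4)" using d by (intro powr_mono') auto
      finally show "sqrt (dist v w) \<le> dist v w powr (1 / 4)" .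
      show "0 \<le> hoelder_const t e" using t0 e by (simp add: hoelder_const_def Let_def add_nonneg_nonneg)
    qed
    finally show "dist (emb v) (emb w) \<le> hoelder_const (infdist u X) e * dist v w powr (1 / 4)" by (simp add: t_def)
  qed
qed

end

section \<open>Coordinates\<close>

text \<open>The dimension is a bound variable of the theorem, so no single Euclidean type class instance fits.
  Finitely supported sequences form one inner product space that contains every \<open>rvec d\<close>.\<close>

typedef fvec = "{x :: nat \<Rightarrow> real. finite {i. x i \<noteq> 0}}"
  morphisms coord Abs_fvec
  by (rule exI[of _ "\<lambda>_. 0"]) simp

setup_lifting type_definition_fvec

lemma fvec_eqI: "(\<And>i. coord x i = coord y i) \<Longrightarrow> x = y"
  by (metis coord_inject ext)

lemma finite_support: "finite {i. coord x i \<noteq> 0}"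
  using coord[of x] by simp

lemma finite_support_add:
  fixes x y :: "nat \<Rightarrow> real"
  assumes "finite {i. x i \<noteq> 0}" "finite {i. y i \<noteq> 0}"
  shows "finite {i. x i + y i \<noteq> 0}" "finite {i. x i - y i \<noteq> 0}"
  by (rule finite_subset[OF _ finite_UnI[OF assms]], force)+

instantiation fvec :: real_vector
begin

lift_definition zero_fvec :: fvec is "\<lambda>_. 0" by simp
lift_definition plus_fvec :: "fvec \<Rightarrow> fvec \<Rightarrow> fvec" is "\<lambda>x y i. x i + y i"
  by (rule finite_support_add)
lift_definition uminus_fvec :: "fvec \<Rightarrow> fvec" is "\<lambda>x i. - x i" by simp
lift_definition minus_fvec :: "fvec \<Rightarrow> fvec \<Rightarrow> fvec" is "\<lambda>x y i. x i - y i"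
  by (rule finite_support_add)
lift_definition scaleR_fvec :: "real \<Rightarrow> fvec \<Rightarrow> fvec" is "\<lambda>r x i. r * x i"
  by (rule finite_subset) auto

instance
  by standard (transfer; simp add: fun_eq_iff algebra_simps)+

end

lemma coord_simps [simp]:
  "coord 0 i = 0" "coord (x + y) i = coord x i + coord y i" "coord (- x) i = - coord x i"
  "coord (x - y) i = coord x i - coord y i" "coord (r *\<^sub>R x) i = r * coord x i"
  by (transfer; simp)+

lemma coord_sum: "coord (\<Sum>a\<in>A. f a) i = (\<Sum>a\<in>A. coord (f a) i)"
  by (induction A rule: infinite_finite_induct) auto

instantiation fvec :: real_inner
begin

definition inner_fvec :: "fvec \<Rightarrow> fvec \<Rightarrow> real" where
  "inner_fvec x y = (\<Sum>i | coord x i \<noteq> 0. coord x i * coord y i)"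

definition norm_fvec :: "fvec \<Rightarrow> real" where "norm_fvec x = sqrt (inner x x)"
definition sgn_fvec :: "fvec \<Rightarrow> fvec" where "sgn_fvec x = x /\<^sub>R norm x"
definition dist_fvec :: "fvec \<Rightarrow> fvec \<Rightarrow> real" where "dist_fvec x y = norm (x - y)"
definition uniformity_fvec :: "(fvec \<times> fvec) filter" where
  "uniformity_fvec = (INF e\<in>{0<..}. principal {(x, y). dist x y < e})"
definition open_fvec :: "fvec set \<Rightarrow> bool" where
  "open_fvec U \<longleftrightarrow> (\<forall>x\<in>U. eventually (\<lambda>(x', y). x' = x \<longrightarrow> y \<in> U) uniformity)"

lemma inner_fvec_eq:
  assumes "finite A" "\<And>i. i \<notin> A \<Longrightarrow> coord x i = 0 \<or> coord y i = 0"
  shows "inner x y = (\<Sum>i\<in>A. coord x i * coord y i)"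
  unfolding inner_fvec_def using assms finite_support[of x]
  by (intro sum.mono_neutral_cong) auto

instance
proof
  fix x y z :: fvec and r :: real
  show "inner x y = inner y x"
    by (subst (1 2) inner_fvec_eq[of "{i. coord x i \<noteq> 0}"]) (auto simp: finite_support mult.commute)
  show "inner (x + y) z = inner x z + inner y z"
    by (subst (1 2 3) inner_fvec_eq[of "{i. coord z i \<noteq> 0}"]) (auto simp: finite_support distrib_right sum.distrib)
  show "inner (r *\<^sub>R x) y = r * inner x y"
    by (subst (1 2) inner_fvec_eq[of "{i. coord y i \<noteq> 0}"]) (auto simp: finite_support sum_distrib_left mult.assoc)
  show "0 \<le> inner x x" unfolding inner_fvec_def by (intro sum_nonneg) auto
  show "inner x x = 0 \<longleftrightarrow> x = 0"
    unfolding inner_fvec_def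
    by (subst sum_nonneg_eq_0_iff) (auto simp: finite_support intro: fvec_eqI)
qed (simp_all add: norm_fvec_def sgn_fvec_def dist_fvec_def uniformity_fvec_def open_fvec_def)

end

definition fvec_space :: "nat \<Rightarrow> fvec set" where
  "fvec_space d = {x. \<forall>i\<ge>d. coord x i = 0}"

lemma inner_fvec_space: "x \<in> fvec_space d \<Longrightarrow> inner x y = (\<Sum>i<d. coord x i * coord y i)"
  by (rule inner_fvec_eq) (auto simp: fvec_space_def)

lemma norm_fvec_space: "x \<in> fvec_space d \<Longrightarrow> norm x = L2_set (coord x) {..<d}"
  unfolding norm_eq_sqrt_inner inner_fvec_space L2_set_def by (simp add: power2_eq_square)

lemma norm_fvec_eq_L2_set: "norm x = L2_set (coord x) {i. coord x i \<noteq> 0}"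
  unfolding norm_eq_sqrt_inner inner_fvec_def L2_set_def by (simp add: power2_eq_square)

lemma abs_coord_le_norm: "\<bar>coord x i\<bar> \<le> norm x"
proof (cases "coord x i = 0")
  case False
  then show ?thesis
    unfolding norm_fvec_eq_L2_set using member_le_L2_set[of "{i. coord x i \<noteq> 0}" i "\<lambda>i. \<bar>coord x i\<bar>"]
    by (simp add: finite_support L2_set_def)
qed simp

lemma bounded_linear_coord: "bounded_linear (\<lambda>x. coord x i)"
  by (rule bounded_linear_intro[where K = 1]) (auto simp: abs_coord_le_norm)

lemma fvec_space_coordI: "coord x \<in> rvec d \<Longrightarrow> x \<in> fvec_space d"
  by (simp add: rvec_def fvec_space_def)

lemma coord_in_rvec: "x \<in> fvec_space d \<Longrightarrow> coord x \<in> rvec d"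
  by (simp add: rvec_def fvec_space_def)

lemma coord_Abs: "x \<in> rvec d \<Longrightarrow> coord (Abs_fvec x) = x"
proof (rule Abs_fvec_inverse)
  assume "x \<in> rvec d"
  then have "{i. x i \<noteq> 0} \<subseteq> {..<d}" by (auto simp: rvec_def not_less[symmetric])
  then show "x \<in> {x. finite {i. x i \<noteq> 0}}" by (auto intro: finite_subset)
qed

lemma Abs_in_fvec_space: "x \<in> rvec d \<Longrightarrow> Abs_fvec x \<in> fvec_space d"
  by (rule fvec_space_coordI) (simp add: coord_Abs)

lemma subspace_fvec_space: "subspace (fvec_space d)"
  by (auto simp: subspace_def fvec_space_def)

lemma closed_fvec_space: "closed (fvec_space d)"
proof -
  have "fvec_space d = (\<Inter>i\<in>{d..}. {x. coord x i = 0})" by (auto simp: fvec_space_def)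
  moreover have "closed {x. coord x i = 0}" for i
    by (intro closed_Collect_eq continuous_intros bounded_linear.continuous_on[OF bounded_linear_coord])
  ultimately show ?thesis by auto
qed

definition unit_fvec :: "nat \<Rightarrow> fvec" where
  "unit_fvec i = Abs_fvec (\<lambda>j. if j = i then 1 else 0)"

lemma coord_unit_fvec: "coord (unit_fvec i) j = (if j = i then 1 else 0)"
  unfolding unit_fvec_def by (subst Abs_fvec_inverse) auto

text \<open>By induction: adding a coordinate presents the box as a continuous image of the smaller
  box times an interval.\<close>

lemma compact_fvec_box: "compact {x \<in> fvec_space d. \<forall>i. \<bar>coord x i\<bar> \<le> R}"
proof (induction d)
  case 0
  have "x = 0" if "x \<in> fvec_space 0" for x using that by (intro fvec_eqI) (simp add: fvec_space_def)
  then have "{x \<in> fvec_space 0. \<forall>i. \<bar>coord x i\<bar> \<le> R} \<subseteq> {0}" by auto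
  then show ?case by (meson finite.emptyI finite_imp_compact finite_insert finite_subset)
next
  case (Suc d)
  let ?B = "\<lambda>d. {x \<in> fvec_space d. \<forall>i. \<bar>coord x i\<bar> \<le> R}"
  let ?f = "\<lambda>x. fst x + snd x *\<^sub>R unit_fvec d"
  have "?B (Suc d) = ?f ` (?B d \<times> {- R..R})"
  proof (intro set_eqI iffI)
    fix x assume x: "x \<in> ?B (Suc d)"
    have "x = ?f (x - coord x d *\<^sub>R unit_fvec d, coord x d)" by simp
    moreover have "(x - coord x d *\<^sub>R unit_fvec d, coord x d) \<in> ?B d \<times> {- R..R}"
    proof -
      have R: "0 \<le> R" using x by (metis (mono_tags, lifting) abs_ge_zero mem_Collect_eq order_trans)
      have "coord (x - coord x d *\<^sub>R unit_fvec d) i = 0" if "d \<le> i" for i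
        using x that by (cases "i = d") (auto simp: fvec_space_def coord_unit_fvec)
      then have "x - coord x d *\<^sub>R unit_fvec d \<in> fvec_space d" unfolding fvec_space_def by blast
      moreover have "\<bar>coord (x - coord x d *\<^sub>R unit_fvec d) i\<bar> \<le> R" for i
        using x R by (cases "i = d") (auto simp: coord_unit_fvec)
      moreover have "\<bar>coord x d\<bar> \<le> R" using x by simp
      then have "- R \<le> coord x d" "coord x d \<le> R" by linarith+
      ultimately show ?thesis by simp
    qed
    ultimately show "x \<in> ?f ` (?B d \<times> {- R..R})" by (rule image_eqI)
  next
    fix x assume "x \<in> ?f ` (?B d \<times> {- R..R})"
    then obtain y c where y: "x = y + c *\<^sub>R unit_fvec d" "y \<in> ?B d" "- R \<le> c" "c \<le> R" by auto
    have "coord y d = 0" using y(2) by (simp add: fvec_space_def)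
    then show "x \<in> ?B (Suc d)" using y by (auto simp: fvec_space_def coord_unit_fvec)
  qed
  moreover have "continuous_on (?B d \<times> {- R..R}) ?f" by (intro continuous_intros)
  ultimately show ?case using Suc by (simp add: compact_continuous_image compact_Times)
qed

interpretation fvec_space: heine_borel_subspace "fvec_space d" for d
proof
  fix S assume S: "S \<subseteq> fvec_space d" "closed S" "bounded S"
  then obtain R where R: "\<And>x. x \<in> S \<Longrightarrow> norm x \<le> R" by (auto simp: bounded_iff)
  have "S \<subseteq> {x \<in> fvec_space d. \<forall>i. \<bar>coord x i\<bar> \<le> R}"
    using S(1) order.trans[OF abs_coord_le_norm R] by auto
  then have eq: "{x \<in> fvec_space d. \<forall>i. \<bar>coord x i\<bar> \<le> R} \<inter> S = S" by (rule Int_absorb1)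
  have "compact ({x \<in> fvec_space d. \<forall>i. \<bar>coord x i\<bar> \<le> R} \<inter> S)"
    by (rule compact_Int_closed[OF compact_fvec_box S(2)])
  then show "compact S" unfolding eq .
qed (rule subspace_fvec_space closed_fvec_space)+

section \<open>Distances, closures and infima in both representations\<close>

lemma edist_fvec:
  assumes "x \<in> rvec d" "y \<in> rvec d"
  shows "edist d x y = dist (Abs_fvec x) (Abs_fvec y)"
proof -
  have "Abs_fvec x - Abs_fvec y \<in> fvec_space d"
    using assms by (intro subspace_diff subspace_fvec_space Abs_in_fvec_space)
  then show ?thesis
    using assms by (simp add: edist_def enorm_def dist_norm norm_fvec_space L2_set_def coord_Abs)
qed

lemma closure_subset_fvec_space: "Y \<subseteq> fvec_space d \<Longrightarrow> closure Y \<subseteq> fvec_space d"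
  by (rule closure_minimal[OF _ closed_fvec_space])

lemma eclosure_fvec:
  assumes X: "X \<subseteq> rvec d"
  shows "eclosure d X = coord ` closure (Abs_fvec ` X)"
proof (intro set_eqI iffI)
  fix y assume y: "y \<in> eclosure d X"
  then have yd: "y \<in> rvec d" by (simp add: eclosure_def)
  have "Abs_fvec y \<in> closure (Abs_fvec ` X)"
    unfolding closure_approachable
  proof (intro allI impI)
    fix e :: real assume "0 < e"
    then obtain z where z: "z \<in> X" "edist d y z < e" using y by (auto simp: eclosure_def)
    then have "dist (Abs_fvec z) (Abs_fvec y) < e"
      using edist_fvec[OF yd, of z] X by (auto simp: dist_commute)
    then show "\<exists>w\<in>Abs_fvec ` X. dist w (Abs_fvec y) < e" using z(1) by blast
  qed
  then show "y \<in> coord ` closure (Abs_fvec ` X)" using coord_Abs[OF yd] by (metis imageI)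
next
  fix y assume "y \<in> coord ` closure (Abs_fvec ` X)"
  then obtain x where x: "x \<in> closure (Abs_fvec ` X)" "y = coord x" by auto
  have "Abs_fvec ` X \<subseteq> fvec_space d" using X Abs_in_fvec_space by auto
  then have "x \<in> fvec_space d" using x(1) closure_subset_fvec_space by blast
  then have yd: "y \<in> rvec d" using x(2) by (simp add: coord_in_rvec)
  show "y \<in> eclosure d X"
    unfolding eclosure_def
  proof (intro CollectI conjI allI impI yd)
    fix e :: real assume "0 < e"
    then obtain w where "w \<in> Abs_fvec ` X" "dist w x < e" using x(1) unfolding closure_approachable by blast
    then obtain z where z: "z \<in> X" "dist x (Abs_fvec z) < e" by (auto simp: dist_commute)
    then have "edist d y z < e" using edist_fvec[OF yd, of z] X x(2) by (auto simp: coord_inverse)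
    then show "\<exists>z\<in>X. edist d y z < e" using z(1) by blast
  qed
qed

lemma pt_set_dist_fvec:
  assumes X: "X \<subseteq> rvec d" "X \<noteq> {}" and u: "u \<in> rvec d"
  shows "pt_set_dist d u X = ereal (infdist (Abs_fvec u) (Abs_fvec ` X))"
proof -
  have bdd: "bdd_below ((\<lambda>y. dist (Abs_fvec u) (Abs_fvec y)) ` X)" by (intro bdd_belowI[of _ 0]) auto
  have "pt_set_dist d u X = (INF y\<in>X. ereal (dist (Abs_fvec u) (Abs_fvec y)))"
    unfolding pt_set_dist_def using X u by (intro INF_cong refl) (auto simp: edist_fvec)
  also have "\<dots> = Inf (ereal ` (\<lambda>y. dist (Abs_fvec u) (Abs_fvec y)) ` X)" by (simp add: image_image)
  also have "\<dots> = ereal (INF y\<in>X. dist (Abs_fvec u) (Abs_fvec y))"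
    using X bdd by (intro ereal_Inf'[symmetric]) auto
  also have "(INF y\<in>X. dist (Abs_fvec u) (Abs_fvec y)) = infdist (Abs_fvec u) (Abs_fvec ` X)"
    using X by (simp add: infdist_notempty image_image)
  finally show ?thesis .
qed

lemma infdist_closure: "infdist x (closure A) = infdist x A"
proof (cases "A = {}")
  case False
  have "infdist x A \<le> dist x y" if "y \<in> closure A" for y
    using infdist_triangle[of x A y] in_closure_iff_infdist_zero[OF False, of y] that by simp
  then have "infdist x A \<le> infdist x (closure A)"
    using False by (auto simp: infdist_notempty[of "closure A"] intro!: cINF_greatest)
  moreover have "infdist x (closure A) \<le> infdist x A"
    using False closure_subset by (intro infdist_mono)
  ultimately show ?thesis by simp
qed simp

section \<open>Gaussian width and near-isometries\<close>

text \<open>Finite nets of radius \<open>1 / Suc n\<close>, accumulated so that they increase;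
  monotonicity is what makes the good events for the random matrix nested.\<close>

lemma compact_dense_sequence:
  fixes K :: "'a::metric_space set"
  assumes K: "compact K"
  obtains N where "incseq N" "\<And>n. finite (N n)" "\<And>n. N n \<subseteq> K" "K \<subseteq> closure (\<Union>n. N n)"
proof -
  have "\<exists>k. finite k \<and> k \<subseteq> K \<and> K \<subseteq> (\<Union>x\<in>k. ball x (1 / Suc n))" for n :: nat
  proof -
    obtain k where "k \<subseteq> K" "finite k" "K \<subseteq> (\<Union>x\<in>k. ball x (1 / Suc n))"
      by (rule compactE_image[OF K, of K "\<lambda>x. ball x (1 / Suc n)"]) auto
    then show ?thesis by blast
  qed
  then obtain k where k: "\<And>n::nat. finite (k n)" "\<And>n. k n \<subseteq> K" "\<And>n. K \<subseteq> (\<Union>x\<in>k n. ball x (1 / Suc n))" by metis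
  define N where "N n = (\<Union>j\<le>n. k j)" for n
  show ?thesis
  proof (rule that[of N])
    show "incseq N" by (force simp: N_def incseq_def)
    show "finite (N n)" "N n \<subseteq> K" for n using k(1,2) by (auto simp: N_def)
    show "K \<subseteq> closure (\<Union>n. N n)"
    proof
      fix x assume x: "x \<in> K"
      have "\<exists>y\<in>\<Union>n. N n. dist y x < e" if e: "0 < e" for e :: real
      proof -
        obtain n :: nat where n: "1 / Suc n < e" using nat_approx_posE[OF e] by metis
        obtain y where y: "y \<in> k n" "dist y x < 1 / Suc n" using k(3)[of n] x by (auto simp: mem_ball)
        have "y \<in> N n" using y(1) by (auto simp: N_def)
        then show ?thesis using y(2) n by force
      qed
      then show "x \<in> closure (\<Union>n. N n)" unfolding closure_approachable by blast
    qed
  qed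
qed

definition unit_secants :: "fvec set \<Rightarrow> fvec set" where
  "unit_secants Y = {(1 / norm (x - y)) *\<^sub>R (x - y) | x y. x \<in> Y \<and> y \<in> Y \<and> x \<noteq> y}"

lemma Abs_fvec_inj: "x \<in> rvec d \<Longrightarrow> y \<in> rvec d \<Longrightarrow> Abs_fvec x = Abs_fvec y \<longleftrightarrow> x = y"
  using coord_Abs by metis

lemma secants_fvec:
  assumes X: "X \<subseteq> rvec d"
  shows "secants d X = coord ` closure (unit_secants (Abs_fvec ` X))"
proof -
  define A where "A = {(\<lambda>i. (x i - y i) / edist d x y) | x y. x \<in> X \<and> y \<in> X \<and> x \<noteq> y}"
  have Ad: "A \<subseteq> rvec d"
  proof
    fix z assume "z \<in> A"
    then obtain x y where z: "z = (\<lambda>i. (x i - y i) / edist d x y)" "x \<in> X" "y \<in> X" by (auto simp: A_def)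
    then have "x \<in> rvec d" "y \<in> rvec d" using X by auto
    then show "z \<in> rvec d" unfolding z(1) by (simp add: rvec_def)
  qed
  have "Abs_fvec (\<lambda>i. (x i - y i) / edist d x y)
      = (1 / norm (Abs_fvec x - Abs_fvec y)) *\<^sub>R (Abs_fvec x - Abs_fvec y)" if "x \<in> X" "y \<in> X" for x y
  proof -
    have r: "x \<in> rvec d" "y \<in> rvec d" using X that by auto
    have "(\<lambda>i. (x i - y i) / edist d x y) \<in> rvec d" using r by (simp add: rvec_def)
    then show ?thesis
      using r by (intro fvec_eqI) (simp add: coord_Abs edist_fvec dist_norm)
  qed
  then have "Abs_fvec ` A = unit_secants (Abs_fvec ` X)"
    unfolding A_def unit_secants_def using X
    by (auto simp: image_iff Abs_fvec_inj[of _ d] subset_iff) (metis Abs_fvec_inj)+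
  then show ?thesis
    unfolding secants_def A_def[symmetric] eclosure_fvec[OF Ad] by simp
qed

section \<open>Suprema of Gaussian linear forms over compact sets\<close>

lemma abs_linform_le:
  assumes "norm x \<le> 1"
  shows "\<bar>\<Sum>i<d. g i * coord x i\<bar> \<le> (\<Sum>i<d. \<bar>g i\<bar>)"
proof -
  have "\<bar>coord x i\<bar> \<le> 1" for i using abs_coord_le_norm[of x i] assms by simp
  then have "\<bar>g i * coord x i\<bar> \<le> \<bar>g i\<bar> * 1" for i
    unfolding abs_mult by (intro mult_left_mono) auto
  then show ?thesis by (intro order.trans[OF sum_abs] sum_mono) simp
qed

lemma bdd_above_linform:
  assumes "\<And>s. s \<in> S \<Longrightarrow> norm s \<le> 1"
  shows "bdd_above ((\<lambda>s. \<Sum>i<d. g i * coord s i) ` S)"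
  using abs_linform_le[OF assms] by (intro bdd_aboveI2[where M = "\<Sum>i<d. \<bar>g i\<bar>"]) (auto simp: abs_le_iff)

lemma continuous_linform: "continuous_on A (\<lambda>s. \<Sum>i<d. g i * coord s i)"
  by (intro continuous_intros bounded_linear.continuous_on[OF bounded_linear_coord])

text \<open>Linear forms are continuous, so the supremum may be taken over a countable dense subset,
  which yields measurability; the sum of the \<open>\<bar>g i\<bar>\<close> dominates it.\<close>

lemma integrable_sup_linform:
  assumes S: "compact S" "S \<noteq> {}" "\<And>s. s \<in> S \<Longrightarrow> norm s \<le> 1"
  shows "integrable (gaussian {..<d}) (\<lambda>g. SUP s\<in>S. \<Sum>i<d. g i * coord s i)"
proof -
  obtain N where N: "incseq N" "\<And>n. finite (N n)" "\<And>n. N n \<subseteq> S" "S \<subseteq> closure (\<Union>n. N n)"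
    using compact_dense_sequence[OF S(1)] by metis
  define D where "D = (\<Union>n. N n)"
  have "countable D" unfolding D_def by (rule countable_UN) (auto intro: countable_finite N(2))
  then have D: "countable D" "D \<subseteq> S" "S \<subseteq> closure D" using N(3,4) by (auto simp: D_def)
  have D0: "D \<noteq> {}" using D(3) S(2) by auto
  have eq: "(SUP s\<in>S. \<Sum>i<d. g i * coord s i) = (SUP s\<in>D. \<Sum>i<d. g i * coord s i)" for g
  proof (rule antisym)
    let ?M = "SUP s\<in>D. \<Sum>i<d. g i * coord s i"
    have "closed {s. (\<Sum>i<d. g i * coord s i) \<le> ?M}" by (intro closed_Collect_le continuous_linform continuous_intros)
    moreover have "D \<subseteq> {s. (\<Sum>i<d. g i * coord s i) \<le> ?M}"
      using D S(3) by (auto intro!: cSUP_upper bdd_above_linform)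
    ultimately have "closure D \<subseteq> {s. (\<Sum>i<d. g i * coord s i) \<le> ?M}" by (intro closure_minimal)
    then show "(SUP s\<in>S. \<Sum>i<d. g i * coord s i) \<le> ?M"
      using D S(2) by (intro cSUP_least) auto
    show "?M \<le> (SUP s\<in>S. \<Sum>i<d. g i * coord s i)"
      by (rule cSUP_subset_mono[OF D0 bdd_above_linform[OF S(3)] D(2)]) auto
  qed
  show ?thesis
  proof (rule Bochner_Integration.integrable_bound)
    show "integrable (gaussian {..<d}) (\<lambda>g. \<Sum>i<d. \<bar>g i\<bar>)"
      by (intro Bochner_Integration.integrable_sum integrable_abs integrable_gaussian_id)
    show "(\<lambda>g. SUP s\<in>S. \<Sum>i<d. g i * coord s i) \<in> borel_measurable (gaussian {..<d})"
      unfolding eq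
    proof (rule borel_measurable_cSUP[OF D(1)])
      show "(\<lambda>g. \<Sum>i<d. g i * coord s i) \<in> borel_measurable (gaussian {..<d})" for s by measurable
      show "bdd_above ((\<lambda>s. \<Sum>i<d. g i * coord s i) ` D)" for g
        using D S(3) by (intro bdd_above_linform) auto
    qed
    show "AE g in gaussian {..<d}. norm (SUP s\<in>S. \<Sum>i<d. g i * coord s i) \<le> norm (\<Sum>i<d. \<bar>g i\<bar>)"
    proof (intro AE_I2)
      fix g :: "nat \<Rightarrow> real"
      obtain s where s: "s \<in> S" using S(2) by auto
      have "(SUP s\<in>S. \<Sum>i<d. g i * coord s i) \<le> (\<Sum>i<d. \<bar>g i\<bar>)"
        using abs_linform_le[OF S(3)] S(2) by (intro cSUP_least) (auto simp: abs_le_iff)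
      moreover have "(\<Sum>i<d. g i * coord s i) \<le> (SUP s\<in>S. \<Sum>i<d. g i * coord s i)"
        by (rule cSUP_upper[OF s bdd_above_linform[OF S(3)]])
      then have "- (\<Sum>i<d. \<bar>g i\<bar>) \<le> (SUP s\<in>S. \<Sum>i<d. g i * coord s i)"
        using abs_linform_le[OF S(3)[OF s], of g d] by linarith
      ultimately show "norm (SUP s\<in>S. \<Sum>i<d. g i * coord s i) \<le> norm (\<Sum>i<d. \<bar>g i\<bar>)"
        unfolding real_norm_def by linarith
    qed
  qed
qed

text \<open>The points satisfying the bound form a closed half-space containing \<open>S\<close>,
  hence containing its closed convex hull.\<close>

lemma linform_le_sup:
  assumes S: "\<And>s. s \<in> S \<Longrightarrow> norm s \<le> 1" and t: "t \<in> closure (convex hull S)"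
  shows "(\<Sum>i<d. coord t i * g i) \<le> (SUP s\<in>S. \<Sum>i<d. g i * coord s i)"
proof -
  let ?M = "SUP s\<in>S. \<Sum>i<d. g i * coord s i"
  define H where "H = {t. (\<Sum>i<d. g i * coord t i) \<le> ?M}"
  have "S \<subseteq> H" unfolding H_def using S by (auto intro!: cSUP_upper bdd_above_linform)
  moreover have "convex H"
  proof (rule convexI)
    fix x y and u v :: real assume xy: "x \<in> H" "y \<in> H" and uv: "0 \<le> u" "0 \<le> v" "u + v = 1"
    have "(\<Sum>i<d. g i * coord (u *\<^sub>R x + v *\<^sub>R y) i) = u * (\<Sum>i<d. g i * coord x i) + v * (\<Sum>i<d. g i * coord y i)"
      by (simp add: sum_distrib_left sum.distrib[symmetric] algebra_simps)
    also have "\<dots> \<le> u * ?M + v * ?M" using xy uv by (intro add_mono mult_left_mono) (auto simp: H_def)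
    also have "\<dots> = ?M" using uv by (simp add: distrib_right[symmetric])
    finally show "u *\<^sub>R x + v *\<^sub>R y \<in> H" by (simp add: H_def)
  qed
  moreover have "closed H" unfolding H_def by (intro closed_Collect_le continuous_linform continuous_intros)
  ultimately have "closure (convex hull S) \<subseteq> H" by (intro closure_minimal hull_minimal) auto
  then show ?thesis using t by (auto simp: H_def mult.commute)
qed

lemma expected_max_le_sup:
  assumes S: "compact S" "S \<noteq> {}" "\<And>s. s \<in> S \<Longrightarrow> norm s \<le> 1"
    and T: "finite T" "T \<noteq> {}" "T \<subseteq> closure (convex hull S)"
  shows "expected_max {..<d} (coord ` T) (\<lambda>t. t)
    \<le> (\<integral>g. (SUP s\<in>S. \<Sum>i<d. g i * coord s i) \<partial>gaussian {..<d})"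
  unfolding expected_max_def
proof (intro integral_mono integrable_Max_linform integrable_sup_linform S)
  fix g
  show "Max ((\<lambda>t. \<Sum>k<d. t k * g k) ` coord ` T) \<le> (SUP s\<in>S. \<Sum>i<d. g i * coord s i)"
    using T linform_le_sup[OF S(3)] by (intro Max.boundedI) (auto simp: subset_iff)
qed (use T in auto)

text \<open>A lower bound free of the dimension, from a single pair of opposite unit vectors; it
  keeps the target dimension positive and makes rounding harmless.\<close>

lemma sup_width_ge:
  assumes S: "compact S" "S \<subseteq> fvec_space d" "\<And>s. s \<in> S \<Longrightarrow> norm s = 1" "s \<in> S" "- s \<in> S"
  shows "1 / 2 \<le> (\<integral>g. (SUP s\<in>S. \<Sum>i<d. g i * coord s i) \<partial>gaussian {..<d})"
proof -
  have "(L2_set (coord s) {..<d})\<^sup>2 = 1" using norm_fvec_space[of s d] S by auto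
  then have "(\<Sum>k<d. (coord s k)\<^sup>2) = 1" by (simp add: L2_set_power2)
  then have "1 / 2 \<le> expected_max {..<d} UNIV (\<lambda>b k. if b then coord s k else - coord s k)"
    by (rule expected_max_symmetric_pair_ge)
  also have "\<dots> \<le> (\<integral>g. (SUP s\<in>S. \<Sum>i<d. g i * coord s i) \<partial>gaussian {..<d})"
    unfolding expected_max_def
  proof (intro integral_mono integrable_Max_linform integrable_sup_linform S)
    fix g
    have n1: "norm s \<le> 1" if "s \<in> S" for s using S(3)[OF that] by simp
    have "S \<subseteq> closure (convex hull S)" using hull_subset closure_subset by (metis subset_trans)
    then have "(\<Sum>k<d. coord s k * g k) \<le> (SUP s\<in>S. \<Sum>i<d. g i * coord s i)"
      "(\<Sum>k<d. coord (- s) k * g k) \<le> (SUP s\<in>S. \<Sum>i<d. g i * coord s i)"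
      using linform_le_sup[where S = S and d = d and g = g, OF n1] S(4,5) by blast+
    then have "(\<Sum>k<d. (if b then coord s k else - coord s k) * g k) \<le> (SUP s\<in>S. \<Sum>i<d. g i * coord s i)" for b
      by (cases b) simp_all
    then show "Max ((\<lambda>b. \<Sum>k<d. (if b then coord s k else - coord s k) * g k) ` UNIV)
        \<le> (SUP s\<in>S. \<Sum>i<d. g i * coord s i)"
      by (intro Max.boundedI) auto
  qed (use S in auto)
  finally show ?thesis .
qed

section \<open>The normalised Gaussian matrix as a linear map\<close>

definition mat_map :: "nat \<Rightarrow> nat \<Rightarrow> (nat \<times> nat \<Rightarrow> real) \<Rightarrow> fvec \<Rightarrow> fvec" where
  "mat_map m d A x = (\<Sum>i<m. (\<Sum>k<d. A (i, k) / sqrt m * coord x k) *\<^sub>R unit_fvec i)"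

lemma coord_mat_map:
  "coord (mat_map m d A x) i = (if i < m then row_product d A (coord x) i / sqrt m else 0)"
proof -
  have "coord (mat_map m d A x) i = (\<Sum>j<m. if j = i then (\<Sum>k<d. A (j, k) / sqrt m * coord x k) else 0)"
    unfolding mat_map_def coord_sum by (intro sum.cong refl) (simp add: coord_unit_fvec)
  also have "\<dots> = (if i < m then row_product d A (coord x) i / sqrt m else 0)"
    by (simp add: row_product_def sum_divide_distrib)
  finally show ?thesis .
qed

lemma mat_map_in_space: "mat_map m d A x \<in> fvec_space m"
  by (simp add: fvec_space_def coord_mat_map)

lemma norm_mat_map: "0 < m \<Longrightarrow> (norm (mat_map m d A x))\<^sup>2 = (\<Sum>i<m. (row_product d A (coord x) i)\<^sup>2) / m"
  unfolding norm_fvec_space[OF mat_map_in_space] L2_set_power2 sum_divide_distrib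
  by (intro sum.cong refl) (simp add: coord_mat_map power_divide)

lemma bounded_linear_mat_map: "bounded_linear (mat_map m d A)"
  unfolding mat_map_def
  by (intro bounded_linear_sum bounded_linear_compose[OF bounded_linear_scaleR_left]
      bounded_linear_compose[OF bounded_linear_mult_right] bounded_linear_coord)

text \<open>The inequality holds for one matrix on all finite nets at once, and as a closed
  condition it passes to the closure of their union, which contains \<open>T\<close>.\<close>

lemma exists_mat_map_near_isometry:
  assumes S: "compact S" "S \<subseteq> fvec_space d" "\<And>s. s \<in> S \<Longrightarrow> norm s = 1" "s0 \<in> S" "- s0 \<in> S"
    and e: "0 < e" and m: "0 < m"
    and W: "300 * (\<integral>g. (SUP s\<in>S. \<Sum>i<d. g i * coord s i) \<partial>gaussian {..<d}) \<le> e * sqrt m"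
    and T: "compact T" "T = closure (convex hull S)" "T \<subseteq> fvec_space d"
  obtains A where "\<And>t. t \<in> T \<Longrightarrow> \<bar>(norm (mat_map m d A t))\<^sup>2 - (norm t)\<^sup>2\<bar> \<le> e / 4 * (norm t + e)"
proof -
  obtain N where N: "incseq N" "\<And>n. finite (N n)" "\<And>n. N n \<subseteq> T" "T \<subseteq> closure (\<Union>n. N n)"
    using compact_dense_sequence[OF T(1)] by metis
  \<comment> \<open>The origin is the midpoint of two opposite secants. It is added to every net
    because the bounds for absolute values rely on a zero form.\<close>
  have zT: "0 \<in> T"
  proof -
    have "(1 / 2) *\<^sub>R s0 + (1 / 2) *\<^sub>R (- s0) \<in> convex hull S"
      using S(4,5) by (intro convexD convex_convex_hull hull_inc) auto
    then show ?thesis using closure_subset[of "convex hull S"] unfolding T(2) by auto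
  qed
  define M where "M n = insert 0 (N n)" for n
  have M: "incseq M" "\<And>n. finite (M n)" "\<And>n. M n \<subseteq> T"
    using N zT by (auto simp: M_def incseq_def)
  have z: "coord 0 = (\<lambda>_. 0)" by (simp add: fun_eq_iff)
  have "\<exists>A. \<forall>n. \<forall>t\<in>coord ` M n. \<bar>(\<Sum>i<m. (row_product d A t i)\<^sup>2) - m * (\<Sum>k<d. (t k)\<^sup>2)\<bar>
      \<le> m * e / 4 * (L2_set t {..<d} + e)"
  proof (rule exists_matrix_quad_dev_le[OF _ _ _ e m])
    show "finite (coord ` M n)" for n using M by auto
    show "(\<lambda>_. 0) \<in> coord ` M n" for n unfolding z[symmetric] by (auto simp: M_def)
    show "incseq (\<lambda>n. coord ` M n)" using M(1) by (auto simp: incseq_def intro!: image_mono)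
    show "300 * expected_max {..<d} (coord ` M n) (\<lambda>t. t) \<le> e * sqrt m" for n
    proof -
      have "expected_max {..<d} (coord ` M n) (\<lambda>t. t) \<le> (\<integral>g. (SUP s\<in>S. \<Sum>i<d. g i * coord s i) \<partial>gaussian {..<d})"
        by (rule expected_max_le_sup[OF S(1)]) (use S M T(2) in \<open>auto simp: M_def\<close>)
      then show ?thesis using W by linarith
    qed
  qed
  then obtain A where A: "\<And>n t. t \<in> M n \<Longrightarrow> \<bar>(\<Sum>i<m. (row_product d A (coord t) i)\<^sup>2) - m * (\<Sum>k<d. (coord t k)\<^sup>2)\<bar>
      \<le> m * e / 4 * (L2_set (coord t) {..<d} + e)" by blast
  let ?P = "mat_map m d A"
  have key: "\<bar>(norm (?P t))\<^sup>2 - (norm t)\<^sup>2\<bar> \<le> e / 4 * (norm t + e)" if t: "t \<in> M n" for t n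
  proof -
    have td: "t \<in> fvec_space d" using t M(3) T(3) by auto
    have "\<bar>m * (norm (?P t))\<^sup>2 - m * (norm t)\<^sup>2\<bar> \<le> m * e / 4 * (norm t + e)"
      using A[OF t] m unfolding norm_mat_map[OF m] norm_fvec_space[OF td] L2_set_power2 by simp
    then have "m * \<bar>(norm (?P t))\<^sup>2 - (norm t)\<^sup>2\<bar> \<le> m * (e / 4 * (norm t + e))"
      by (simp add: right_diff_distrib[symmetric] abs_mult mult.assoc)
    then show ?thesis using m by simp
  qed
  have cont: "continuous_on UNIV ?P" by (rule bounded_linear.continuous_on[OF bounded_linear_mat_map continuous_on_id])
  have "closed {t. \<bar>(norm (?P t))\<^sup>2 - (norm t)\<^sup>2\<bar> \<le> e / 4 * (norm t + e)}"
    by (intro closed_Collect_le continuous_intros cont)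
  moreover have "(\<Union>n. N n) \<subseteq> {t. \<bar>(norm (?P t))\<^sup>2 - (norm t)\<^sup>2\<bar> \<le> e / 4 * (norm t + e)}"
    using key by (auto simp: M_def)
  ultimately have "closure (\<Union>n. N n) \<subseteq> {t. \<bar>(norm (?P t))\<^sup>2 - (norm t)\<^sup>2\<bar> \<le> e / 4 * (norm t + e)}"
    by (intro closure_minimal)
  then show ?thesis using N(4) that[of A] by blast
qed

section \<open>Secants and reach in coordinates\<close>

text \<open>Trivial for \<open>n \<le> e\<close>. Otherwise \<open>n^2 - e / 4 * (n + e)\<close>
  exceeds \<open>(n - e)^2\<close> by \<open>e * (7 / 4 * n - 5 / 4 * e)\<close>, which is positive
  there.\<close>

lemma norm_lower_of_square_dev:
  fixes n p e :: real
  assumes "\<bar>p\<^sup>2 - n\<^sup>2\<bar> \<le> e / 4 * (n + e)" "0 \<le> p" "0 < e"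
  shows "n - e \<le> p"
proof (cases "n \<le> e")
  case False
  have "0 \<le> e * (7 / 4 * n - 5 / 4 * e)" using False assms(3) by (intro mult_nonneg_nonneg) auto
  moreover have "n\<^sup>2 - e / 4 * (n + e) - (n - e)\<^sup>2 = e * (7 / 4 * n - 5 / 4 * e)"
    by (simp add: power2_eq_square field_simps)
  ultimately have "(n - e)\<^sup>2 \<le> n\<^sup>2 - e / 4 * (n + e)" by linarith
  also have "\<dots> \<le> p\<^sup>2" using assms(1) by linarith
  finally show ?thesis using assms(2) by (rule power2_le_imp_le)
qed (use assms(2) in linarith)

text \<open>Projections land in the closure of the set, so secants between limit points matter as
  well; they are limits of secants because \<open>x \<noteq> y\<close> keeps the quotients
  continuous.\<close>

lemma secant_of_closure:
  assumes x: "x \<in> closure Y" and y: "y \<in> closure Y" and ne: "x \<noteq> y"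
  shows "(1 / norm (x - y)) *\<^sub>R (x - y) \<in> closure (unit_secants Y)"
proof -
  obtain a where a: "\<And>n. a n \<in> Y" "a \<longlonglongrightarrow> x" using x by (auto simp: closure_sequential)
  obtain b where b: "\<And>n. b n \<in> Y" "b \<longlonglongrightarrow> y" using y by (auto simp: closure_sequential)
  have lim: "(\<lambda>n. a n - b n) \<longlonglongrightarrow> x - y" by (intro tendsto_diff a b)
  have "(\<lambda>n. (1 / norm (a n - b n)) *\<^sub>R (a n - b n)) \<longlonglongrightarrow> (1 / norm (x - y)) *\<^sub>R (x - y)"
    using ne by (intro tendsto_intros lim) auto
  moreover have "\<forall>\<^sub>F n in sequentially. (1 / norm (a n - b n)) *\<^sub>R (a n - b n) \<in> closure (unit_secants Y)"
  proof -
    have "\<forall>\<^sub>F n in sequentially. a n - b n \<noteq> 0"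
      using tendsto_imp_eventually_ne[OF lim, of 0] ne by simp
    then show ?thesis
    proof (rule eventually_mono)
      fix n assume "a n - b n \<noteq> 0"
      then have "(1 / norm (a n - b n)) *\<^sub>R (a n - b n) \<in> unit_secants Y"
        using a(1) b(1) unfolding unit_secants_def by auto
      then show "(1 / norm (a n - b n)) *\<^sub>R (a n - b n) \<in> closure (unit_secants Y)"
        using closure_subset by blast
    qed
  qed
  ultimately show ?thesis by (rule Lim_in_closed_set[OF closed_closure _ sequentially_bot, rotated])
qed

lemma closure_unit_secants:
  assumes Y: "Y \<subseteq> fvec_space d"
  shows "compact (closure (unit_secants Y))" "closure (unit_secants Y) \<subseteq> fvec_space d"
    and "\<And>s. s \<in> closure (unit_secants Y) \<Longrightarrow> norm s = 1"
    and "\<And>s. s \<in> closure (unit_secants Y) \<Longrightarrow> - s \<in> closure (unit_secants Y)"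
proof -
  let ?U = "unit_secants Y"
  have "?U \<subseteq> fvec_space d"
    using Y unfolding unit_secants_def
    by (auto intro!: subspace_scale subspace_diff subspace_fvec_space)
  then show sub: "closure ?U \<subseteq> fvec_space d" by (rule closure_subset_fvec_space)
  have "?U \<subseteq> {s. norm s = 1}" by (auto simp: unit_secants_def)
  moreover have "closed {s :: fvec. norm s = 1}" by (intro closed_Collect_eq continuous_intros)
  ultimately have n: "closure ?U \<subseteq> {s. norm s = 1}" by (rule closure_minimal)
  then show "norm s = 1" if "s \<in> closure ?U" for s using that by auto
  have "bounded (closure ?U)" unfolding bounded_iff using n by (intro exI[of _ 1]) auto
  then show "compact (closure ?U)" by (intro fvec_space.heine_borel[OF sub]) auto
  have "?U \<subseteq> uminus -` closure ?U"
  proof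
    fix s assume "s \<in> ?U"
    then obtain x y where s: "s = (1 / norm (x - y)) *\<^sub>R (x - y)" "x \<in> Y" "y \<in> Y" "x \<noteq> y"
      by (auto simp: unit_secants_def)
    have "- s = (1 / norm (y - x)) *\<^sub>R (y - x)"
      unfolding s(1) norm_minus_commute[of x y] by (simp add: scaleR_minus_right[symmetric])
    then have "- s \<in> ?U" using s(2-4) unfolding unit_secants_def by blast
    then show "s \<in> uminus -` closure ?U" using closure_subset by auto
  qed
  moreover have "closed (uminus -` closure ?U)"
    by (intro closed_vimage closed_closure continuous_intros)
  ultimately have "closure ?U \<subseteq> uminus -` closure ?U" by (rule closure_minimal)
  then show "- s \<in> closure ?U" if "s \<in> closure ?U" for s using that by auto
qed

lemma gaussian_width_secants:
  assumes X: "X \<subseteq> rvec d"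
  shows "gaussian_width d (secants d X)
    = (\<integral>g. (SUP s\<in>closure (unit_secants (Abs_fvec ` X)). \<Sum>i<d. g i * coord s i) \<partial>gaussian {..<d})"
  unfolding gaussian_width_def gauss_def secants_fvec[OF X] gaussian_def einner_def
  by (simp add: image_image)

text \<open>The reach is a supremum that need not be attained; the strict inequality leaves room for
  an admissible \<sigma> above twice the distance.\<close>

lemma unique_nearest_of_reach:
  assumes X: "X \<subseteq> rvec d" "X \<noteq> {}" and u: "u \<in> rvec d"
    and reach: "pt_set_dist d u X < reach d X / 2"
  obtains \<sigma> where "2 * infdist (Abs_fvec u) (Abs_fvec ` X) < \<sigma>"
    and "\<And>x y z. x \<in> fvec_space d \<Longrightarrow> infdist x (closure (Abs_fvec ` X)) < \<sigma> \<Longrightarrow>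
      y \<in> closure (Abs_fvec ` X) \<Longrightarrow> z \<in> closure (Abs_fvec ` X) \<Longrightarrow>
      dist x y = infdist x (closure (Abs_fvec ` X)) \<Longrightarrow> dist x z = infdist x (closure (Abs_fvec ` X)) \<Longrightarrow> y = z"
proof -
  let ?Y = "Abs_fvec ` X"
  define t where "t = infdist (Abs_fvec u) ?Y"
  have t: "pt_set_dist d u X = ereal t" unfolding t_def by (rule pt_set_dist_fvec[OF X u])
  \<comment> \<open>The case distinction covers infinite reach, as for convex sets.\<close>
  have "ereal (2 * t) < reach d X" using reach unfolding t by (cases "reach d X") auto
  then obtain \<sigma> where \<sigma>: "2 * t < \<sigma>"
    and uniq: "\<forall>x\<in>rvec d. pt_set_dist d x X < ereal \<sigma> \<longrightarrow>
        (\<exists>!y. y \<in> eclosure d X \<and> ereal (edist d x y) = pt_set_dist d x (eclosure d X))"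
    unfolding reach_def less_Sup_iff by auto
  have Y: "?Y \<subseteq> fvec_space d" using X Abs_in_fvec_space by auto
  have cY: "closure ?Y \<subseteq> fvec_space d" by (rule closure_subset_fvec_space[OF Y])
  have ecl: "eclosure d X = coord ` closure ?Y" by (rule eclosure_fvec[OF X(1)])
  have ecl_sub: "eclosure d X \<subseteq> rvec d" unfolding ecl using cY coord_in_rvec by auto
  have Abs_ecl: "Abs_fvec ` eclosure d X = closure ?Y"
    unfolding ecl image_image coord_inverse by simp
  show ?thesis
  proof (rule that[of \<sigma>])
    show "2 * infdist (Abs_fvec u) ?Y < \<sigma>" using \<sigma> by (simp add: t_def)
    fix x y z assume x: "x \<in> fvec_space d" "infdist x (closure ?Y) < \<sigma>"
      and yz: "y \<in> closure ?Y" "z \<in> closure ?Y" "dist x y = infdist x (closure ?Y)" "dist x z = infdist x (closure ?Y)"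
    have xr: "coord x \<in> rvec d" using x(1) by (rule coord_in_rvec)
    have "pt_set_dist d (coord x) X < ereal \<sigma>"
      using x(2) unfolding pt_set_dist_fvec[OF X xr] infdist_closure coord_inverse by simp
    then have ex1: "\<exists>!y. y \<in> eclosure d X \<and> ereal (edist d (coord x) y) = pt_set_dist d (coord x) (eclosure d X)"
      using uniq xr by blast
    have "pt_set_dist d (coord x) (eclosure d X) = ereal (infdist x (closure ?Y))"
    proof -
      have "eclosure d X \<noteq> {}" unfolding ecl using X(2) closure_subset by auto
      from pt_set_dist_fvec[OF ecl_sub this xr] show ?thesis unfolding Abs_ecl coord_inverse .
    qed
    moreover have "edist d (coord x) (coord w) = dist x w" if "w \<in> closure ?Y" for w
      using edist_fvec[OF xr coord_in_rvec, of w] that cY by (auto simp: coord_inverse)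
    ultimately have "coord y = coord z"
      using ex1 yz unfolding ecl by (metis imageI)
    then show "y = z" by (simp add: coord_inject)
  qed
qed

section \<open>Assembling the embedding in coordinates\<close>

definition join_last :: "nat \<Rightarrow> fvec \<times> real \<Rightarrow> nat \<Rightarrow> real" where
  "join_last m p i = (if i < m then coord (fst p) i else if i = m then snd p else 0)"

lemma join_last_in_rvec: "join_last m p \<in> rvec (m + 1)"
  by (simp add: rvec_def join_last_def)

lemma edist_join_last:
  assumes "fst p \<in> fvec_space m" "fst q \<in> fvec_space m"
  shows "edist (m + 1) (join_last m p) (join_last m q) = dist p q"
proof -
  have "fst p - fst q \<in> fvec_space m" using assms by (intro subspace_diff subspace_fvec_space)
  then have "(dist (fst p) (fst q))\<^sup>2 = (\<Sum>i<m. (coord (fst p) i - coord (fst q) i)\<^sup>2)"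
    by (simp add: dist_norm norm_fvec_space L2_set_power2)
  moreover have "(\<Sum>i<m + 1. (join_last m p i - join_last m q i)\<^sup>2)
      = (\<Sum>i<m. (coord (fst p) i - coord (fst q) i)\<^sup>2) + (snd p - snd q)\<^sup>2"
    by (simp add: join_last_def)
  ultimately show ?thesis
    unfolding edist_def enorm_def dist_prod_def by (simp add: dist_real_def)
qed

text \<open>Two distinct points provide a unit secant and thus \<open>1 / 2 \<le> \<omega>\<close>,
  so that the bound on \<open>m\<close> leaves room for a positive dimension.\<close>

lemma embedding_exists:
  assumes X: "X \<subseteq> rvec d" and two: "x0 \<in> X" "y0 \<in> X" "x0 \<noteq> y0" and \<epsilon>: "0 < \<epsilon>" "\<epsilon> < 1"
  obtains m f where "real m \<le> 72000000 * \<epsilon> powr (-2) * (gaussian_width d (secants d X))\<^sup>2"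
    and "terminal_embedding d (m + 1) X \<epsilon> f"
    and "\<And>u. u \<in> rvec d \<Longrightarrow> pt_set_dist d u X < reach d X / 2 \<Longrightarrow>
      \<exists>r>0. \<forall>v\<in>rvec d. \<forall>w\<in>rvec d. edist d v u < r \<longrightarrow> edist d w u < r \<longrightarrow>
        edist (m + 1) (f v) (f w)
          \<le> hoelder_const (real_of_ereal (pt_set_dist d u X)) (\<epsilon> / 20) * edist d v w powr (1 / 4)"
proof -
  define Y where "Y = Abs_fvec ` X"
  define S where "S = closure (unit_secants Y)"
  define T where "T = closure (convex hull S)"
  define \<omega> where "\<omega> = gaussian_width d (secants d X)"
  \<comment> \<open>Small enough for the distortion condition \<open>18 * e \<le> \<epsilon>\<close>
    and for \<open>4 * e < 1\<close>.\<close>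
  define e where "e = \<epsilon> / 20"
  have e: "0 < e" "4 * e < 1" "18 * e \<le> \<epsilon>" using \<epsilon> by (auto simp: e_def)
  have Xne: "X \<noteq> {}" using two by auto
  have Y: "Y \<subseteq> fvec_space d" unfolding Y_def using X Abs_in_fvec_space by auto
  note S = closure_unit_secants[OF Y, folded S_def]
  have "Abs_fvec x0 \<noteq> Abs_fvec y0" using two X Abs_fvec_inj by blast
  then have "(1 / norm (Abs_fvec x0 - Abs_fvec y0)) *\<^sub>R (Abs_fvec x0 - Abs_fvec y0) \<in> S"
    unfolding S_def using two by (intro secant_of_closure closure_subset[THEN subsetD]) (auto simp: Y_def)
  then obtain s0 where s0: "s0 \<in> S" "- s0 \<in> S" using S(4) by blast
  have \<omega>: "\<omega> = (\<integral>g. (SUP s\<in>S. \<Sum>i<d. g i * coord s i) \<partial>gaussian {..<d})"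
    unfolding \<omega>_def S_def Y_def by (rule gaussian_width_secants[OF X])
  have \<omega>_ge: "1 / 2 \<le> \<omega>" unfolding \<omega> by (rule sup_width_ge[OF S(1-3) s0])
  have "convex hull S \<subseteq> fvec_space d"
    by (intro hull_minimal S(2) subspace_imp_convex subspace_fvec_space)
  then have Td: "T \<subseteq> fvec_space d" unfolding T_def by (rule closure_subset_fvec_space)
  have "bounded T" unfolding T_def by (intro bounded_closure bounded_convex_hull compact_imp_bounded S(1))
  then have T: "compact T" "convex T" "T \<noteq> {}" "S \<subseteq> T"
  proof -
    assume "bounded T"
    then show "compact T" by (intro fvec_space.heine_borel[OF Td]) (auto simp: T_def)
    show "convex T" unfolding T_def by (intro convex_closure convex_convex_hull)
    show "S \<subseteq> T" unfolding T_def using hull_subset closure_subset by (metis subset_trans)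
    then show "T \<noteq> {}" using s0 by auto
  qed
  \<comment> \<open>The least real dimension with \<open>300 * \<omega> \<le> e * sqrt k\<close>.
    Since \<open>k \<ge> 1\<close>, rounding up at most doubles it.\<close>
  define k where "k = (300 * \<omega> / e)\<^sup>2"
  define m where "m = nat \<lceil>k\<rceil>"
  have "1 \<le> 300 * \<omega> / e" using \<omega>_ge e by (simp add: field_simps)
  then have k1: "1 \<le> k" unfolding k_def by (rule one_le_power)
  have km: "k \<le> m" unfolding m_def using k1 by linarith
  have m0: "0 < m" using km k1 by (cases m) auto
  have mk: "m \<le> 2 * k" unfolding m_def using k1 by linarith
  have m_le: "real m \<le> 72000000 * \<epsilon> powr (-2) * \<omega>\<^sup>2"
  proof -
    \<comment> \<open>The constant is \<open>2 * (300 * 20)\<^sup>2\<close>.\<close>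
    have "2 * k = 72000000 * (1 / \<epsilon>\<^sup>2) * \<omega>\<^sup>2" using \<epsilon> by (simp add: k_def e_def power_mult_distrib power_divide)
    also have "1 / \<epsilon>\<^sup>2 = \<epsilon> powr (-2)" using \<epsilon> by (simp add: powr_minus_divide)
    finally show ?thesis using mk by linarith
  qed
  have "300 * \<omega> / e = sqrt k" unfolding k_def using \<omega>_ge e by simp
  also have "\<dots> \<le> sqrt m" using km by simp
  finally have "300 * \<omega> \<le> e * sqrt m" using e by (simp add: field_simps)
  then obtain A where A: "\<And>t. t \<in> T \<Longrightarrow> \<bar>(norm (mat_map m d A t))\<^sup>2 - (norm t)\<^sup>2\<bar> \<le> e / 4 * (norm t + e)"
    using exists_mat_map_near_isometry[OF S(1-3) s0 e(1) m0 _ T(1) T_def Td] unfolding \<omega> by blast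
  \<comment> \<open>The construction runs on the closure, where nearest points exist; this changes
    neither distances to the set nor its closed secants. On unit secants the weighted deviation is
    at most \<open>e / 4 * (1 + e)\<close>, hence below \<open>e / 2\<close>.\<close>
  interpret E: outer_extension "fvec_space m" "mat_map m d A" T S e "fvec_space d" "closure Y"
  proof (intro outer_extension.intro near_isometry.intro near_isometry_axioms.intro outer_extension_axioms.intro
      fvec_space.heine_borel_subspace_axioms bounded_linear_mat_map)
    show "norm t - e \<le> norm (mat_map m d A t)" if "t \<in> T" for t
      by (rule norm_lower_of_square_dev[OF A[OF that] norm_ge_zero e(1)])
    show "\<bar>(norm (mat_map m d A s))\<^sup>2 - 1\<bar> \<le> e / 2" if s: "s \<in> S" for s
    proof -
      have "\<bar>(norm (mat_map m d A s))\<^sup>2 - 1\<bar> \<le> e / 4 * (1 + e)" using A[of s] T(4) S(3)[OF s] s by auto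
      also have "\<dots> \<le> e / 4 * 2" using e by (intro mult_left_mono) auto
      finally show ?thesis by simp
    qed
    show "(1 / norm (x - y)) *\<^sub>R (x - y) \<in> S" if "x \<in> closure Y" "y \<in> closure Y" "x \<noteq> y" for x y
      unfolding S_def by (rule secant_of_closure[OF that])
    show "closure Y \<subseteq> fvec_space d" by (rule closure_subset_fvec_space[OF Y])
    show "closure Y \<noteq> {}" using Xne by (simp add: Y_def)
    show "range (mat_map m d A) \<subseteq> fvec_space m" using mat_map_in_space by auto
  qed (use T S e in auto)
  define f where "f x = join_last m (E.emb (Abs_fvec x))" for x
  have f_dist: "edist (m + 1) (f x) (f y) = dist (E.emb (Abs_fvec x)) (E.emb (Abs_fvec y))" for x y
    unfolding f_def by (intro edist_join_last E.fst_emb_in_W)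
  show ?thesis
  proof (rule that[of m f])
    show "real m \<le> 72000000 * \<epsilon> powr (-2) * (gaussian_width d (secants d X))\<^sup>2"
      using m_le by (simp add: \<omega>_def)
    show "terminal_embedding d (m + 1) X \<epsilon> f"
      unfolding terminal_embedding_def
    proof (intro conjI ballI)
      show "f ` rvec d \<subseteq> rvec (m + 1)" unfolding f_def by (intro image_subsetI join_last_in_rvec)
      fix x y assume x: "x \<in> X" and y: "y \<in> rvec d"
      have "Abs_fvec x \<in> closure Y" using x by (intro closure_subset[THEN subsetD]) (auto simp: Y_def)
      note d = E.emb_distortion[OF this e(3) \<epsilon>(2), of "Abs_fvec y"]
      have "edist d x y = dist (Abs_fvec x) (Abs_fvec y)" using x y X by (intro edist_fvec) auto
      then show "(1 - \<epsilon>) * edist d x y \<le> edist (m + 1) (f x) (f y)"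
        "edist (m + 1) (f x) (f y) \<le> (1 + \<epsilon>) * edist d x y"
        using d by (simp_all only: f_dist)
    qed
    fix u assume u: "u \<in> rvec d" and reach: "pt_set_dist d u X < reach d X / 2"
    obtain \<sigma> where \<sigma>: "2 * infdist (Abs_fvec u) Y < \<sigma>"
      and uniq: "\<And>x y z. x \<in> fvec_space d \<Longrightarrow> infdist x (closure Y) < \<sigma> \<Longrightarrow>
        y \<in> closure Y \<Longrightarrow> z \<in> closure Y \<Longrightarrow>
        dist x y = infdist x (closure Y) \<Longrightarrow> dist x z = infdist x (closure Y) \<Longrightarrow> y = z"
      unfolding Y_def by (rule unique_nearest_of_reach[OF X Xne u reach]) blast
    have t: "real_of_ereal (pt_set_dist d u X) = infdist (Abs_fvec u) (closure Y)"
      unfolding pt_set_dist_fvec[OF X Xne u] Y_def infdist_closure by simp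
    have \<sigma>': "2 * infdist (Abs_fvec u) (closure Y) < \<sigma>" using \<sigma> unfolding infdist_closure .
    have "\<exists>r>0. \<forall>v\<in>fvec_space d. \<forall>w\<in>fvec_space d.
        dist v (Abs_fvec u) < r \<longrightarrow> dist w (Abs_fvec u) < r \<longrightarrow>
        dist (E.emb v) (E.emb w) \<le> hoelder_const (infdist (Abs_fvec u) (closure Y)) e * dist v w powr (1 / 4)"
      by (rule E.emb_locally_hoelder[OF _ \<sigma>']) (rule uniq; assumption)
    then obtain r where r: "0 < r" and hoelder: "\<And>v w. v \<in> fvec_space d \<Longrightarrow> w \<in> fvec_space d \<Longrightarrow>
        dist v (Abs_fvec u) < r \<Longrightarrow> dist w (Abs_fvec u) < r \<Longrightarrow>
        dist (E.emb v) (E.emb w) \<le> hoelder_const (infdist (Abs_fvec u) (closure Y)) e * dist v w powr (1 / 4)"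
      by blast
    show "\<exists>r>0. \<forall>v\<in>rvec d. \<forall>w\<in>rvec d. edist d v u < r \<longrightarrow> edist d w u < r \<longrightarrow>
        edist (m + 1) (f v) (f w)
          \<le> hoelder_const (real_of_ereal (pt_set_dist d u X)) (\<epsilon> / 20) * edist d v w powr (1 / 4)"
    proof (intro exI[of _ r] conjI ballI impI r)
      fix v w assume "v \<in> rvec d" "w \<in> rvec d" "edist d v u < r" "edist d w u < r"
      then show "edist (m + 1) (f v) (f w)
          \<le> hoelder_const (real_of_ereal (pt_set_dist d u X)) (\<epsilon> / 20) * edist d v w powr (1 / 4)"
        unfolding f_dist t e_def[symmetric] using hoelder Abs_in_fvec_space u by (simp add: edist_fvec)
    qed
  qed
qed

text \<open>A single point has no secants and hence no lower bound on the width, so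
  \<open>m = 0\<close> is used. The distance to the point is an exact terminal embedding into the
  line and is 1-Lipschitz.\<close>

lemma embedding_singleton:
  assumes x0: "x0 \<in> rvec d" and \<epsilon>: "0 < \<epsilon>"
  obtains f where "terminal_embedding d (0 + 1) {x0} \<epsilon> f"
    and "\<And>v w. v \<in> rvec d \<Longrightarrow> w \<in> rvec d \<Longrightarrow> edist (0 + 1) (f v) (f w) \<le> edist d v w"
proof -
  define f where "f x = (\<lambda>i::nat. if i = 0 then edist d x x0 else 0)" for x
  have fd: "edist (0 + 1) (f v) (f w) = \<bar>edist d v x0 - edist d w x0\<bar>" for v w
    unfolding f_def edist_def[where d = "0 + 1"] enorm_def[where d = "0 + 1"] by simp
  have x00: "edist d x0 x0 = 0" by (simp add: edist_def enorm_def)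
  have sym: "edist d x y = edist d y x" for x y
    unfolding edist_def enorm_def by (simp add: power2_commute)
  have nonneg: "0 \<le> edist d x y" for x y by (simp add: edist_def enorm_def sum_nonneg)
  show ?thesis
  proof (rule that[of f])
    show "terminal_embedding d (0 + 1) {x0} \<epsilon> f"
      unfolding terminal_embedding_def
    proof (intro conjI ballI)
      show "f ` rvec d \<subseteq> rvec (0 + 1)" by (auto simp: f_def rvec_def)
      fix x y assume "x \<in> {x0}"
      then have eq: "edist (0 + 1) (f x) (f y) = edist d x y"
        unfolding fd using nonneg[of x0 y] by (simp add: x00 sym[of y])
      have "0 \<le> \<epsilon> * edist d x y" using \<epsilon> nonneg by simp
      then show "(1 - \<epsilon>) * edist d x y \<le> edist (0 + 1) (f x) (f y)"
        "edist (0 + 1) (f x) (f y) \<le> (1 + \<epsilon>) * edist d x y"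
        unfolding eq by (simp_all add: distrib_right left_diff_distrib)
    qed
    show "edist (0 + 1) (f v) (f w) \<le> edist d v w" if "v \<in> rvec d" "w \<in> rvec d" for v w
      unfolding fd edist_fvec[OF that] edist_fvec[OF that(1) x0] edist_fvec[OF that(2) x0]
      using dist_triangle[of "Abs_fvec v" "Abs_fvec x0" "Abs_fvec w"]
        dist_triangle[of "Abs_fvec w" "Abs_fvec x0" "Abs_fvec v"] by (simp add: dist_commute abs_le_iff)
  qed
qed

text \<open>The function \<open>C\<close> is chosen before \<open>d\<close> and \<open>X\<close>,
  which expresses that the local constant depends only on the distance and on \<epsilon>; the
  neighbourhoods are balls within \<open>rvec d\<close>.\<close>

theorem theorem2:
  "\<exists>c::real. c > 0 \<and>
   (\<exists>C::real \<Rightarrow> real \<Rightarrow> real. (\<forall>t \<epsilon>. C t \<epsilon> > 0) \<and>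
    (\<forall>(d::nat) (X::(nat \<Rightarrow> real) set) (\<epsilon>::real).
       X \<subseteq> rvec d \<longrightarrow> reach d X > 0 \<longrightarrow> 0 < \<epsilon> \<longrightarrow> \<epsilon> < 1 \<longrightarrow>
       (\<exists>(m::nat) (f::(nat \<Rightarrow> real) \<Rightarrow> (nat \<Rightarrow> real)).
          real m \<le> c * \<epsilon> powr (-2) * (gaussian_width d (secants d X))\<^sup>2 \<and>
          terminal_embedding d (m + 1) X \<epsilon> f \<and>
          (\<forall>u\<in>rvec d. pt_set_dist d u X < reach d X / 2 \<longrightarrow>
             (\<exists>r>0. \<forall>v\<in>rvec d. \<forall>w\<in>rvec d.
                edist d v u < r \<longrightarrow> edist d w u < r \<longrightarrow>
                edist (m + 1) (f v) (f w)
                  \<le> C (real_of_ereal (pt_set_dist d u X)) \<epsilon> * edist d v w powr (1/4))))))"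
proof (intro exI[of _ "72000000 :: real"]
    exI[of _ "(\<lambda>t \<epsilon>. max 1 (hoelder_const t (\<epsilon> / 20))) :: real \<Rightarrow> real \<Rightarrow> real"] conjI allI impI)
  fix d X and \<epsilon> :: real
  assume X: "X \<subseteq> rvec d" and \<epsilon>: "0 < \<epsilon>" "\<epsilon> < 1"
  \<comment> \<open>The maximum with 1 makes the constant positive for all real arguments and also
    covers the 1-Lipschitz map of the one-point case.\<close>
  define C where "C t = max 1 (hoelder_const t (\<epsilon> / 20))" for t
  consider "X = {}" | x0 where "X = {x0}" | x0 y0 where "x0 \<in> X" "y0 \<in> X" "x0 \<noteq> y0" by blast
  then have "\<exists>m f. real m \<le> 72000000 * \<epsilon> powr (-2) * (gaussian_width d (secants d X))\<^sup>2 \<and>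
    terminal_embedding d (m + 1) X \<epsilon> f \<and>
    (\<forall>u\<in>rvec d. pt_set_dist d u X < reach d X / 2 \<longrightarrow>
       (\<exists>r>0. \<forall>v\<in>rvec d. \<forall>w\<in>rvec d. edist d v u < r \<longrightarrow> edist d w u < r \<longrightarrow>
          edist (m + 1) (f v) (f w) \<le> C (real_of_ereal (pt_set_dist d u X)) * edist d v w powr (1/4)))"
  proof cases
    case 1
    have "terminal_embedding d (0 + 1) X \<epsilon> (\<lambda>_ _. 0)" by (auto simp: terminal_embedding_def rvec_def 1)
    \<comment> \<open>The infimum over the empty set is infinite, so no point satisfies the strict
      inequality and the local condition is vacuous.\<close>
    moreover have "\<not> pt_set_dist d u X < reach d X / 2" for u by (simp add: pt_set_dist_def 1 top_ereal_def)
    ultimately show ?thesis by (intro exI[of _ 0] exI[of _ "\<lambda>_ _. 0"]) auto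
  next
    case (2 x0)
    obtain f where f: "terminal_embedding d (0 + 1) X \<epsilon> f"
      and lip: "\<And>v w. v \<in> rvec d \<Longrightarrow> w \<in> rvec d \<Longrightarrow> edist (0 + 1) (f v) (f w) \<le> edist d v w"
      using embedding_singleton[of x0 d \<epsilon>] X \<epsilon> unfolding 2 by auto
    have "edist (0 + 1) (f v) (f w) \<le> C t * edist d v w powr (1/4)"
      if u: "u \<in> rvec d" and v: "v \<in> rvec d" "edist d v u < 1 / 2" and w: "w \<in> rvec d" "edist d w u < 1 / 2" for u v w t
    proof -
      \<comment> \<open>Below distance 1 a Lipschitz bound implies the one with exponent 1/4; this
        is why the radius is 1/2.\<close>
      have "edist d v w \<le> 1"
        using dist_triangle2[of "Abs_fvec v" "Abs_fvec w" "Abs_fvec u"] u v w by (simp add: edist_fvec)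
      moreover have "0 \<le> edist d v w" by (simp add: edist_def enorm_def sum_nonneg)
      ultimately have "edist d v w powr 1 \<le> edist d v w powr (1/4)" by (intro powr_mono') auto
      then have "edist d v w \<le> 1 * edist d v w powr (1/4)" using \<open>0 \<le> edist d v w\<close> by simp
      also have "\<dots> \<le> C t * edist d v w powr (1/4)" by (intro mult_right_mono) (auto simp: C_def)
      finally show ?thesis using lip[OF v(1) w(1)] by linarith
    qed
    then have "\<exists>r>0. \<forall>v\<in>rvec d. \<forall>w\<in>rvec d. edist d v u < r \<longrightarrow> edist d w u < r \<longrightarrow>
        edist (0 + 1) (f v) (f w) \<le> C t * edist d v w powr (1/4)" if "u \<in> rvec d" for u t
      using that by (intro exI[of _ "1 / 2"]) auto
    then show ?thesis using f by (intro exI[of _ 0] exI[of _ f]) simp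
  next
    case (3 x0 y0)
    show ?thesis
    proof (rule embedding_exists[OF X 3 \<epsilon>])
      fix m f
      assume m: "real m \<le> 72000000 * \<epsilon> powr (-2) * (gaussian_width d (secants d X))\<^sup>2"
        and f: "terminal_embedding d (m + 1) X \<epsilon> f"
        and h: "\<And>u. u \<in> rvec d \<Longrightarrow> pt_set_dist d u X < reach d X / 2 \<Longrightarrow>
          \<exists>r>0. \<forall>v\<in>rvec d. \<forall>w\<in>rvec d. edist d v u < r \<longrightarrow> edist d w u < r \<longrightarrow>
            edist (m + 1) (f v) (f w)
              \<le> hoelder_const (real_of_ereal (pt_set_dist d u X)) (\<epsilon> / 20) * edist d v w powr (1 / 4)"
      have "hoelder_const t (\<epsilon> / 20) * s powr (1 / 4) \<le> C t * s powr (1 / 4)" for t s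
        by (intro mult_right_mono) (auto simp: C_def)
      then have "\<exists>r>0. \<forall>v\<in>rvec d. \<forall>w\<in>rvec d. edist d v u < r \<longrightarrow> edist d w u < r \<longrightarrow>
            edist (m + 1) (f v) (f w) \<le> C (real_of_ereal (pt_set_dist d u X)) * edist d v w powr (1 / 4)"
        if "u \<in> rvec d" "pt_set_dist d u X < reach d X / 2" for u
        using h[OF that] by (meson order_trans)
      then show ?thesis using m f by blast
    qed
  qed
  then show "\<exists>m f. real m \<le> 72000000 * \<epsilon> powr (-2) * (gaussian_width d (secants d X))\<^sup>2 \<and>
    terminal_embedding d (m + 1) X \<epsilon> f \<and>
    (\<forall>u\<in>rvec d. pt_set_dist d u X < reach d X / 2 \<longrightarrow>
       (\<exists>r>0. \<forall>v\<in>rvec d. \<forall>w\<in>rvec d. edist d v u < r \<longrightarrow> edist d w u < r \<longrightarrow>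
          edist (m + 1) (f v) (f w)
            \<le> max 1 (hoelder_const (real_of_ereal (pt_set_dist d u X)) (\<epsilon> / 20)) * edist d v w powr (1/4)))"
    unfolding C_def .
qed auto

end
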